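(* The integral cohomology of $\mathfrak{T}$ is $$H^q(\mathfrak{T};\mathbb{Z})=\begin{cases}\mathbb{Z}&q=0,2;\\ \mathbb{Z}\oplus\mathbb{Z}&q=3;\\ \mathbb{Z}/2&q=4;\\ 0&\text{otherwise.}\end{cases}$$ All cup products in the reduced cohomology $\tilde{H}^*(\mathfrak{T})$ are zero.
   Context: $\mathfrak{T}:=\{(g,h)\in SU(2)\times SU(2)\mid ghg^{-1}h^{-1}=I\}$ is the space of commuting pairs in $SU(2)$ (with the subspace topology). *)

theory Defs
  imports "HOL-Analysis.Analysis" "HOL-Homology.Homology"
begin

section \<open>Integral singular cohomology\<close>

text \<open>
  As the chain group in degree \<open>p\<close> is free on the singular \<open>p\<close>-simplices, a homomorphism from it
  to the integers is represented by its values on simplices. The value of a cochain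
  outside the singular \<open>p\<close>-simplices of the space is \<open>undefined\<close>.
\<close>

definition cochain_group :: "nat \<Rightarrow> 'a topology \<Rightarrow> (((nat \<Rightarrow> real) \<Rightarrow> 'a) \<Rightarrow> int) monoid"
  where "cochain_group p X = product_group (singular_simplex_set p X) (\<lambda>_. integer_group)"

text \<open>The linear extension of a cochain to singular chains.\<close>

definition cochain_eval :: "(((nat \<Rightarrow> real) \<Rightarrow> 'a) \<Rightarrow> int) \<Rightarrow> 'a chain \<Rightarrow> int"
  where "cochain_eval \<phi> c = (\<Sum>\<sigma>\<in>Poly_Mapping.keys c. Poly_Mapping.lookup c \<sigma> * \<phi> \<sigma>)"

definition coboundary ::
    "nat \<Rightarrow> 'a topology \<Rightarrow> (((nat \<Rightarrow> real) \<Rightarrow> 'a) \<Rightarrow> int) \<Rightarrow> (((nat \<Rightarrow> real) \<Rightarrow> 'a) \<Rightarrow> int)"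
  where "coboundary p X \<phi> =
    (\<lambda>\<sigma>\<in>singular_simplex_set (Suc p) X. cochain_eval \<phi> (chain_boundary (Suc p) (frag_of \<sigma>)))"

definition singular_cocycle_set :: "nat \<Rightarrow> 'a topology \<Rightarrow> (((nat \<Rightarrow> real) \<Rightarrow> 'a) \<Rightarrow> int) set"
  where "singular_cocycle_set p X =
    kernel (cochain_group p X) (cochain_group (Suc p) X) (coboundary p X)"

definition singular_coboundary_set :: "nat \<Rightarrow> 'a topology \<Rightarrow> (((nat \<Rightarrow> real) \<Rightarrow> 'a) \<Rightarrow> int) set"
  where "singular_coboundary_set p X =
    (case p of
       0 \<Rightarrow> {\<one>\<^bsub>cochain_group 0 X\<^esub>}
     | Suc r \<Rightarrow> coboundary r X ` carrier (cochain_group r X))"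

definition cocycle_group :: "nat \<Rightarrow> 'a topology \<Rightarrow> (((nat \<Rightarrow> real) \<Rightarrow> 'a) \<Rightarrow> int) monoid"
  where "cocycle_group p X = subgroup_generated (cochain_group p X) (singular_cocycle_set p X)"

definition cohomology_group :: "nat \<Rightarrow> 'a topology \<Rightarrow> (((nat \<Rightarrow> real) \<Rightarrow> 'a) \<Rightarrow> int) set monoid"
  where "cohomology_group p X = cocycle_group p X Mod singular_coboundary_set p X"

definition cohomology_class ::
    "nat \<Rightarrow> 'a topology \<Rightarrow> (((nat \<Rightarrow> real) \<Rightarrow> 'a) \<Rightarrow> int) \<Rightarrow> (((nat \<Rightarrow> real) \<Rightarrow> 'a) \<Rightarrow> int) set"
  where "cohomology_class p X \<phi> = singular_coboundary_set p X #>\<^bsub>cocycle_group p X\<^esub> \<phi>"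

section \<open>Cup products\<close>

text \<open>
  The restrictions of a singular simplex to the face spanned by the vertices
  \<open>0, \<dots>, p\<close>, respectively \<open>p, \<dots>, p + q\<close>. The standard \<open>p\<close>-simplex consists of sequences
  vanishing beyond index \<open>p\<close>, so the inclusion of the front face is the identity on points
  and that of the back face is a shift by \<open>p\<close>.
\<close>

definition front_face :: "nat \<Rightarrow> ((nat \<Rightarrow> real) \<Rightarrow> 'a) \<Rightarrow> ((nat \<Rightarrow> real) \<Rightarrow> 'a)"
  where "front_face p \<sigma> = restrict \<sigma> (standard_simplex p)"

definition back_face :: "nat \<Rightarrow> nat \<Rightarrow> ((nat \<Rightarrow> real) \<Rightarrow> 'a) \<Rightarrow> ((nat \<Rightarrow> real) \<Rightarrow> 'a)"
  where "back_face p q \<sigma> = (\<lambda>x\<in>standard_simplex q. \<sigma> (\<lambda>i. if i < p then 0 else x (i - p)))"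

definition cup_cochain ::
    "nat \<Rightarrow> nat \<Rightarrow> 'a topology \<Rightarrow> (((nat \<Rightarrow> real) \<Rightarrow> 'a) \<Rightarrow> int) \<Rightarrow> (((nat \<Rightarrow> real) \<Rightarrow> 'a) \<Rightarrow> int) \<Rightarrow>
      (((nat \<Rightarrow> real) \<Rightarrow> 'a) \<Rightarrow> int)"
  where "cup_cochain p q X \<phi> \<psi> =
    (\<lambda>\<sigma>\<in>singular_simplex_set (p + q) X. \<phi> (front_face p \<sigma>) * \<psi> (back_face p q \<sigma>))"

text \<open>
  The operations on cohomology classes below are unions over all representing cocycles;
  since the class obtained does not depend on the representatives, the union is that class.
\<close>

definition cup_product ::
    "nat \<Rightarrow> nat \<Rightarrow> 'a topology \<Rightarrow> (((nat \<Rightarrow> real) \<Rightarrow> 'a) \<Rightarrow> int) set \<Rightarrow> (((nat \<Rightarrow> real) \<Rightarrow> 'a) \<Rightarrow> int) set \<Rightarrow>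
      (((nat \<Rightarrow> real) \<Rightarrow> 'a) \<Rightarrow> int) set"
  where "cup_product p q X a b =
    (\<Union>\<phi>\<in>a. \<Union>\<psi>\<in>b. cohomology_class (p + q) X (cup_cochain p q X \<phi> \<psi>))"

section \<open>Reduced cohomology\<close>

definition cochain_pullback ::
    "nat \<Rightarrow> 'a topology \<Rightarrow> ('a \<Rightarrow> 'b) \<Rightarrow> (((nat \<Rightarrow> real) \<Rightarrow> 'b) \<Rightarrow> int) \<Rightarrow> (((nat \<Rightarrow> real) \<Rightarrow> 'a) \<Rightarrow> int)"
  where "cochain_pullback p X f \<phi> = (\<lambda>\<sigma>\<in>singular_simplex_set p X. \<phi> (simplex_map p f \<sigma>))"

definition cohomology_pullback ::
    "nat \<Rightarrow> 'a topology \<Rightarrow> ('a \<Rightarrow> 'b) \<Rightarrow> (((nat \<Rightarrow> real) \<Rightarrow> 'b) \<Rightarrow> int) set \<Rightarrow>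
      (((nat \<Rightarrow> real) \<Rightarrow> 'a) \<Rightarrow> int) set"
  where "cohomology_pullback p X f a = (\<Union>\<phi>\<in>a. cohomology_class p X (cochain_pullback p X f \<phi>))"

text \<open>
  The reduced cohomology of a space with base point, as the kernel of the restriction to the
  base point. In this form it is an ideal of the cohomology ring, so the cup product of
  reduced classes makes sense in every degree.
\<close>

definition reduced_cohomology ::
    "nat \<Rightarrow> 'a topology \<Rightarrow> 'a \<Rightarrow> (((nat \<Rightarrow> real) \<Rightarrow> 'a) \<Rightarrow> int) set set"
  where "reduced_cohomology p X x\<^sub>0 =
    kernel (cohomology_group p X) (cohomology_group p (subtopology X {x\<^sub>0}))
      (cohomology_pullback p (subtopology X {x\<^sub>0}) id)"

section \<open>Commuting pairs in the special unitary group\<close>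

definition conjugate_transpose :: "complex^'n^'m \<Rightarrow> complex^'m^'n"
  where "conjugate_transpose A = (\<chi> i j. cnj (A $ j $ i))"

definition SU2 :: "(complex^2^2) set"
  where "SU2 = {A. A ** conjugate_transpose A = mat 1 \<and> det A = 1}"

definition commuting_pairs :: "((complex^2^2) \<times> (complex^2^2)) set"
  where "commuting_pairs =
    {(g, h) \<in> SU2 \<times> SU2. g ** h ** matrix_inv g ** matrix_inv h = mat 1}"

definition commuting_pairs_space :: "((complex^2^2) \<times> (complex^2^2)) topology"
  where "commuting_pairs_space = top_of_set commuting_pairs"

end

theory Submission
  imports Defs
begin

text \<open>
  Over \<open>{g \<noteq> -1}\<close> and over \<open>{g \<noteq> 1}\<close> the first component of a commuting pair \<open>(g, h)\<close> can be contracted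
  to a central element inside the centralizer of \<open>h\<close>, so \<open>h\<close> identifies both open sets \<open>U\<close>, \<open>V\<close> with \<open>S^3\<close>
  up to homotopy. On the intersection \<open>h = cos t + v sin t\<close> where \<open>v \<in> S^2\<close> is the direction of the
  imaginary part of \<open>g\<close>, so the intersection is \<open>S^2 \<times> S^1\<close> up to homotopy. The map
  \<open>(v, t) \<mapsto> cos t + v sin t\<close> to \<open>S^3\<close> has degree \<open>2\<close>: it covers twice, by \<open>(v, t)\<close> and \<open>(- v, - t)\<close>, and
  the antipodal map of \<open>S^2\<close> and the reflection of \<open>S^1\<close> both have degree \<open>-1\<close>. Hence in the
  Mayer-Vietoris sequence the map \<open>H^3(S^3) \<oplus> H^3(S^3) \<rightarrow> H^3(S^2 \<times> S^1)\<close> is \<open>(s, t) \<mapsto> 2 (s - t)\<close>, and the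
  groups can be read off. Classes of degree \<open>2\<close> vanish on \<open>U\<close> and on \<open>V\<close> because \<open>H^2(S^3) = 0\<close>, so the
  product of two of them vanishes on \<open>U \<union> V\<close>; all other products of positive degree vanish because
  \<open>H^1\<close> and the groups above degree \<open>4\<close> do.

  Excision and homotopy invariance pass from homology to cohomology because a relatively acyclic
  complex that is free on simplices is contractible.
\<close>

section \<open>Singular cochains\<close>

text \<open>The degree \<open>2\<close> is never obtained by counting preimages. The generator of
  \<open>H^3(S^3)\<close> is pulled back along \<open>h\<close>, and its connecting class for the
  two arcs of the circle factor is compared, over each component of their intersection, with the
  class \<kappa> of the axis of \<open>g\<close>. Where the axes of \<open>g\<close> and
  \<open>h\<close> agree the coefficient is \<open>1\<close>; where they are opposite it is the sign
  of the antipodal map of \<open>S^2\<close>; the top class of \<open>S^2 \<times> S^1\<close> sees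
  the difference. On \<open>S^n\<close> that sign is \<open>(-1)^(n+1)\<close>, so for odd
  \<open>n\<close> the analogous map would have degree \<open>0\<close>: the dimension of the
  imaginary quaternions is what produces the torsion. Classes stay represented by total functions,
  judged only on the simplices of the space at hand. One cochain can thus serve on every subspace,
  and the connecting map can be a relation that commits to no choice of primitives. Quotient groups
  enter only when all coboundaries are known.\<close>

type_synonym 'a cochain = "((nat \<Rightarrow> real) \<Rightarrow> 'a) \<Rightarrow> int"

lemma cochain_eval_superset:
  assumes "finite A" "Poly_Mapping.keys c \<subseteq> A"
  shows "cochain_eval \<phi> c = (\<Sum>\<sigma>\<in>A. Poly_Mapping.lookup c \<sigma> * \<phi> \<sigma>)"
  unfolding cochain_eval_def using assms
  by (intro sum.mono_neutral_left) (auto simp: in_keys_iff)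

lemma cochain_eval_zero [simp]: "cochain_eval \<phi> 0 = 0"
  by (simp add: cochain_eval_def)

lemma cochain_eval_frag_of [simp]: "cochain_eval \<phi> (frag_of \<sigma>) = \<phi> \<sigma>"
  by (simp add: cochain_eval_def)

lemma cochain_eval_add: "cochain_eval \<phi> (a + b) = cochain_eval \<phi> a + cochain_eval \<phi> b"
proof -
  let ?A = "Poly_Mapping.keys a \<union> Poly_Mapping.keys b"
  have "Poly_Mapping.keys (a + b) \<subseteq> ?A" by (rule keys_add)
  then show ?thesis
    by (simp add: cochain_eval_superset[of ?A] lookup_add distrib_right sum.distrib)
qed

lemma cochain_eval_cmul: "cochain_eval \<phi> (frag_cmul k a) = k * cochain_eval \<phi> a"
proof -
  have "Poly_Mapping.keys (frag_cmul k a) \<subseteq> Poly_Mapping.keys a" by (rule keys_cmul)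
  then show ?thesis
    by (simp add: cochain_eval_superset[of "Poly_Mapping.keys a"] sum_distrib_left mult.assoc)
qed

lemma cochain_eval_diff: "cochain_eval \<phi> (a - b) = cochain_eval \<phi> a - cochain_eval \<phi> b"
  using cochain_eval_add[of \<phi> a "- b"] cochain_eval_cmul[of \<phi> "-1" b] by simp

lemma cochain_eval_sum: "cochain_eval \<phi> (sum f I) = (\<Sum>i\<in>I. cochain_eval \<phi> (f i))"
  by (induction I rule: infinite_finite_induct) (simp_all add: cochain_eval_add)

lemma cochain_eval_frag_extend:
  "cochain_eval \<phi> (frag_extend f c) = cochain_eval (\<lambda>\<sigma>. cochain_eval \<phi> (f \<sigma>)) c"
  by (simp add: frag_extend_def cochain_eval_sum cochain_eval_cmul cochain_eval_def[of _ c])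

lemma cochain_eval_cong:
  assumes "\<And>\<sigma>. \<sigma> \<in> Poly_Mapping.keys c \<Longrightarrow> \<phi> \<sigma> = \<psi> \<sigma>"
  shows "cochain_eval \<phi> c = cochain_eval \<psi> c"
  unfolding cochain_eval_def using assms by (intro sum.cong) auto

lemma cochain_eval_eq_0:
  assumes "\<And>\<sigma>. \<sigma> \<in> Poly_Mapping.keys c \<Longrightarrow> \<phi> \<sigma> = 0"
  shows "cochain_eval \<phi> c = 0"
  unfolding cochain_eval_def using assms by (intro sum.neutral) auto

lemma cochain_eval_linear:
  "cochain_eval (\<lambda>\<sigma>. k * \<phi> \<sigma> + l * \<psi> \<sigma>) c = k * cochain_eval \<phi> c + l * cochain_eval \<psi> c"
  by (simp add: cochain_eval_def algebra_simps sum.distrib sum_distrib_left)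

text \<open>The index is the degree of the result, and \<open>chain_boundary 0\<close> is zero, so
  degree \<open>0\<close> needs no separate case. In contrast to \<open>coboundary\<close> nothing
  is restricted: values off the simplices of a space are harmless, and the same function can be used
  on every subspace.\<close>

definition cobd :: "nat \<Rightarrow> 'a cochain \<Rightarrow> 'a cochain"
  where "cobd q \<phi> \<sigma> = cochain_eval \<phi> (chain_boundary q (frag_of \<sigma>))"

lemma chain_boundary_eq_frag_extend:
  "chain_boundary q c = frag_extend (\<lambda>\<sigma>. chain_boundary q (frag_of \<sigma>)) c"
  by (simp add: chain_boundary_def frag_extend_def[of "\<lambda>_. 0"])

lemma cochain_eval_cobd: "cochain_eval (cobd q \<phi>) c = cochain_eval \<phi> (chain_boundary q c)"
  by (subst chain_boundary_eq_frag_extend) (simp add: cochain_eval_frag_extend cobd_def[abs_def])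

lemma cobd_0 [simp]: "cobd 0 \<phi> \<sigma> = 0"
  by (simp add: cobd_def chain_boundary_def)

lemma cobd_Suc:
  "cobd (Suc q) \<phi> \<sigma> = (\<Sum>k\<le>Suc q. (-1) ^ k * \<phi> (singular_face (Suc q) k \<sigma>))"
  by (simp add: cobd_def chain_boundary_of cochain_eval_sum cochain_eval_cmul del: sum.atMost_Suc)

lemma cobd_linear:
  "cobd q (\<lambda>\<sigma>. k * \<phi> \<sigma> + l * \<psi> \<sigma>) \<sigma> = k * cobd q \<phi> \<sigma> + l * cobd q \<psi> \<sigma>"
  by (simp add: cobd_def cochain_eval_linear)

lemma cobd_add: "cobd q (\<lambda>\<sigma>. \<phi> \<sigma> + \<psi> \<sigma>) \<sigma> = cobd q \<phi> \<sigma> + cobd q \<psi> \<sigma>"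
  using cobd_linear[of q 1 \<phi> 1 \<psi>] by simp

lemma cobd_diff: "cobd q (\<lambda>\<sigma>. \<phi> \<sigma> - \<psi> \<sigma>) \<sigma> = cobd q \<phi> \<sigma> - cobd q \<psi> \<sigma>"
  using cobd_linear[of q 1 \<phi> "-1" \<psi>] by simp

lemma cobd_cmul: "cobd q (\<lambda>\<sigma>. k * \<phi> \<sigma>) \<sigma> = k * cobd q \<phi> \<sigma>"
  using cobd_linear[of q k \<phi> 0 \<phi>] by simp

lemma cobd_zero [simp]: "cobd q (\<lambda>\<sigma>. 0) \<sigma> = 0"
  using cobd_cmul[of q 0 "\<lambda>_. 0"] by simp

lemma cobd_cobd:
  assumes "singular_simplex (Suc q) X \<sigma>"
  shows "cobd (Suc q) (cobd q \<phi>) \<sigma> = 0"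
  using assms chain_boundary_boundary_alt[of q X "frag_of \<sigma>"]
  by (simp add: cobd_def[of "Suc q"] cochain_eval_cobd singular_chain_of)

lemma cobd_cong:
  assumes "singular_simplex q X \<sigma>" "\<And>\<tau>. singular_simplex (q - 1) X \<tau> \<Longrightarrow> \<phi> \<tau> = \<psi> \<tau>"
  shows "cobd q \<phi> \<sigma> = cobd q \<psi> \<sigma>"
  unfolding cobd_def using assms singular_chain_boundary[of q X "frag_of \<sigma>"]
  by (intro cochain_eval_cong) (auto simp: singular_chain_of singular_chain_def)

lemma cobd_const_1: "cobd (Suc 0) (\<lambda>_. k) \<sigma> = 0"
  by (simp add: cobd_Suc)

lemma cobd_simplex_map:
  assumes "singular_simplex q X \<sigma>"
  shows "cobd q (\<lambda>\<tau>. \<phi> (simplex_map (q - 1) f \<tau>)) \<sigma> = cobd q \<phi> (simplex_map q f \<sigma>)"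
proof -
  have "cobd q \<phi> (simplex_map q f \<sigma>) = cochain_eval \<phi> (chain_map (q - 1) f (chain_boundary q (frag_of \<sigma>)))"
    using assms chain_boundary_chain_map[of q X "frag_of \<sigma>" f]
    by (simp add: cobd_def singular_chain_of)
  also have "\<dots> = cobd q (\<lambda>\<tau>. \<phi> (simplex_map (q - 1) f \<tau>)) \<sigma>"
    by (simp add: chain_map_def cochain_eval_frag_extend cobd_def)
  finally show ?thesis by simp
qed

definition is_cocycle :: "nat \<Rightarrow> 'a topology \<Rightarrow> 'a cochain \<Rightarrow> bool"
  where "is_cocycle q X \<phi> \<longleftrightarrow> (\<forall>\<sigma>. singular_simplex (Suc q) X \<sigma> \<longrightarrow> cobd (Suc q) \<phi> \<sigma> = 0)"

lemma keys_diff_subset: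
  assumes "Poly_Mapping.keys a \<subseteq> A" "Poly_Mapping.keys b \<subseteq> A"
  shows "Poly_Mapping.keys (a - b :: 'a \<Rightarrow>\<^sub>0 int) \<subseteq> A"
  using assms keys_diff[of a b] by blast

text \<open>
  A complex that is free on simplices and has no homology relative to a subcomplex spanned by
  simplices is contractible relative to it; the contraction \<open>h\<close> is built one simplex at a time.
\<close>

lemma relative_cocycle_is_coboundary:
  fixes S :: "nat \<Rightarrow> ((nat \<Rightarrow> real) \<Rightarrow> 'a) set"
  assumes closed: "\<And>p \<sigma>. \<sigma> \<in> S p \<Longrightarrow> Poly_Mapping.keys (chain_boundary p (frag_of \<sigma>)) \<subseteq> S (p - 1)"
    and acyclic: "\<And>p c. singular_chain p X c \<Longrightarrow> Poly_Mapping.keys (chain_boundary p c) \<subseteq> S (p - 1) \<Longrightarrow>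
      \<exists>d. singular_chain (Suc p) X d \<and> Poly_Mapping.keys (c - chain_boundary (Suc p) d) \<subseteq> S p"
    and \<phi>: "is_cocycle q X \<phi>" "\<And>\<sigma>. \<sigma> \<in> S q \<Longrightarrow> \<phi> \<sigma> = 0"
  shows "\<exists>\<psi>. (\<forall>\<tau>\<in>S (q - 1). \<psi> \<tau> = 0) \<and> (\<forall>\<sigma>. singular_simplex q X \<sigma> \<longrightarrow> \<phi> \<sigma> = cobd q \<psi> \<sigma>)"
proof -
  \<comment> \<open>An arbitrary filling of \<open>c\<close> modulo the span of \<open>S p\<close>;
    it is meaningful only where \<open>acyclic\<close> applies.\<close>
  define pick where "pick p c = (SOME d. singular_chain (Suc p) X d \<and>
      Poly_Mapping.keys (c - chain_boundary (Suc p) d) \<subseteq> S p)" for p and c :: "'a chain"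
  \<comment> \<open>On a simplex outside \<open>S\<close> the contraction fills
    \<open>\<sigma> - h (\<partial> \<sigma>)\<close>; on \<open>S\<close> it is zero. The recursion
    is on the degree, and \<open>prev\<close> below is the linear extension of \<open>h\<close> in
    the preceding degree.\<close>
  define h :: "nat \<Rightarrow> ((nat \<Rightarrow> real) \<Rightarrow> 'a) \<Rightarrow> 'a chain" where
    "h = rec_nat (\<lambda>\<sigma>. if \<sigma> \<in> S 0 then 0 else pick 0 (frag_of \<sigma>))
      (\<lambda>n hn \<sigma>. if \<sigma> \<in> S (Suc n) then 0
        else pick (Suc n) (frag_of \<sigma> - frag_extend hn (chain_boundary (Suc n) (frag_of \<sigma>))))"
  define prev where "prev n c = (if n = 0 then 0 else frag_extend (h (n - 1)) c)" for n and c :: "'a chain"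
  have h_rec: "h n \<sigma> = (if \<sigma> \<in> S n then 0
        else pick n (frag_of \<sigma> - prev n (chain_boundary n (frag_of \<sigma>))))" for n \<sigma>
    by (cases n) (simp_all add: h_def prev_def)
  have prev_diff: "prev n (a - b) = prev n a - prev n b" for n a b
    by (simp add: prev_def frag_extend_diff)
  have prev_S: "prev n c = 0" if "Poly_Mapping.keys c \<subseteq> S (n - 1)" for n c
    using that by (auto simp: prev_def h_rec intro!: frag_extend_eq_0)
  \<comment> \<open>The identity \<open>c = h (\<partial> c) + \<partial> (h c)\<close> of a
    contraction, up to simplices in \<open>S n\<close>.\<close>
  define good where "good n c \<longleftrightarrow> Poly_Mapping.keys (c - prev n (chain_boundary n c)
      - chain_boundary (Suc n) (frag_extend (h n) c)) \<subseteq> S n" for n and c :: "'a chain"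
  have good_diff: "good n (a - b)" if "good n a" "good n b" for n a b
  proof -
    have eq: "(a - b) - prev n (chain_boundary n (a - b))
        - chain_boundary (Suc n) (frag_extend (h n) (a - b)) =
      (a - prev n (chain_boundary n a) - chain_boundary (Suc n) (frag_extend (h n) a)) -
      (b - prev n (chain_boundary n b) - chain_boundary (Suc n) (frag_extend (h n) b))"
      by (simp add: chain_boundary_diff prev_diff frag_extend_diff)
    show ?thesis unfolding good_def eq using that unfolding good_def by (rule keys_diff_subset)
  qed
  have good_simplex_imp: "good n c"
    if "\<And>\<sigma>. singular_simplex n X \<sigma> \<Longrightarrow> good n (frag_of \<sigma>)" "singular_chain n X c" for n c
    using that(2) unfolding singular_chain_def
  proof (induction c rule: frag_induction)
    case zero
    show ?case by (simp add: good_def prev_def)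
  qed (auto simp: that(1) good_diff)
  have main: "singular_chain (Suc n) X (h n \<sigma>) \<and> good n (frag_of \<sigma>)"
    if "singular_simplex n X \<sigma>" for n \<sigma>
    using that
  proof (induction n arbitrary: \<sigma>)
    case 0
    show ?case
    proof (cases "\<sigma> \<in> S 0")
      case True
      then show ?thesis by (simp add: h_rec good_def prev_def keys_frag_of)
    next
      case False
      have "\<exists>d. singular_chain (Suc 0) X d \<and> Poly_Mapping.keys (frag_of \<sigma> - chain_boundary (Suc 0) d) \<subseteq> S 0"
        by (rule acyclic) (use 0 in \<open>simp_all add: singular_chain_of chain_boundary_def\<close>)
      from someI_ex[OF this] show ?thesis
        using False by (simp add: h_rec good_def prev_def pick_def[symmetric])
    qed
  next
    case (Suc n)
    have ch: "singular_chain (Suc n) X (frag_of \<sigma>)" using Suc.prems by (simp add: singular_chain_of)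
    have bch: "singular_chain n X (chain_boundary (Suc n) (frag_of \<sigma>))"
      using ch by (rule singular_chain_boundary_alt)
    show ?case
    proof (cases "\<sigma> \<in> S (Suc n)")
      case True
      then have "prev (Suc n) (chain_boundary (Suc n) (frag_of \<sigma>)) = 0"
        using closed[of \<sigma> "Suc n"] by (intro prev_S) simp
      then show ?thesis using True by (simp add: h_rec good_def keys_frag_of)
    next
      case False
      let ?c = "frag_of \<sigma> - prev (Suc n) (chain_boundary (Suc n) (frag_of \<sigma>))"
      have hc: "singular_chain (Suc n) X (prev (Suc n) (chain_boundary (Suc n) (frag_of \<sigma>)))"
        using Suc.IH bch unfolding prev_def singular_chain_def[of n]
        by (simp add: singular_chain_extend subset_iff)
      \<comment> \<open>The chain \<open>?c\<close> can be filled because its boundary lies in the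
        span of \<open>S n\<close>: for the cycle \<open>\<partial> \<sigma>\<close> the contraction
        identity says exactly that
        \<open>\<partial> \<sigma> - \<partial> (h (\<partial> \<sigma>))\<close> does.\<close>
      have "chain_boundary n (chain_boundary (Suc n) (frag_of \<sigma>)) = 0"
        using ch by (rule chain_boundary_boundary_alt)
      moreover have "good n (chain_boundary (Suc n) (frag_of \<sigma>))"
        by (rule good_simplex_imp) (use Suc.IH bch in auto)
      ultimately have "Poly_Mapping.keys (chain_boundary (Suc n) ?c) \<subseteq> S n"
        by (simp add: good_def prev_def chain_boundary_diff split: if_splits)
      then have "\<exists>d. singular_chain (Suc (Suc n)) X d \<and>
          Poly_Mapping.keys (?c - chain_boundary (Suc (Suc n)) d) \<subseteq> S (Suc n)"
        by (intro acyclic[of "Suc n"] singular_chain_diff) (use ch hc in simp_all)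
      from someI_ex[OF this] show ?thesis
        using False by (simp add: h_rec good_def pick_def[symmetric])
    qed
  qed
  \<comment> \<open>Evaluating \<phi> on
    \<open>\<sigma> = h (\<partial> \<sigma>) + \<partial> (h \<sigma>)\<close> modulo
    \<open>S\<close> leaves the first term: the second vanishes as \<phi> is a cocycle, the
    remainder as \<phi> is zero on \<open>S\<close>. In degree \<open>0\<close> there is no first
    term, hence the default \<open>0\<close>.\<close>
  define \<psi> where "\<psi> \<tau> = (if q = 0 then 0 else cochain_eval \<phi> (h (q - 1) \<tau>))" for \<tau>
  have "\<phi> \<sigma> = cobd q \<psi> \<sigma>" if \<sigma>: "singular_simplex q X \<sigma>" for \<sigma>
  proof -
    let ?b = "chain_boundary q (frag_of \<sigma>)"
    have "good q (frag_of \<sigma>)" "singular_chain (Suc q) X (h q \<sigma>)" using main[OF \<sigma>] by auto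
    then have "cochain_eval \<phi> (frag_of \<sigma> - prev q ?b - chain_boundary (Suc q) (h q \<sigma>)) = 0"
      using \<phi>(2) by (intro cochain_eval_eq_0) (auto simp: good_def)
    moreover have "cochain_eval \<phi> (chain_boundary (Suc q) (h q \<sigma>)) = 0"
      using \<phi>(1) \<open>singular_chain (Suc q) X (h q \<sigma>)\<close>
      unfolding cochain_eval_cobd[symmetric]
      by (intro cochain_eval_eq_0) (auto simp: is_cocycle_def singular_chain_def)
    ultimately have "\<phi> \<sigma> = cochain_eval \<phi> (prev q ?b)"
      by (simp add: cochain_eval_diff)
    also have "\<dots> = cobd q \<psi> \<sigma>"
      by (cases "q = 0") (simp_all add: prev_def \<psi>_def[abs_def] cobd_def cochain_eval_frag_extend)
    finally show ?thesis .
  qed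
  moreover have "\<psi> \<tau> = 0" if "\<tau> \<in> S (q - 1)" for \<tau>
    using that by (simp add: \<psi>_def h_rec)
  ultimately show ?thesis by blast
qed

section \<open>Small simplices and deformation retracts\<close>

text \<open>Iterated barycentric subdivision makes every simplex of \<open>c\<close> small, and the
  natural chain homotopy \<open>h\<close> between it and the identity gives
  \<open>d = - h c\<close>. The remaining term \<open>h (\<partial> c)\<close> is small because
  \<open>h\<close> maps chains of \<open>U\<close> to chains of \<open>U\<close>, and likewise for
  \<open>V\<close>.\<close>

lemma open_cover_small_chain:
  assumes "openin X U" "openin X V" "topspace X \<subseteq> U \<union> V"
  defines "S \<equiv> \<lambda>p. singular_simplex_set p (subtopology X U) \<union> singular_simplex_set p (subtopology X V)"
  assumes c: "singular_chain p X c" "Poly_Mapping.keys (chain_boundary p c) \<subseteq> S (p - 1)"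
  shows "\<exists>d. singular_chain (Suc p) X d \<and> Poly_Mapping.keys (c - chain_boundary (Suc p) d) \<subseteq> S p"
proof -
  obtain n where n: "\<And>m f. \<lbrakk>n \<le> m; f \<in> Poly_Mapping.keys ((singular_subdivision p ^^ m) c)\<rbrakk>
      \<Longrightarrow> \<exists>W \<in> {U, V}. f \<in> standard_simplex p \<rightarrow> W"
    using sufficient_iterated_singular_subdivision_exists[of "{U, V}" X p c] assms by auto
  obtain h :: "nat \<Rightarrow> 'a chain \<Rightarrow> 'a chain" where h:
      "\<And>p c1 c2. h p (c1 - c2) = h p c1 - h p c2"
      "\<And>p X c. singular_chain p X c \<Longrightarrow> singular_chain (Suc p) X (h p c)"
      "\<And>p X c. singular_chain p X c \<Longrightarrow>
        chain_boundary (Suc p) (h p c) + h (p - Suc 0) (chain_boundary p c) = (singular_subdivision p ^^ n) c - c"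
    using chain_homotopic_iterated_singular_subdivision[of n] by metis
  have sd: "singular_chain p X ((singular_subdivision p ^^ m) c)" for m
    by (induction m) (auto simp: singular_chain_singular_subdivision c)
  have small: "Poly_Mapping.keys ((singular_subdivision p ^^ n) c) \<subseteq> S p"
  proof
    fix f assume f: "f \<in> Poly_Mapping.keys ((singular_subdivision p ^^ n) c)"
    then have "singular_simplex p X f" using sd[of n] by (auto simp: singular_chain_def)
    with n[OF order_refl f] show "f \<in> S p"
      by (auto simp: S_def singular_simplex_subtopology)
  qed
  \<comment> \<open>For \<open>p = 0\<close> the index \<open>p - Suc 0\<close> does not drop, so
    this case is settled by \<open>\<partial> c = 0\<close> and \<open>h 0 0 = 0\<close>. For
    \<open>p > 0\<close> the boundary is split into a part in \<open>U\<close> and a part in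
    \<open>V\<close>; as \<open>h\<close> is given as compatible with differences, the sum is read
    as \<open>a - (- b)\<close>.\<close>
  have "\<exists>h'. h (p - Suc 0) (chain_boundary p c) = h' \<and> Poly_Mapping.keys h' \<subseteq> S p"
  proof (cases "p = 0")
    case True
    have "h 0 (0 - 0) = h 0 0 - h 0 0" by (rule h(1))
    then have "h 0 0 = 0" by simp
    then show ?thesis using True by (simp add: chain_boundary_def)
  next
    case False
    obtain a b where ab: "Poly_Mapping.keys a \<subseteq> singular_simplex_set (p - 1) (subtopology X U)"
      "Poly_Mapping.keys b \<subseteq> singular_simplex_set (p - 1) (subtopology X V)" "chain_boundary p c = a + b"
      using frag_split[OF c(2)[unfolded S_def]] by metis
    have "singular_chain p (subtopology X U) (h (p - 1) a)" "singular_chain p (subtopology X V) (h (p - 1) (- b))"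
      using h(2)[of "p - 1" "subtopology X U" a] h(2)[of "p - 1" "subtopology X V" "- b"] ab False
      by (auto simp: singular_chain_def)
    then have "Poly_Mapping.keys (h (p - 1) a - h (p - 1) (- b)) \<subseteq> S p"
      by (intro keys_diff_subset) (auto simp: S_def singular_chain_def)
    then show ?thesis using h(1)[of "p - 1" a "- b"] ab by simp
  qed
  then have "Poly_Mapping.keys ((singular_subdivision p ^^ n) c - h (p - Suc 0) (chain_boundary p c)) \<subseteq> S p"
    using small by (intro keys_diff_subset) auto
  moreover have "(singular_subdivision p ^^ n) c - h (p - Suc 0) (chain_boundary p c)
      = c - chain_boundary (Suc p) (- h p c)"
    using h(3)[OF c(1)] by (simp add: chain_boundary_minus algebra_simps)
  ultimately have "Poly_Mapping.keys (c - chain_boundary (Suc p) (- h p c)) \<subseteq> S p" by simp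
  moreover have "singular_chain (Suc p) X (- h p c)"
    using h(2)[OF c(1)] by (simp add: singular_chain_minus)
  ultimately show ?thesis by blast
qed

text \<open>Excision for cochains: those vanishing on small simplices form an acyclic complex. The
  primitive again vanishes on small simplices, so it can later be subtracted without changing
  anything on \<open>U\<close> or on \<open>V\<close>.\<close>

lemma open_cover_cocycle_is_coboundary:
  assumes "openin X U" "openin X V" "topspace X \<subseteq> U \<union> V"
    and "is_cocycle q X \<phi>"
    and "\<And>\<sigma>. singular_simplex q (subtopology X U) \<sigma> \<Longrightarrow> \<phi> \<sigma> = 0"
    and "\<And>\<sigma>. singular_simplex q (subtopology X V) \<sigma> \<Longrightarrow> \<phi> \<sigma> = 0"
  obtains \<psi> where "\<And>\<tau>. singular_simplex (q - 1) (subtopology X U) \<tau> \<Longrightarrow> \<psi> \<tau> = 0"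
    "\<And>\<tau>. singular_simplex (q - 1) (subtopology X V) \<tau> \<Longrightarrow> \<psi> \<tau> = 0"
    "\<And>\<sigma>. singular_simplex q X \<sigma> \<Longrightarrow> \<phi> \<sigma> = cobd q \<psi> \<sigma>"
proof -
  define S where
    "S p = singular_simplex_set p (subtopology X U) \<union> singular_simplex_set p (subtopology X V)" for p
  have "\<exists>\<psi>. (\<forall>\<tau>\<in>S (q - 1). \<psi> \<tau> = 0) \<and> (\<forall>\<sigma>. singular_simplex q X \<sigma> \<longrightarrow> \<phi> \<sigma> = cobd q \<psi> \<sigma>)"
  proof (rule relative_cocycle_is_coboundary)
    fix p \<sigma> assume "\<sigma> \<in> S p"
    then show "Poly_Mapping.keys (chain_boundary p (frag_of \<sigma>)) \<subseteq> S (p - 1)"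
      using singular_chain_boundary[of p "subtopology X U" "frag_of \<sigma>"]
        singular_chain_boundary[of p "subtopology X V" "frag_of \<sigma>"]
      by (auto simp: S_def singular_chain_of singular_chain_def)
  next
    fix p c assume "singular_chain p X c" "Poly_Mapping.keys (chain_boundary p c) \<subseteq> S (p - 1)"
    then show "\<exists>d. singular_chain (Suc p) X d \<and> Poly_Mapping.keys (c - chain_boundary (Suc p) d) \<subseteq> S p"
      using open_cover_small_chain[OF assms(1-3), of p c] by (simp add: S_def)
  qed (use assms in \<open>auto simp: S_def\<close>)
  then show ?thesis using that by (auto simp: S_def)
qed

section \<open>Cocycles and coboundaries of a space, and the rules for them\<close>

definition is_cobd :: "nat \<Rightarrow> 'a topology \<Rightarrow> 'a cochain \<Rightarrow> bool"
  where "is_cobd q X \<phi> \<longleftrightarrow> (\<exists>\<psi>. \<forall>\<sigma>. singular_simplex q X \<sigma> \<longrightarrow> \<phi> \<sigma> = cobd q \<psi> \<sigma>)"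

text \<open>Coboundaries of the augmented complex: in degree \<open>0\<close> these are the constant cochains.\<close>

definition is_rcobd :: "nat \<Rightarrow> 'a topology \<Rightarrow> 'a cochain \<Rightarrow> bool"
  where "is_rcobd q X \<phi> \<longleftrightarrow> (\<exists>k. is_cobd q X (\<lambda>\<sigma>. \<phi> \<sigma> - k) \<and> (q = 0 \<or> k = 0))"

lemma is_cobdI: "(\<And>\<sigma>. singular_simplex q X \<sigma> \<Longrightarrow> \<phi> \<sigma> = cobd q \<psi> \<sigma>) \<Longrightarrow> is_cobd q X \<phi>"
  unfolding is_cobd_def by blast

lemma is_rcobd_pos: "q > 0 \<Longrightarrow> is_rcobd q X \<phi> \<longleftrightarrow> is_cobd q X \<phi>"
  by (auto simp: is_rcobd_def)

lemma is_rcobd_0: "is_rcobd 0 X \<phi> \<longleftrightarrow> (\<exists>k. \<forall>\<sigma>. singular_simplex 0 X \<sigma> \<longrightarrow> \<phi> \<sigma> = k)"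
  by (auto simp: is_rcobd_def is_cobd_def)

lemma is_cobd_imp_is_rcobd: "is_cobd q X \<phi> \<Longrightarrow> is_rcobd q X \<phi>"
  unfolding is_rcobd_def by (rule exI[of _ 0]) simp

text \<open>Sums, differences, multiples and replacement by a cochain with the same values are all
  instances of this one rule; the equation for \<theta> is required on simplices of \<open>X\<close>
  only.\<close>

lemma is_cobd_lincomb:
  assumes "is_cobd q X \<phi>" "is_cobd q X \<psi>"
    and "\<And>\<sigma>. singular_simplex q X \<sigma> \<Longrightarrow> \<theta> \<sigma> = k * \<phi> \<sigma> + l * \<psi> \<sigma>"
  shows "is_cobd q X \<theta>"
proof -
  obtain a b where "\<And>\<sigma>. singular_simplex q X \<sigma> \<Longrightarrow> \<phi> \<sigma> = cobd q a \<sigma>"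
    "\<And>\<sigma>. singular_simplex q X \<sigma> \<Longrightarrow> \<psi> \<sigma> = cobd q b \<sigma>"
    using assms by (auto simp: is_cobd_def)
  then show ?thesis
    using assms(3) by (intro is_cobdI[where \<psi> = "\<lambda>\<sigma>. k * a \<sigma> + l * b \<sigma>"]) (simp add: cobd_linear)
qed

lemma is_rcobd_lincomb:
  assumes "is_rcobd q X \<phi>" "is_rcobd q X \<psi>"
    and "\<And>\<sigma>. singular_simplex q X \<sigma> \<Longrightarrow> \<theta> \<sigma> = k * \<phi> \<sigma> + l * \<psi> \<sigma>"
  shows "is_rcobd q X \<theta>"
proof -
  obtain m n where "is_cobd q X (\<lambda>\<sigma>. \<phi> \<sigma> - m)" "q = 0 \<or> m = 0"
    "is_cobd q X (\<lambda>\<sigma>. \<psi> \<sigma> - n)" "q = 0 \<or> n = 0"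
    using assms by (auto simp: is_rcobd_def)
  then have "is_cobd q X (\<lambda>\<sigma>. \<theta> \<sigma> - (k * m + l * n))"
    by - (rule is_cobd_lincomb[where k = k and l = l], assumption+, simp add: assms(3) algebra_simps)
  moreover have "q = 0 \<or> k * m + l * n = 0"
    using \<open>q = 0 \<or> m = 0\<close> \<open>q = 0 \<or> n = 0\<close> by auto
  ultimately show ?thesis unfolding is_rcobd_def by blast
qed

lemma is_cocycle_lincomb:
  assumes "is_cocycle q X \<phi>" "is_cocycle q X \<psi>"
    and "\<And>\<sigma>. singular_simplex q X \<sigma> \<Longrightarrow> \<theta> \<sigma> = k * \<phi> \<sigma> + l * \<psi> \<sigma>"
  shows "is_cocycle q X \<theta>"
  unfolding is_cocycle_def
proof (intro allI impI)
  fix \<sigma> assume \<sigma>: "singular_simplex (Suc q) X \<sigma>"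
  then have "cobd (Suc q) \<theta> \<sigma> = cobd (Suc q) (\<lambda>\<sigma>. k * \<phi> \<sigma> + l * \<psi> \<sigma>) \<sigma>"
    using assms(3) by (intro cobd_cong) auto
  then show "cobd (Suc q) \<theta> \<sigma> = 0" using assms(1,2) \<sigma> by (simp add: cobd_linear is_cocycle_def)
qed

lemma is_cocycle_cong:
  "is_cocycle q X \<phi> \<Longrightarrow> (\<And>\<sigma>. singular_simplex q X \<sigma> \<Longrightarrow> \<theta> \<sigma> = \<phi> \<sigma>) \<Longrightarrow> is_cocycle q X \<theta>"
  using is_cocycle_lincomb[of q X \<phi> \<phi> \<theta> 1 0] by simp

lemma is_cobd_cong:
  "is_cobd q X \<phi> \<Longrightarrow> (\<And>\<sigma>. singular_simplex q X \<sigma> \<Longrightarrow> \<theta> \<sigma> = \<phi> \<sigma>) \<Longrightarrow> is_cobd q X \<theta>"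
  using is_cobd_lincomb[of q X \<phi> \<phi> \<theta> 1 0] by simp

lemma is_rcobd_cong:
  "is_rcobd q X \<phi> \<Longrightarrow> (\<And>\<sigma>. singular_simplex q X \<sigma> \<Longrightarrow> \<theta> \<sigma> = \<phi> \<sigma>) \<Longrightarrow> is_rcobd q X \<theta>"
  using is_rcobd_lincomb[of q X \<phi> \<phi> \<theta> 1 0] by simp

lemma is_cobd_zero [simp]: "is_cobd q X (\<lambda>_. 0)"
  by (rule is_cobdI[where \<psi> = "\<lambda>_. 0"]) simp

lemma is_rcobd_zero [simp]: "is_rcobd q X (\<lambda>_. 0)"
  by (simp add: is_cobd_imp_is_rcobd)

lemma is_cocycle_zero [simp]: "is_cocycle q X (\<lambda>_. 0)"
  by (simp add: is_cocycle_def)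

lemma is_cocycle_const: "is_cocycle 0 X (\<lambda>_. k)"
  by (simp add: is_cocycle_def cobd_const_1)

lemma is_cocycle_cobd: "is_cocycle q X (cobd q \<psi>)"
  by (simp add: is_cocycle_def cobd_cobd)

lemma is_rcobd_imp_is_cocycle: "is_rcobd q X \<phi> \<Longrightarrow> is_cocycle q X \<phi>"
proof -
  assume "is_rcobd q X \<phi>"
  then obtain k \<psi> where k: "\<And>\<sigma>. singular_simplex q X \<sigma> \<Longrightarrow> \<phi> \<sigma> - k = cobd q \<psi> \<sigma>" "q = 0 \<or> k = 0"
    by (auto simp: is_rcobd_def is_cobd_def)
  have "is_cocycle q X (\<lambda>_. k)" using k(2) is_cocycle_const by auto
  then show ?thesis
    by (rule is_cocycle_lincomb[OF is_cocycle_cobd[of q X \<psi>], where k = 1 and l = 1])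
      (use k(1) in \<open>simp add: algebra_simps\<close>)
qed

section \<open>Restriction to subspaces and pullback along maps\<close>

lemma singular_simplex_top_of_set_mono:
  "singular_simplex q (top_of_set S) \<sigma> \<Longrightarrow> S \<subseteq> T \<Longrightarrow> singular_simplex q (top_of_set T) \<sigma>"
  by (rule singular_simplex_mono)

lemma singular_simplex_top_of_set_Int:
  "singular_simplex q (top_of_set (S \<inter> T)) \<sigma> \<longleftrightarrow>
    singular_simplex q (top_of_set S) \<sigma> \<and> singular_simplex q (top_of_set T) \<sigma>"
  by (auto simp: singular_simplex_subtopology)

lemma is_cocycle_mono: "is_cocycle q (top_of_set T) \<phi> \<Longrightarrow> S \<subseteq> T \<Longrightarrow> is_cocycle q (top_of_set S) \<phi>"
  unfolding is_cocycle_def by (blast intro: singular_simplex_top_of_set_mono)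

lemma is_cobd_mono: "is_cobd q (top_of_set T) \<phi> \<Longrightarrow> S \<subseteq> T \<Longrightarrow> is_cobd q (top_of_set S) \<phi>"
  unfolding is_cobd_def by (blast intro: singular_simplex_top_of_set_mono)

lemma is_rcobd_mono: "is_rcobd q (top_of_set T) \<phi> \<Longrightarrow> S \<subseteq> T \<Longrightarrow> is_rcobd q (top_of_set S) \<phi>"
  unfolding is_rcobd_def using is_cobd_mono by blast

lemma is_cobd_pullback:
  assumes "is_cobd q Y \<phi>" "continuous_map X Y f"
  shows "is_cobd q X (\<lambda>\<sigma>. \<phi> (simplex_map q f \<sigma>))"
proof -
  obtain \<psi> where "\<And>\<sigma>. singular_simplex q Y \<sigma> \<Longrightarrow> \<phi> \<sigma> = cobd q \<psi> \<sigma>"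
    using assms(1) by (auto simp: is_cobd_def)
  then show ?thesis
    using assms(2)
    by (intro is_cobdI[where \<psi> = "\<lambda>\<tau>. \<psi> (simplex_map (q - 1) f \<tau>)"])
      (simp only: cobd_simplex_map singular_simplex_simplex_map)
qed

lemma is_rcobd_pullback:
  assumes "is_rcobd q Y \<phi>" "continuous_map X Y f"
  shows "is_rcobd q X (\<lambda>\<sigma>. \<phi> (simplex_map q f \<sigma>))"
  using assms is_cobd_pullback[of q Y "\<lambda>\<sigma>. \<phi> \<sigma> - k" X f for k] unfolding is_rcobd_def by blast

lemma is_cocycle_pullback:
  assumes "is_cocycle q Y \<phi>" "continuous_map X Y f"
  shows "is_cocycle q X (\<lambda>\<sigma>. \<phi> (simplex_map q f \<sigma>))"
  unfolding is_cocycle_def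
proof (intro allI impI)
  fix \<sigma> assume \<sigma>: "singular_simplex (Suc q) X \<sigma>"
  show "cobd (Suc q) (\<lambda>\<tau>. \<phi> (simplex_map q f \<tau>)) \<sigma> = 0"
    using cobd_simplex_map[OF \<sigma>, of \<phi> f] assms \<sigma>
    by (simp add: is_cocycle_def singular_simplex_simplex_map)
qed

section \<open>Cohomology of deformation retracts\<close>

lemma simplex_map_simplex_map: "simplex_map q f (simplex_map q g \<sigma>) = simplex_map q (f \<circ> g) \<sigma>"
  by (simp add: simplex_map_compose)

text \<open>The simplices that factor through \<open>i\<close> span the subcomplex. If the boundary
  of \<open>c\<close> lies there, \<open>c - i (f c)\<close> is a cycle, and
  \<open>i \<circ> f\<close>, which is homotopic to the identity, maps it to zero; so it bounds, and
  \<open>c\<close> is homologous to a chain in the subcomplex.\<close>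

lemma deformation_retract_is_cobd:
  assumes f: "continuous_map X Y f" and i: "continuous_map Y X i"
    and fi: "\<And>y. y \<in> topspace Y \<Longrightarrow> f (i y) = y"
    and hom: "homotopic_with (\<lambda>_. True) X X (i \<circ> f) id"
    and \<phi>: "is_cocycle q X \<phi>" "is_cobd q Y (\<lambda>\<sigma>. \<phi> (simplex_map q i \<sigma>))"
  shows "is_cobd q X \<phi>"
proof -
  obtain a where a: "\<And>\<tau>. singular_simplex q Y \<tau> \<Longrightarrow> \<phi> (simplex_map q i \<tau>) = cobd q a \<tau>"
    using \<phi>(2) by (auto simp: is_cobd_def)
  \<comment> \<open>The primitive on \<open>Y\<close> is transported to \<open>X\<close> along
    \<open>f\<close>. Since \<open>f \<circ> i\<close> is the identity on \<open>Y\<close>, its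
    coboundary agrees with \<phi> on the simplices that factor through \<open>i\<close>, and
    subtracting it makes \<phi> vanish there.\<close>
  define a' where "a' \<tau> = a (simplex_map (q - 1) f \<tau>)" for \<tau>
  define S where "S p = simplex_map p i ` singular_simplex_set p Y" for p
  have fi_simplex: "simplex_map p f (simplex_map p i \<tau>) = \<tau>" if "singular_simplex p Y \<tau>" for p \<tau>
    unfolding simplex_map_simplex_map using that by (rule simplex_map_id_gen) (simp add: fi)
  have fi_chain: "chain_map p f (chain_map p i c) = c" if "singular_chain p Y c" for p c
    using chain_map_compose[of p f i] chain_map_id_gen[OF that, of "f \<circ> i"] by (simp add: fi)
  have S_image: "\<exists>e. singular_chain p Y e \<and> c = chain_map p i e" if "Poly_Mapping.keys c \<subseteq> S p" for p c
    using that
  proof (induction c rule: frag_induction)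
    case zero
    show ?case by (rule exI[of _ 0]) simp
  next
    case (one x)
    then obtain \<tau> where "singular_simplex p Y \<tau>" "x = simplex_map p i \<tau>" by (auto simp: S_def)
    then show ?case by (intro exI[of _ "frag_of \<tau>"]) (simp add: singular_chain_of)
  next
    case (diff a b)
    then show ?case by (metis chain_map_diff singular_chain_diff)
  qed
  have image_S: "Poly_Mapping.keys (chain_map p i e) \<subseteq> S p" if "singular_chain p Y e" for p e
    using that keys_frag_extend[of "frag_of \<circ> simplex_map p i" e]
    by (fastforce simp: chain_map_def S_def singular_chain_def keys_frag_of)
  have "\<exists>\<psi>. (\<forall>\<tau>\<in>S (q - 1). \<psi> \<tau> = 0) \<and>
      (\<forall>\<sigma>. singular_simplex q X \<sigma> \<longrightarrow> \<phi> \<sigma> - cobd q a' \<sigma> = cobd q \<psi> \<sigma>)"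
  proof (rule relative_cocycle_is_coboundary)
    fix p \<sigma> assume "\<sigma> \<in> S p"
    then obtain \<tau> where \<tau>: "singular_simplex p Y \<tau>" "\<sigma> = simplex_map p i \<tau>" by (auto simp: S_def)
    then have "chain_boundary p (frag_of \<sigma>) = chain_map (p - 1) i (chain_boundary p (frag_of \<tau>))"
      using chain_boundary_chain_map[of p Y "frag_of \<tau>" i] by (simp add: singular_chain_of)
    then show "Poly_Mapping.keys (chain_boundary p (frag_of \<sigma>)) \<subseteq> S (p - 1)"
      using image_S[of "p - 1" "chain_boundary p (frag_of \<tau>)"] \<tau>(1)
        singular_chain_boundary[of p Y "frag_of \<tau>"]
      by (simp add: singular_chain_of)
  next
    fix p c assume c: "singular_chain p X c" and bd: "Poly_Mapping.keys (chain_boundary p c) \<subseteq> S (p - 1)"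
    obtain e where e: "singular_chain (p - 1) Y e" "chain_boundary p c = chain_map (p - 1) i e"
      using S_image[OF bd] by blast
    let ?r = "\<lambda>c. chain_map p i (chain_map p f c)"
    have fc: "singular_chain p Y (chain_map p f c)" using c f by (rule singular_chain_chain_map)
    have rc: "singular_chain p X (?r c)" using fc i by (rule singular_chain_chain_map)
    let ?z = "c - ?r c"
    have "chain_boundary p (?r c) = chain_boundary p c"
      using chain_boundary_chain_map[OF fc, of i] chain_boundary_chain_map[OF c, of f] fi_chain[OF e(1)] e(2)
      by simp
    then have "singular_relcycle p X {} ?z"
      using c rc by (simp add: singular_cycle singular_chain_diff chain_boundary_diff)
    moreover have "homotopic_with (\<lambda>h. h \<in> {} \<rightarrow> {}) X X (i \<circ> f) id" using hom by simp
    ultimately have "homologous_rel p X {} (chain_map p (i \<circ> f) ?z) (chain_map p id ?z)"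
      by (intro homotopic_imp_homologous_rel_chain_maps)
    moreover have "chain_map p (i \<circ> f) ?z = 0"
      by (simp add: chain_map_compose chain_map_diff fi_chain[OF fc])
    moreover have "chain_map p id ?z = ?z" by (rule chain_map_ident[OF singular_chain_diff[OF c rc]])
    ultimately have "homologous_rel p X {} 0 ?z" by simp
    then obtain d where d: "singular_chain (Suc p) X d" "chain_boundary (Suc p) d = 0 - ?z"
      unfolding homologous_rel_def singular_boundary by blast
    have "c - chain_boundary (Suc p) (- d) = ?r c" using d(2) by (simp add: chain_boundary_minus)
    then have "Poly_Mapping.keys (c - chain_boundary (Suc p) (- d)) \<subseteq> S p" using image_S[OF fc] by simp
    then show "\<exists>d. singular_chain (Suc p) X d \<and> Poly_Mapping.keys (c - chain_boundary (Suc p) d) \<subseteq> S p"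
      using d(1) singular_chain_minus by metis
  next
    show "is_cocycle q X (\<lambda>\<sigma>. \<phi> \<sigma> - cobd q a' \<sigma>)"
      by (rule is_cocycle_lincomb[OF \<phi>(1) is_cocycle_cobd[of q X a'], where k = 1 and l = "-1"]) simp
  next
    fix \<sigma> assume "\<sigma> \<in> S q"
    then obtain \<tau> where \<tau>: "singular_simplex q Y \<tau>" "\<sigma> = simplex_map q i \<tau>" by (auto simp: S_def)
    have "cobd q a' \<sigma> = cobd q a \<tau>"
      using cobd_simplex_map[OF singular_simplex_simplex_map[OF \<tau>(1) i], of a f] fi_simplex[OF \<tau>(1)] \<tau>(2)
      by (simp add: a'_def[abs_def])
    then show "\<phi> \<sigma> - cobd q a' \<sigma> = 0" using a[OF \<tau>(1)] \<tau>(2) by simp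
  qed
  then obtain \<psi> where "\<And>\<sigma>. singular_simplex q X \<sigma> \<Longrightarrow> \<phi> \<sigma> - cobd q a' \<sigma> = cobd q \<psi> \<sigma>" by blast
  then show ?thesis
    by (intro is_cobdI[where \<psi> = "\<lambda>\<tau>. a' \<tau> + \<psi> \<tau>"]) (simp add: cobd_add algebra_simps)
qed

lemma deformation_retract_is_rcobd:
  assumes "continuous_map X Y f" "continuous_map Y X i"
    and "\<And>y. y \<in> topspace Y \<Longrightarrow> f (i y) = y"
    and "homotopic_with (\<lambda>_. True) X X (i \<circ> f) id"
    and \<phi>: "is_cocycle q X \<phi>" "is_rcobd q Y (\<lambda>\<sigma>. \<phi> (simplex_map q i \<sigma>))"
  shows "is_rcobd q X \<phi>"
proof -
  obtain k where k: "is_cobd q Y (\<lambda>\<sigma>. \<phi> (simplex_map q i \<sigma>) - k)" "q = 0 \<or> k = 0"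
    using \<phi>(2) by (auto simp: is_rcobd_def)
  have "is_cocycle q X (\<lambda>_. k)" using k(2) is_cocycle_const by auto
  then have "is_cocycle q X (\<lambda>\<sigma>. \<phi> \<sigma> - k)"
    by (rule is_cocycle_lincomb[OF \<phi>(1), where k = 1 and l = "-1"]) simp
  then have "is_cobd q X (\<lambda>\<sigma>. \<phi> \<sigma> - k)"
    using deformation_retract_is_cobd[OF assms(1-4), of q "\<lambda>\<sigma>. \<phi> \<sigma> - k"] k(1) by simp
  then show ?thesis using k(2) unfolding is_rcobd_def by blast
qed

section \<open>The Mayer-Vietoris sequence\<close>

text \<open>Openness is relative to the union, so that the union itself plays the role of the space;
  it need not be open in the type.\<close>

definition open_pair :: "'a::topological_space set \<Rightarrow> 'a set \<Rightarrow> bool"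
  where "open_pair U V \<longleftrightarrow> openin (top_of_set (U \<union> V)) U \<and> openin (top_of_set (U \<union> V)) V"

lemma open_pair_cocycle_is_coboundary:
  assumes "open_pair U V" "is_cocycle q (top_of_set (U \<union> V)) \<phi>"
    and "\<And>\<sigma>. singular_simplex q (top_of_set U) \<sigma> \<Longrightarrow> \<phi> \<sigma> = 0"
    and "\<And>\<sigma>. singular_simplex q (top_of_set V) \<sigma> \<Longrightarrow> \<phi> \<sigma> = 0"
  shows "\<exists>\<psi>. (\<forall>\<tau>. singular_simplex (q - 1) (top_of_set U) \<tau> \<longrightarrow> \<psi> \<tau> = 0) \<and>
    (\<forall>\<tau>. singular_simplex (q - 1) (top_of_set V) \<tau> \<longrightarrow> \<psi> \<tau> = 0) \<and>
    (\<forall>\<sigma>. singular_simplex q (top_of_set (U \<union> V)) \<sigma> \<longrightarrow> \<phi> \<sigma> = cobd q \<psi> \<sigma>)"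
proof -
  have eq: "subtopology (top_of_set (U \<union> V)) U = top_of_set U"
    "subtopology (top_of_set (U \<union> V)) V = top_of_set V"
    by (simp_all add: subtopology_subtopology Int_absorb1)
  show ?thesis
    by (rule open_cover_cocycle_is_coboundary[of "top_of_set (U \<union> V)" U V q \<phi>])
      (use assms in \<open>auto simp: open_pair_def eq\<close>)
qed

text \<open>
  The connecting homomorphism of the Mayer-Vietoris sequence, as a relation between \<open>Suc q\<close>-cochains
  on the union and \<open>q\<close>-cochains on the intersection.
\<close>

definition conn :: "nat \<Rightarrow> 'a::topological_space set \<Rightarrow> 'a set \<Rightarrow> 'a cochain \<Rightarrow> 'a cochain \<Rightarrow> bool"
  where "conn q U V \<phi> \<kappa> \<longleftrightarrow> (\<exists>a b.
    (\<forall>\<sigma>. singular_simplex (Suc q) (top_of_set U) \<sigma> \<longrightarrow> \<phi> \<sigma> = cobd (Suc q) a \<sigma>) \<and>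
    (\<forall>\<sigma>. singular_simplex (Suc q) (top_of_set V) \<sigma> \<longrightarrow> \<phi> \<sigma> = cobd (Suc q) b \<sigma>) \<and>
    is_rcobd q (top_of_set (U \<inter> V)) (\<lambda>\<sigma>. a \<sigma> - b \<sigma> - \<kappa> \<sigma>))"

lemma connI:
  assumes "\<And>\<sigma>. singular_simplex (Suc q) (top_of_set U) \<sigma> \<Longrightarrow> \<phi> \<sigma> = cobd (Suc q) a \<sigma>"
    and "\<And>\<sigma>. singular_simplex (Suc q) (top_of_set V) \<sigma> \<Longrightarrow> \<phi> \<sigma> = cobd (Suc q) b \<sigma>"
    and "is_rcobd q (top_of_set (U \<inter> V)) (\<lambda>\<sigma>. a \<sigma> - b \<sigma> - \<kappa> \<sigma>)"
  shows "conn q U V \<phi> \<kappa>"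
  unfolding conn_def using assms by blast

lemma connE:
  assumes "conn q U V \<phi> \<kappa>"
  obtains a b where "\<And>\<sigma>. singular_simplex (Suc q) (top_of_set U) \<sigma> \<Longrightarrow> \<phi> \<sigma> = cobd (Suc q) a \<sigma>"
    "\<And>\<sigma>. singular_simplex (Suc q) (top_of_set V) \<sigma> \<Longrightarrow> \<phi> \<sigma> = cobd (Suc q) b \<sigma>"
    "is_rcobd q (top_of_set (U \<inter> V)) (\<lambda>\<sigma>. a \<sigma> - b \<sigma> - \<kappa> \<sigma>)"
  using assms unfolding conn_def by blast

lemma conn_lincomb:
  assumes "conn q U V \<phi> \<kappa>" "conn q U V \<psi> \<mu>"
    and "\<And>\<sigma>. singular_simplex (Suc q) (top_of_set (U \<union> V)) \<sigma> \<Longrightarrow> \<theta> \<sigma> = k * \<phi> \<sigma> + l * \<psi> \<sigma>"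
    and "is_rcobd q (top_of_set (U \<inter> V)) (\<lambda>\<sigma>. \<nu> \<sigma> - (k * \<kappa> \<sigma> + l * \<mu> \<sigma>))"
  shows "conn q U V \<theta> \<nu>"
proof -
  from assms(1) obtain a b where ab:
    "\<And>\<sigma>. singular_simplex (Suc q) (top_of_set U) \<sigma> \<Longrightarrow> \<phi> \<sigma> = cobd (Suc q) a \<sigma>"
    "\<And>\<sigma>. singular_simplex (Suc q) (top_of_set V) \<sigma> \<Longrightarrow> \<phi> \<sigma> = cobd (Suc q) b \<sigma>"
    "is_rcobd q (top_of_set (U \<inter> V)) (\<lambda>\<sigma>. a \<sigma> - b \<sigma> - \<kappa> \<sigma>)" by (rule connE) blast
  from assms(2) obtain c d where cd:
    "\<And>\<sigma>. singular_simplex (Suc q) (top_of_set U) \<sigma> \<Longrightarrow> \<psi> \<sigma> = cobd (Suc q) c \<sigma>"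
    "\<And>\<sigma>. singular_simplex (Suc q) (top_of_set V) \<sigma> \<Longrightarrow> \<psi> \<sigma> = cobd (Suc q) d \<sigma>"
    "is_rcobd q (top_of_set (U \<inter> V)) (\<lambda>\<sigma>. c \<sigma> - d \<sigma> - \<mu> \<sigma>)" by (rule connE) blast
  have "is_rcobd q (top_of_set (U \<inter> V))
      (\<lambda>\<sigma>. k * (a \<sigma> - b \<sigma> - \<kappa> \<sigma>) + l * (c \<sigma> - d \<sigma> - \<mu> \<sigma>))"
    by (rule is_rcobd_lincomb[OF ab(3) cd(3)]) simp
  then have r: "is_rcobd q (top_of_set (U \<inter> V))
      (\<lambda>\<sigma>. (k * a \<sigma> + l * c \<sigma>) - (k * b \<sigma> + l * d \<sigma>) - \<nu> \<sigma>)"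
    by (rule is_rcobd_lincomb[OF _ assms(4), where k = 1 and l = "-1"]) (simp add: algebra_simps)
  show ?thesis
  proof (rule connI[OF _ _ r])
    fix \<sigma> assume "singular_simplex (Suc q) (top_of_set U) \<sigma>"
    then show "\<theta> \<sigma> = cobd (Suc q) (\<lambda>\<sigma>. k * a \<sigma> + l * c \<sigma>) \<sigma>"
      using assms(3)[of \<sigma>] singular_simplex_top_of_set_mono[of "Suc q" U \<sigma> "U \<union> V"]
      by (simp add: cobd_linear ab cd)
  next
    fix \<sigma> assume "singular_simplex (Suc q) (top_of_set V) \<sigma>"
    then show "\<theta> \<sigma> = cobd (Suc q) (\<lambda>\<sigma>. k * b \<sigma> + l * d \<sigma>) \<sigma>"
      using assms(3)[of \<sigma>] singular_simplex_top_of_set_mono[of "Suc q" V \<sigma> "U \<union> V"]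
      by (simp add: cobd_linear ab cd)
  qed
qed

lemma conn_cong:
  assumes "conn q U V \<phi> \<kappa>"
    and "\<And>\<sigma>. singular_simplex (Suc q) (top_of_set (U \<union> V)) \<sigma> \<Longrightarrow> \<theta> \<sigma> = \<phi> \<sigma>"
    and "is_rcobd q (top_of_set (U \<inter> V)) (\<lambda>\<sigma>. \<nu> \<sigma> - \<kappa> \<sigma>)"
  shows "conn q U V \<theta> \<nu>"
  by (rule conn_lincomb[OF assms(1,1), where k = 1 and l = 0]) (use assms(2,3) in auto)

text \<open>The two primitives change places. This sign is the reason why the antipodal degree
  alternates with the dimension of the sphere.\<close>

lemma conn_commute:
  assumes "conn q U V \<phi> \<kappa>"
  shows "conn q V U \<phi> (\<lambda>\<sigma>. - \<kappa> \<sigma>)"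
proof -
  from assms obtain a b where ab:
    "\<And>\<sigma>. singular_simplex (Suc q) (top_of_set U) \<sigma> \<Longrightarrow> \<phi> \<sigma> = cobd (Suc q) a \<sigma>"
    "\<And>\<sigma>. singular_simplex (Suc q) (top_of_set V) \<sigma> \<Longrightarrow> \<phi> \<sigma> = cobd (Suc q) b \<sigma>"
    "is_rcobd q (top_of_set (U \<inter> V)) (\<lambda>\<sigma>. a \<sigma> - b \<sigma> - \<kappa> \<sigma>)" by (rule connE) blast
  have "is_rcobd q (top_of_set (V \<inter> U)) (\<lambda>\<sigma>. b \<sigma> - a \<sigma> - - \<kappa> \<sigma>)"
    unfolding Int_commute[of V] by (rule is_rcobd_lincomb[OF ab(3,3), where k = "-1" and l = 0]) simp
  then show ?thesis using ab(1,2) by (intro connI[of q V \<phi> b U a])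
qed

lemma conn_pullback:
  assumes "conn q U' V' \<phi> \<kappa>" "continuous_map (top_of_set U) (top_of_set U') f"
    and "continuous_map (top_of_set V) (top_of_set V') f"
  shows "conn q U V (\<lambda>\<sigma>. \<phi> (simplex_map (Suc q) f \<sigma>)) (\<lambda>\<sigma>. \<kappa> (simplex_map q f \<sigma>))"
proof -
  from assms(1) obtain a b where ab:
    "\<And>\<sigma>. singular_simplex (Suc q) (top_of_set U') \<sigma> \<Longrightarrow> \<phi> \<sigma> = cobd (Suc q) a \<sigma>"
    "\<And>\<sigma>. singular_simplex (Suc q) (top_of_set V') \<sigma> \<Longrightarrow> \<phi> \<sigma> = cobd (Suc q) b \<sigma>"
    "is_rcobd q (top_of_set (U' \<inter> V')) (\<lambda>\<sigma>. a \<sigma> - b \<sigma> - \<kappa> \<sigma>)" by (rule connE) blast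
  have "continuous_map (top_of_set (U \<inter> V)) (top_of_set (U' \<inter> V')) f"
    using assms(2,3) continuous_on_subset[of U f "U \<inter> V"] by (auto simp: Pi_iff)
  note r = is_rcobd_pullback[OF ab(3) this]
  show ?thesis
  proof (rule connI[OF _ _ r])
    fix \<sigma> assume \<sigma>: "singular_simplex (Suc q) (top_of_set U) \<sigma>"
    from ab(1)[OF singular_simplex_simplex_map[OF this assms(2)]] cobd_simplex_map[OF \<sigma>, of a f]
    show "\<phi> (simplex_map (Suc q) f \<sigma>) = cobd (Suc q) (\<lambda>\<sigma>. a (simplex_map q f \<sigma>)) \<sigma>" by simp
  next
    fix \<sigma> assume \<sigma>: "singular_simplex (Suc q) (top_of_set V) \<sigma>"
    from ab(2)[OF singular_simplex_simplex_map[OF this assms(3)]] cobd_simplex_map[OF \<sigma>, of b f]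
    show "\<phi> (simplex_map (Suc q) f \<sigma>) = cobd (Suc q) (\<lambda>\<sigma>. b (simplex_map q f \<sigma>)) \<sigma>" by simp
  qed
qed

text \<open>Exactness at the cohomology of the union. After subtracting \<alpha> and \<beta>, the
  primitives on \<open>U\<close> and \<open>V\<close> differ on the intersection by a coboundary
  and, in degree \<open>0\<close>, a constant; once this is absorbed they glue. The glued cochain is
  a primitive on small simplices, and excision supplies the rest.\<close>

lemma conn_imp_is_cobd:
  assumes UV: "open_pair U V" and \<phi>: "is_cocycle (Suc q) (top_of_set (U \<union> V)) \<phi>"
    and c: "conn q U V \<phi> \<kappa>" and \<alpha>: "is_cocycle q (top_of_set U) \<alpha>" and \<beta>: "is_cocycle q (top_of_set V) \<beta>"
    and r: "is_rcobd q (top_of_set (U \<inter> V)) (\<lambda>\<sigma>. \<kappa> \<sigma> - (\<alpha> \<sigma> - \<beta> \<sigma>))"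
  shows "is_cobd (Suc q) (top_of_set (U \<union> V)) \<phi>"
proof -
  from c obtain a b where ab:
    "\<And>\<sigma>. singular_simplex (Suc q) (top_of_set U) \<sigma> \<Longrightarrow> \<phi> \<sigma> = cobd (Suc q) a \<sigma>"
    "\<And>\<sigma>. singular_simplex (Suc q) (top_of_set V) \<sigma> \<Longrightarrow> \<phi> \<sigma> = cobd (Suc q) b \<sigma>"
    "is_rcobd q (top_of_set (U \<inter> V)) (\<lambda>\<sigma>. a \<sigma> - b \<sigma> - \<kappa> \<sigma>)" by (rule connE) blast
  have "is_rcobd q (top_of_set (U \<inter> V)) (\<lambda>\<sigma>. (a \<sigma> - \<alpha> \<sigma>) - (b \<sigma> - \<beta> \<sigma>))"
    by (rule is_rcobd_lincomb[OF ab(3) r, where k = 1 and l = 1]) simp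
  then obtain e k where e: "\<And>\<sigma>. singular_simplex q (top_of_set (U \<inter> V)) \<sigma> \<Longrightarrow>
      (a \<sigma> - \<alpha> \<sigma>) - (b \<sigma> - \<beta> \<sigma>) - k = cobd q e \<sigma>" "q = 0 \<or> k = 0"
    by (auto simp: is_rcobd_def is_cobd_def)
  \<comment> \<open>The discrepancy is absorbed on the side of \<open>U\<close>. No extension of
    \<open>e\<close> from the intersection to \<open>U\<close> has to be constructed, as
    \<open>e\<close> is a function on all maps.\<close>
  define c where "c \<sigma> = (if singular_simplex q (top_of_set U) \<sigma> then a \<sigma> - \<alpha> \<sigma> - cobd q e \<sigma> - k
      else b \<sigma> - \<beta> \<sigma>)" for \<sigma>
  have c_V: "c \<sigma> = b \<sigma> - \<beta> \<sigma>" if "singular_simplex q (top_of_set V) \<sigma>" for \<sigma>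
    using e(1)[of \<sigma>] that by (auto simp: c_def singular_simplex_top_of_set_Int)
  have k: "cobd (Suc q) (\<lambda>_. k) \<sigma> = 0" for \<sigma> using e(2) cobd_const_1 by auto
  have U: "\<phi> \<sigma> - cobd (Suc q) c \<sigma> = 0" if \<sigma>: "singular_simplex (Suc q) (top_of_set U) \<sigma>" for \<sigma>
  proof -
    have "cobd (Suc q) c \<sigma> = cobd (Suc q) (\<lambda>\<sigma>. a \<sigma> - \<alpha> \<sigma> - cobd q e \<sigma> - k) \<sigma>"
      using \<sigma> by (rule cobd_cong) (simp add: c_def)
    then show ?thesis
      using \<sigma> \<alpha> unfolding is_cocycle_def by (simp add: cobd_diff k cobd_cobd[OF \<sigma>] ab(1)[OF \<sigma>])
  qed
  have V: "\<phi> \<sigma> - cobd (Suc q) c \<sigma> = 0" if \<sigma>: "singular_simplex (Suc q) (top_of_set V) \<sigma>" for \<sigma>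
  proof -
    have "cobd (Suc q) c \<sigma> = cobd (Suc q) (\<lambda>\<sigma>. b \<sigma> - \<beta> \<sigma>) \<sigma>"
      using \<sigma> by (rule cobd_cong) (simp add: c_V)
    then show ?thesis
      using \<sigma> \<beta> unfolding is_cocycle_def by (simp add: cobd_diff ab(2)[OF \<sigma>])
  qed
  have "is_cocycle (Suc q) (top_of_set (U \<union> V)) (\<lambda>\<sigma>. \<phi> \<sigma> - cobd (Suc q) c \<sigma>)"
    by (rule is_cocycle_lincomb[OF \<phi> is_cocycle_cobd[of "Suc q" _ c], where k = 1 and l = "-1"]) simp
  from open_pair_cocycle_is_coboundary[OF UV this U V] obtain \<psi> where
    "\<And>\<sigma>. singular_simplex (Suc q) (top_of_set (U \<union> V)) \<sigma> \<Longrightarrow> \<phi> \<sigma> - cobd (Suc q) c \<sigma> = cobd (Suc q) \<psi> \<sigma>"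
    by blast
  then show ?thesis
    by (intro is_cobdI[where \<psi> = "\<lambda>\<tau>. c \<tau> + \<psi> \<tau>"]) (simp add: cobd_add algebra_simps)
qed

lemma conn_rcobd_imp_is_cobd:
  assumes "open_pair U V" "is_cocycle (Suc q) (top_of_set (U \<union> V)) \<phi>"
    and "conn q U V \<phi> \<kappa>" "is_rcobd q (top_of_set (U \<inter> V)) \<kappa>"
  shows "is_cobd (Suc q) (top_of_set (U \<union> V)) \<phi>"
  by (rule conn_imp_is_cobd[OF assms(1-3), where \<alpha> = "\<lambda>_. 0" and \<beta> = "\<lambda>_. 0"]) (use assms(4) in auto)

text \<open>The zigzag of the snake lemma: \<kappa> is extended by zero to \<open>U\<close>, and
  \<open>\<phi>0\<close> is the coboundary of this on simplices of \<open>U\<close> and zero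
  elsewhere. It vanishes on \<open>V\<close> because \<kappa> is closed on the intersection. It is
  sure to be closed on small simplices only, and excision gives the \<psi> by which it is corrected
  to a cocycle.\<close>

lemma cocycle_with_conn_exists:
  assumes UV: "open_pair U V" and \<kappa>: "is_cocycle q (top_of_set (U \<inter> V)) \<kappa>"
  obtains \<phi> where "is_cocycle (Suc q) (top_of_set (U \<union> V)) \<phi>" "conn q U V \<phi> \<kappa>"
proof -
  define a where "a \<sigma> = (if singular_simplex q (top_of_set (U \<inter> V)) \<sigma> then \<kappa> \<sigma> else 0)" for \<sigma>
  define \<phi>0 where "\<phi>0 \<sigma> = (if singular_simplex (Suc q) (top_of_set U) \<sigma> then cobd (Suc q) a \<sigma> else 0)" for \<sigma>
  have \<phi>0_V: "\<phi>0 \<sigma> = 0" if \<sigma>: "singular_simplex (Suc q) (top_of_set V) \<sigma>" for \<sigma>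
  proof (cases "singular_simplex (Suc q) (top_of_set U) \<sigma>")
    case True
    then have *: "singular_simplex (Suc q) (top_of_set (U \<inter> V)) \<sigma>"
      using \<sigma> by (simp add: singular_simplex_top_of_set_Int)
    then have "cobd (Suc q) a \<sigma> = cobd (Suc q) \<kappa> \<sigma>" by (rule cobd_cong) (simp add: a_def)
    then show ?thesis using * \<kappa> by (simp add: \<phi>0_def is_cocycle_def)
  qed (simp add: \<phi>0_def)
  have U: "cobd (Suc (Suc q)) \<phi>0 \<sigma> = 0" if \<sigma>: "singular_simplex (Suc (Suc q)) (top_of_set U) \<sigma>" for \<sigma>
  proof -
    have "cobd (Suc (Suc q)) \<phi>0 \<sigma> = cobd (Suc (Suc q)) (cobd (Suc q) a) \<sigma>"
      using \<sigma> by (rule cobd_cong) (simp add: \<phi>0_def)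
    then show ?thesis by (simp only: cobd_cobd[OF \<sigma>])
  qed
  have V: "cobd (Suc (Suc q)) \<phi>0 \<sigma> = 0" if \<sigma>: "singular_simplex (Suc (Suc q)) (top_of_set V) \<sigma>" for \<sigma>
  proof -
    have "cobd (Suc (Suc q)) \<phi>0 \<sigma> = cobd (Suc (Suc q)) (\<lambda>_. 0) \<sigma>"
      using \<sigma> by (rule cobd_cong) (simp add: \<phi>0_V)
    then show ?thesis by simp
  qed
  from open_pair_cocycle_is_coboundary[OF UV is_cocycle_cobd U V] obtain \<psi> where \<psi>:
    "\<And>\<tau>. singular_simplex (Suc q) (top_of_set U) \<tau> \<Longrightarrow> \<psi> \<tau> = 0"
    "\<And>\<tau>. singular_simplex (Suc q) (top_of_set V) \<tau> \<Longrightarrow> \<psi> \<tau> = 0"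
    "\<And>\<sigma>. singular_simplex (Suc (Suc q)) (top_of_set (U \<union> V)) \<sigma> \<Longrightarrow>
      cobd (Suc (Suc q)) \<phi>0 \<sigma> = cobd (Suc (Suc q)) \<psi> \<sigma>" unfolding diff_Suc_1 by blast
  show ?thesis
  proof
    show "is_cocycle (Suc q) (top_of_set (U \<union> V)) (\<lambda>\<sigma>. \<phi>0 \<sigma> - \<psi> \<sigma>)"
      by (simp add: is_cocycle_def cobd_diff \<psi>(3))
    show "conn q U V (\<lambda>\<sigma>. \<phi>0 \<sigma> - \<psi> \<sigma>) \<kappa>"
    proof (rule connI[where a = a and b = "\<lambda>_. 0"])
      show "is_rcobd q (top_of_set (U \<inter> V)) (\<lambda>\<sigma>. a \<sigma> - 0 - \<kappa> \<sigma>)"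
        by (rule is_rcobd_cong[OF is_rcobd_zero]) (simp add: a_def)
    qed (simp_all add: \<psi> \<phi>0_V, simp add: \<phi>0_def)
  qed
qed

lemma conn_exists:
  assumes "is_cobd (Suc q) (top_of_set U) \<phi>" "is_cobd (Suc q) (top_of_set V) \<phi>"
  obtains \<kappa> where "is_cocycle q (top_of_set (U \<inter> V)) \<kappa>" "conn q U V \<phi> \<kappa>"
proof -
  obtain a b where ab:
    "\<And>\<sigma>. singular_simplex (Suc q) (top_of_set U) \<sigma> \<Longrightarrow> \<phi> \<sigma> = cobd (Suc q) a \<sigma>"
    "\<And>\<sigma>. singular_simplex (Suc q) (top_of_set V) \<sigma> \<Longrightarrow> \<phi> \<sigma> = cobd (Suc q) b \<sigma>"
    using assms by (auto simp: is_cobd_def)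
  show ?thesis
  proof
    show "is_cocycle q (top_of_set (U \<inter> V)) (\<lambda>\<sigma>. a \<sigma> - b \<sigma>)"
      unfolding is_cocycle_def singular_simplex_top_of_set_Int using ab by (auto simp: cobd_diff) metis
    show "conn q U V \<phi> (\<lambda>\<sigma>. a \<sigma> - b \<sigma>)"
      using ab by (rule connI) simp_all
  qed
qed

text \<open>A primitive \<open>c\<close> on the whole union differs from the local primitives by
  cocycles on \<open>U\<close> and on \<open>V\<close>, and \<open>c\<close> cancels in the
  difference of the two.\<close>

lemma conn_is_cobd:
  assumes "conn q U V \<phi> \<kappa>" "is_cobd (Suc q) (top_of_set (U \<union> V)) \<phi>"
  obtains \<alpha> \<beta> where "is_cocycle q (top_of_set U) \<alpha>" "is_cocycle q (top_of_set V) \<beta>"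
    "is_rcobd q (top_of_set (U \<inter> V)) (\<lambda>\<sigma>. \<kappa> \<sigma> - (\<alpha> \<sigma> - \<beta> \<sigma>))"
proof -
  from assms(1) obtain a b where ab:
    "\<And>\<sigma>. singular_simplex (Suc q) (top_of_set U) \<sigma> \<Longrightarrow> \<phi> \<sigma> = cobd (Suc q) a \<sigma>"
    "\<And>\<sigma>. singular_simplex (Suc q) (top_of_set V) \<sigma> \<Longrightarrow> \<phi> \<sigma> = cobd (Suc q) b \<sigma>"
    "is_rcobd q (top_of_set (U \<inter> V)) (\<lambda>\<sigma>. a \<sigma> - b \<sigma> - \<kappa> \<sigma>)" by (rule connE) blast
  from assms(2) obtain c where c:
    "\<And>\<sigma>. singular_simplex (Suc q) (top_of_set (U \<union> V)) \<sigma> \<Longrightarrow> \<phi> \<sigma> = cobd (Suc q) c \<sigma>"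
    by (auto simp: is_cobd_def)
  have cU: "\<phi> \<sigma> = cobd (Suc q) c \<sigma>" if "singular_simplex (Suc q) (top_of_set U) \<sigma>" for \<sigma>
    using c singular_simplex_top_of_set_mono[OF that, of "U \<union> V"] by blast
  have cV: "\<phi> \<sigma> = cobd (Suc q) c \<sigma>" if "singular_simplex (Suc q) (top_of_set V) \<sigma>" for \<sigma>
    using c singular_simplex_top_of_set_mono[OF that, of "U \<union> V"] by blast
  show ?thesis
  proof
    show "is_cocycle q (top_of_set U) (\<lambda>\<sigma>. a \<sigma> - c \<sigma>)"
      unfolding is_cocycle_def using ab(1) cU by (auto simp: cobd_diff)
    show "is_cocycle q (top_of_set V) (\<lambda>\<sigma>. b \<sigma> - c \<sigma>)"
      unfolding is_cocycle_def using ab(2) cV by (auto simp: cobd_diff)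
    show "is_rcobd q (top_of_set (U \<inter> V)) (\<lambda>\<sigma>. \<kappa> \<sigma> - ((a \<sigma> - c \<sigma>) - (b \<sigma> - c \<sigma>)))"
      by (rule is_rcobd_lincomb[OF ab(3,3), where k = "-1" and l = 0]) simp
  qed
qed

section \<open>Cohomology of spheres\<close>

definition acyclic_space :: "'a topology \<Rightarrow> bool"
  where "acyclic_space X \<longleftrightarrow> (\<forall>q \<phi>. is_cocycle q X \<phi> \<longrightarrow> is_rcobd q X \<phi>)"

text \<open>The reduced cohomology of an \<open>n\<close>-sphere with \<kappa> as generator. The use
  of \<open>is_rcobd\<close> in all degrees makes \<open>n = 0\<close>, the case of two points, a
  regular instance.\<close>

definition cohomology_sphere :: "nat \<Rightarrow> 'a topology \<Rightarrow> 'a cochain \<Rightarrow> bool"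
  where "cohomology_sphere n X \<kappa> \<longleftrightarrow> is_cocycle n X \<kappa> \<and>
    (\<forall>q \<phi>. is_cocycle q X \<phi> \<longrightarrow> q \<noteq> n \<longrightarrow> is_rcobd q X \<phi>) \<and>
    (\<forall>\<phi>. is_cocycle n X \<phi> \<longrightarrow> (\<exists>k. is_rcobd n X (\<lambda>\<sigma>. \<phi> \<sigma> - k * \<kappa> \<sigma>))) \<and>
    (\<forall>k. is_rcobd n X (\<lambda>\<sigma>. k * \<kappa> \<sigma>) \<longrightarrow> k = 0)"

lemma cohomology_sphereD:
  assumes "cohomology_sphere n X \<kappa>"
  shows "is_cocycle n X \<kappa>"
    and "\<And>q \<phi>. is_cocycle q X \<phi> \<Longrightarrow> q \<noteq> n \<Longrightarrow> is_rcobd q X \<phi>"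
    and "\<And>\<phi>. is_cocycle n X \<phi> \<Longrightarrow> \<exists>k. is_rcobd n X (\<lambda>\<sigma>. \<phi> \<sigma> - k * \<kappa> \<sigma>)"
    and "\<And>k. is_rcobd n X (\<lambda>\<sigma>. k * \<kappa> \<sigma>) \<Longrightarrow> k = 0"
  using assms unfolding cohomology_sphere_def by blast+

lemma singular_simplex_const: "p \<in> S \<Longrightarrow> singular_simplex q (top_of_set S) (\<lambda>x\<in>standard_simplex q. p)"
  by (simp add: singular_simplex_def)

lemma cohomology_sphere_nonempty:
  assumes "cohomology_sphere n (top_of_set S) \<kappa>"
  shows "S \<noteq> {}"
proof
  assume "S = {}"
  then have "is_rcobd n (top_of_set S) (\<lambda>\<sigma>. 1 * \<kappa> \<sigma>)"
    by (intro is_rcobd_cong[OF is_rcobd_zero]) (simp add: singular_simplex_empty)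
  then show False using cohomology_sphereD(4)[OF assms] by fastforce
qed

lemma acyclic_space_singleton: "acyclic_space (top_of_set {p})"
  unfolding acyclic_space_def
proof (intro allI impI)
  fix q and \<phi> :: "'a cochain" assume \<phi>: "is_cocycle q (top_of_set {p}) \<phi>"
  let ?c = "\<lambda>q. \<lambda>x\<in>standard_simplex q. p"
  have uniq: "singular_simplex q (top_of_set {p}) \<sigma> \<longleftrightarrow> \<sigma> = ?c q" for q \<sigma>
    by (rule singular_simplex_singleton) simp
  \<comment> \<open>The unique \<open>q\<close>-simplex has \<open>q + 1\<close> equal faces with
    alternating signs: they cancel for odd \<open>q\<close>, and one remains for even positive
    \<open>q\<close>.\<close>
  have bd: "cobd q \<psi> (?c q) = (if q = 0 \<or> odd q then 0 else \<psi> (?c (q - 1)))" for q \<psi>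
    using chain_boundary_of_singleton[of "top_of_set {p}" p q "frag_of (?c q)"] uniq[of q "?c q"]
    by (simp add: cobd_def singular_chain_of)
  show "is_rcobd q (top_of_set {p}) \<phi>"
  proof (cases "q = 0")
    case True
    then show ?thesis by (auto simp: is_rcobd_0 uniq)
  next
    case False
    have "is_cobd q (top_of_set {p}) \<phi>"
    proof (cases "odd q")
      case True
      then have "\<phi> (?c q) = 0" using \<phi> bd[of "Suc q" \<phi>] by (simp add: is_cocycle_def uniq)
      then show ?thesis by (intro is_cobdI[where \<psi> = "\<lambda>_. 0"]) (simp add: uniq)
    next
      case even: False
      then show ?thesis
        using False bd[of q "\<lambda>_. \<phi> (?c q)"]
        by (intro is_cobdI[where \<psi> = "\<lambda>_. \<phi> (?c q)"]) (simp add: uniq)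
    qed
    then show ?thesis by (rule is_cobd_imp_is_rcobd)
  qed
qed

lemma acyclic_space_deformation_retract:
  assumes "acyclic_space Y" "continuous_map X Y f" "continuous_map Y X i"
    and "\<And>y. y \<in> topspace Y \<Longrightarrow> f (i y) = y"
    and "homotopic_with (\<lambda>_. True) X X (i \<circ> f) id"
  shows "acyclic_space X"
  using assms(1) deformation_retract_is_rcobd[OF assms(2-5)] is_cocycle_pullback[OF _ assms(3)]
  unfolding acyclic_space_def by blast

text \<open>The generator is pulled back along \<open>f\<close>. Coboundaries on \<open>X\<close>
  are detected by restriction along \<open>i\<close>, under which the pulled back \<kappa> becomes
  \<kappa> again as \<open>f \<circ> i\<close> is the identity.\<close>

lemma cohomology_sphere_deformation_retract:
  assumes Y: "cohomology_sphere n Y \<kappa>" and f: "continuous_map X Y f" and i: "continuous_map Y X i"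
    and fi: "\<And>y. y \<in> topspace Y \<Longrightarrow> f (i y) = y"
    and hom: "homotopic_with (\<lambda>_. True) X X (i \<circ> f) id"
  shows "cohomology_sphere n X (\<lambda>\<sigma>. \<kappa> (simplex_map n f \<sigma>))"
proof -
  have retract: "is_rcobd q X \<phi>"
    if "is_cocycle q X \<phi>" "is_rcobd q Y (\<lambda>\<sigma>. \<phi> (simplex_map q i \<sigma>))" for q \<phi>
    by (rule deformation_retract_is_rcobd[OF f i fi hom that])
  have fi_simplex: "simplex_map p f (simplex_map p i \<tau>) = \<tau>" if "singular_simplex p Y \<tau>" for p \<tau>
    unfolding simplex_map_simplex_map using that by (rule simplex_map_id_gen) (simp add: fi)
  have cocycle: "is_cocycle n X (\<lambda>\<sigma>. \<kappa> (simplex_map n f \<sigma>))"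
    using cohomology_sphereD(1)[OF Y] f by (rule is_cocycle_pullback)
  have "is_rcobd q X \<phi>" if "is_cocycle q X \<phi>" "q \<noteq> n" for q \<phi>
    using that by (intro retract cohomology_sphereD(2)[OF Y] is_cocycle_pullback[OF _ i])
  moreover have "\<exists>k. is_rcobd n X (\<lambda>\<sigma>. \<phi> \<sigma> - k * \<kappa> (simplex_map n f \<sigma>))" if \<phi>: "is_cocycle n X \<phi>" for \<phi>
  proof -
    obtain k where k: "is_rcobd n Y (\<lambda>\<sigma>. \<phi> (simplex_map n i \<sigma>) - k * \<kappa> \<sigma>)"
      using cohomology_sphereD(3)[OF Y is_cocycle_pullback[OF \<phi> i]] by blast
    have "is_rcobd n X (\<lambda>\<sigma>. \<phi> \<sigma> - k * \<kappa> (simplex_map n f \<sigma>))"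
    proof (intro retract)
      show "is_cocycle n X (\<lambda>\<sigma>. \<phi> \<sigma> - k * \<kappa> (simplex_map n f \<sigma>))"
        by (rule is_cocycle_lincomb[OF \<phi> cocycle, where k = 1 and l = "- k"]) simp
      show "is_rcobd n Y (\<lambda>\<sigma>. \<phi> (simplex_map n i \<sigma>) - k * \<kappa> (simplex_map n f (simplex_map n i \<sigma>)))"
        by (rule is_rcobd_cong[OF k]) (simp add: fi_simplex)
    qed
    then show ?thesis by blast
  qed
  moreover have "k = 0" if "is_rcobd n X (\<lambda>\<sigma>. k * \<kappa> (simplex_map n f \<sigma>))" for k
    using is_rcobd_cong[OF is_rcobd_pullback[OF that i]]
    by (intro cohomology_sphereD(4)[OF Y]) (simp add: fi_simplex)
  ultimately show ?thesis using cocycle unfolding cohomology_sphere_def by blast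
qed

section \<open>Homotopies along normalized segments\<close>

lemma homotopic_canonI:
  assumes "continuous_on ({0..1} \<times> S) h" "\<And>t x. 0 \<le> t \<Longrightarrow> t \<le> 1 \<Longrightarrow> x \<in> S \<Longrightarrow> h (t, x) \<in> T"
    and "\<And>x. x \<in> S \<Longrightarrow> h (0 :: real, x) = f x" "\<And>x. x \<in> S \<Longrightarrow> h (1, x) = g x"
  shows "homotopic_with (\<lambda>_. True) (top_of_set S) (top_of_set T) f g"
proof -
  have "prod_topology (top_of_set {0..1::real}) (top_of_set S) = top_of_set ({0..1} \<times> S)"
    by (simp add: prod_topology_subtopology subtopology_subtopology Times_Int_Times)
  then have "continuous_map (prod_topology (top_of_set {0..1::real}) (top_of_set S)) (top_of_set T) h"
    using assms(1,2) by auto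
  then show ?thesis
    by (subst homotopic_with) (use assms(3,4) in auto)
qed

text \<open>The homotopy is the straight segment from \<open>r z\<close> to \<open>z\<close>, scaled
  back to the sphere. At its ends the scaling does nothing because \<open>S\<close> consists of unit
  vectors.\<close>

lemma homotopic_normalized_segment:
  fixes S :: "'a::real_normed_vector set"
  assumes "S \<subseteq> sphere 0 1" "continuous_on S r" "\<And>z. z \<in> S \<Longrightarrow> r z \<in> S"
    and seg: "\<And>z t. z \<in> S \<Longrightarrow> 0 \<le> t \<Longrightarrow> t \<le> 1 \<Longrightarrow>
      (1 - t) *\<^sub>R r z + t *\<^sub>R z \<noteq> 0 \<and> sgn ((1 - t) *\<^sub>R r z + t *\<^sub>R z) \<in> S"
  shows "homotopic_with (\<lambda>_. True) (top_of_set S) (top_of_set S) r id"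
proof (rule homotopic_canonI)
  have [continuous_intros]: "continuous_on ({0..1} \<times> S) (\<lambda>w. r (snd w))"
    by (rule continuous_on_compose2[OF assms(2) continuous_on_snd[OF continuous_on_id]]) auto
  show "continuous_on ({0..1} \<times> S) (\<lambda>w. sgn ((1 - fst w) *\<^sub>R r (snd w) + fst w *\<^sub>R snd w))"
    by (intro continuous_intros) (use seg in auto)
  show "sgn ((1 - fst (t, z)) *\<^sub>R r (snd (t, z)) + fst (t, z) *\<^sub>R snd (t, z)) \<in> S"
    if "0 \<le> t" "t \<le> 1" "z \<in> S" for t z
    using seg[of z t] that by simp
  fix z assume z: "z \<in> S"
  then have "norm (r z) = 1" "norm z = 1" using assms(1,3) by (auto simp: subset_iff)
  then show "sgn ((1 - fst (0, z)) *\<^sub>R r (snd (0, z)) + fst (0, z) *\<^sub>R snd (0, z)) = r z"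
    "sgn ((1 - fst (1, z)) *\<^sub>R r (snd (1, z)) + fst (1, z) *\<^sub>R snd (1, z)) = id z"
    by (simp_all add: sgn_div_norm)
qed

text \<open>Each factor is normalized by itself, since the points lie in a product of two
  spheres.\<close>

lemma homotopic_normalized_segment_pair:
  fixes S :: "('a::real_normed_vector \<times> 'b::real_normed_vector) set"
  assumes sub: "S \<subseteq> sphere 0 1 \<times> sphere 0 1" and r: "continuous_on S r" "\<And>z. z \<in> S \<Longrightarrow> r z \<in> S"
    and normalizable: "\<And>z t. z \<in> S \<Longrightarrow> 0 \<le> t \<Longrightarrow> t \<le> 1 \<Longrightarrow>
      \<exists>g h. (1 - t) *\<^sub>R r z + t *\<^sub>R z = (g, h) \<and> g \<noteq> 0 \<and> h \<noteq> 0 \<and> (sgn g, sgn h) \<in> S"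
  shows "homotopic_with (\<lambda>_. True) (top_of_set S) (top_of_set S) r id"
proof (rule homotopic_canonI)
  let ?s = "\<lambda>w. (1 - fst w) *\<^sub>R r (snd w) + fst w *\<^sub>R snd w"
  have seg: "fst (?s (t, z)) \<noteq> 0 \<and> snd (?s (t, z)) \<noteq> 0 \<and> (sgn (fst (?s (t, z))), sgn (snd (?s (t, z)))) \<in> S"
    if "z \<in> S" "0 \<le> t" "t \<le> 1" for z t
    using normalizable[OF that] by (auto simp del: fst_add snd_add fst_scaleR snd_scaleR)
  have [continuous_intros]: "continuous_on ({0..1} \<times> S) (\<lambda>w. r (snd w))"
    by (rule continuous_on_compose2[OF r(1) continuous_on_snd[OF continuous_on_id]]) auto
  have [continuous_intros]: "continuous_on ({0..1} \<times> S) ?s"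
    by (intro continuous_intros)
  show "continuous_on ({0..1} \<times> S) (\<lambda>w. (sgn (fst (?s w)), sgn (snd (?s w))))"
    by (intro continuous_intros) (use seg in \<open>auto simp del: fst_add snd_add fst_scaleR snd_scaleR\<close>)
  show "(sgn (fst (?s (t, z))), sgn (snd (?s (t, z)))) \<in> S"
    if "0 \<le> t" "t \<le> 1" "z \<in> S" for t z
    using seg[OF that(3,1,2)] by blast
  fix z assume z: "z \<in> S"
  then have "norm (fst (r z)) = 1" "norm (fst z) = 1" "norm (snd (r z)) = 1" "norm (snd z) = 1"
    using subsetD[OF sub z] subsetD[OF sub r(2)[OF z]] by (simp_all add: mem_Times_iff)
  then show "(sgn (fst (?s (0, z))), sgn (snd (?s (0, z)))) = r z"
    "(sgn (fst (?s (1, z))), sgn (snd (?s (1, z)))) = id z"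
    by (simp_all add: sgn_div_norm)
qed

text \<open>The standard simplex is connected, so its image cannot meet both of two disjoint
  relatively open pieces.\<close>

lemma singular_simplex_disjoint_Un:
  assumes "open_pair U V" "U \<inter> V = {}" "singular_simplex q (top_of_set (U \<union> V)) \<sigma>"
  shows "singular_simplex q (top_of_set U) \<sigma> \<or> singular_simplex q (top_of_set V) \<sigma>"
proof -
  let ?I = "\<sigma> ` standard_simplex q"
  have "connectedin (top_of_set (U \<union> V)) ?I"
  proof (rule connectedin_continuous_map_image)
    show "continuous_map (subtopology (powertop_real UNIV) (standard_simplex q)) (top_of_set (U \<union> V)) \<sigma>"
      using assms(3) by (simp add: singular_simplex_def)
    show "connectedin (subtopology (powertop_real UNIV) (standard_simplex q)) (standard_simplex q)"
      by (simp add: connectedin_subtopology connectedin_standard_simplex)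
  qed
  then have I: "?I \<subseteq> U \<union> V" "\<not> (\<exists>E1 E2. openin (top_of_set (U \<union> V)) E1 \<and> openin (top_of_set (U \<union> V)) E2 \<and>
      ?I \<subseteq> E1 \<union> E2 \<and> E1 \<inter> E2 \<inter> ?I = {} \<and> E1 \<inter> ?I \<noteq> {} \<and> E2 \<inter> ?I \<noteq> {})"
    by (auto simp: connectedin)
  then have "U \<inter> ?I = {} \<or> V \<inter> ?I = {}"
    using assms(1,2) unfolding open_pair_def by (metis Int_empty_left)
  then have "?I \<subseteq> U \<or> ?I \<subseteq> V" using I(1) by blast
  then show ?thesis
    using assms(3) by (auto simp: singular_simplex_subtopology)
qed

lemma is_cobd_disjoint_Un:
  assumes UV: "open_pair U V" "U \<inter> V = {}"
    and "is_cobd q (top_of_set U) \<phi>" "is_cobd q (top_of_set V) \<phi>"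
  shows "is_cobd q (top_of_set (U \<union> V)) \<phi>"
proof -
  obtain a b where a: "\<And>\<sigma>. singular_simplex q (top_of_set U) \<sigma> \<Longrightarrow> \<phi> \<sigma> = cobd q a \<sigma>"
    and b: "\<And>\<sigma>. singular_simplex q (top_of_set V) \<sigma> \<Longrightarrow> \<phi> \<sigma> = cobd q b \<sigma>"
    using assms by (auto simp: is_cobd_def)
  define c where "c \<tau> = (if singular_simplex (q - 1) (top_of_set U) \<tau> then a \<tau> else b \<tau>)" for \<tau>
  have no: "\<not> singular_simplex p (top_of_set U) \<tau>" if "singular_simplex p (top_of_set V) \<tau>" for p \<tau>
    using that UV(2) singular_simplex_top_of_set_Int[of p U V \<tau>] singular_simplex_empty[of "top_of_set {}" p \<tau>]
    by auto
  have "\<phi> \<sigma> = cobd q c \<sigma>" if "singular_simplex q (top_of_set (U \<union> V)) \<sigma>" for \<sigma>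
    using singular_simplex_disjoint_Un[OF UV that]
  proof
    assume \<sigma>: "singular_simplex q (top_of_set U) \<sigma>"
    then have "cobd q c \<sigma> = cobd q a \<sigma>" by (rule cobd_cong) (simp add: c_def)
    then show ?thesis using a[OF \<sigma>] by simp
  next
    assume \<sigma>: "singular_simplex q (top_of_set V) \<sigma>"
    then have "cobd q c \<sigma> = cobd q b \<sigma>" by (rule cobd_cong) (simp add: c_def no)
    then show ?thesis using b[OF \<sigma>] by simp
  qed
  then show ?thesis by (rule is_cobdI)
qed

lemma is_cocycle_disjoint_Un:
  assumes UV: "open_pair U V" "U \<inter> V = {}"
    and "is_cocycle q (top_of_set U) \<phi>" "is_cocycle q (top_of_set V) \<phi>"
  shows "is_cocycle q (top_of_set (U \<union> V)) \<phi>"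
  using singular_simplex_disjoint_Un[OF UV] assms(3,4) unfolding is_cocycle_def by blast

text \<open>Every \<open>0\<close>-simplex is a point and lies in one of the two sets; a common
  point forces the two constants to agree.\<close>

lemma is_rcobd_0_Un:
  assumes "is_rcobd 0 (top_of_set U) \<phi>" "is_rcobd 0 (top_of_set V) \<phi>" "U \<inter> V \<noteq> {}"
  shows "is_rcobd 0 (top_of_set (U \<union> V)) \<phi>"
proof -
  obtain k l where kl: "\<And>\<sigma>. singular_simplex 0 (top_of_set U) \<sigma> \<Longrightarrow> \<phi> \<sigma> = k"
    "\<And>\<sigma>. singular_simplex 0 (top_of_set V) \<sigma> \<Longrightarrow> \<phi> \<sigma> = l"
    using assms(1,2) by (auto simp: is_rcobd_0)
  obtain p where "p \<in> U" "p \<in> V" using assms(3) by blast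
  then have "k = l" using kl singular_simplex_const[of p _ 0] by metis
  moreover have "singular_simplex 0 (top_of_set U) \<sigma> \<or> singular_simplex 0 (top_of_set V) \<sigma>"
    if "singular_simplex 0 (top_of_set (U \<union> V)) \<sigma>" for \<sigma>
    using that by (auto simp: singular_simplex_subtopology standard_simplex_0)
  ultimately have "\<phi> \<sigma> = l" if "singular_simplex 0 (top_of_set (U \<union> V)) \<sigma>" for \<sigma>
    using kl that by metis
  then show ?thesis by (auto simp: is_rcobd_0)
qed

text \<open>With acyclic members the Mayer-Vietoris sequence in reduced cohomology makes the
  connecting relation an isomorphism that raises the degree by one. In degree \<open>0\<close> the
  constants on the two members agree because the intersection is nonempty.\<close>

lemma cohomology_sphere_suspension:
  assumes UV: "open_pair U V" and U: "acyclic_space (top_of_set U)" and V: "acyclic_space (top_of_set V)"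
    and \<kappa>: "cohomology_sphere n (top_of_set (U \<inter> V)) \<kappa>"
  obtains \<omega> where "cohomology_sphere (Suc n) (top_of_set (U \<union> V)) \<omega>" "conn n U V \<omega> \<kappa>"
proof -
  obtain \<omega> where \<omega>: "is_cocycle (Suc n) (top_of_set (U \<union> V)) \<omega>" "conn n U V \<omega> \<kappa>"
    using cocycle_with_conn_exists[OF UV cohomology_sphereD(1)[OF \<kappa>]] by blast
  have acyclic: "is_rcobd q (top_of_set U) \<phi>" "is_rcobd q (top_of_set V) \<phi>"
    if "is_cocycle q (top_of_set (U \<union> V)) \<phi>" for q \<phi>
    using that U V is_cocycle_mono[of q "U \<union> V" \<phi>] unfolding acyclic_space_def by blast+
  have conn: "\<exists>\<kappa>'. is_cocycle q (top_of_set (U \<inter> V)) \<kappa>' \<and> conn q U V \<phi> \<kappa>'"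
    if "is_cocycle (Suc q) (top_of_set (U \<union> V)) \<phi>" for q \<phi>
    using conn_exists[of q U \<phi> V] acyclic[OF that] by (auto simp: is_rcobd_pos)
  have "is_rcobd q (top_of_set (U \<union> V)) \<phi>" if \<phi>: "is_cocycle q (top_of_set (U \<union> V)) \<phi>" "q \<noteq> Suc n" for q \<phi>
  proof (cases q)
    case 0
    then show ?thesis
      using is_rcobd_0_Un acyclic[OF \<phi>(1)] cohomology_sphere_nonempty[OF \<kappa>] by blast
  next
    case (Suc m)
    then obtain \<kappa>' where \<kappa>': "is_cocycle m (top_of_set (U \<inter> V)) \<kappa>'" "conn m U V \<phi> \<kappa>'"
      using conn \<phi>(1) by blast
    have "is_rcobd m (top_of_set (U \<inter> V)) \<kappa>'"
      using \<kappa>'(1) by (rule cohomology_sphereD(2)[OF \<kappa>]) (use \<phi>(2) Suc in simp)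
    then have "is_cobd (Suc m) (top_of_set (U \<union> V)) \<phi>"
      using conn_rcobd_imp_is_cobd[OF UV _ \<kappa>'(2)] \<phi>(1) Suc by blast
    then show ?thesis using Suc by (simp add: is_rcobd_pos)
  qed
  moreover have "\<exists>k. is_rcobd (Suc n) (top_of_set (U \<union> V)) (\<lambda>\<sigma>. \<phi> \<sigma> - k * \<omega> \<sigma>)"
    if \<phi>: "is_cocycle (Suc n) (top_of_set (U \<union> V)) \<phi>" for \<phi>
  proof -
    obtain \<kappa>' where \<kappa>': "is_cocycle n (top_of_set (U \<inter> V)) \<kappa>'" "conn n U V \<phi> \<kappa>'"
      using conn \<phi>(1) by blast
    obtain k where k: "is_rcobd n (top_of_set (U \<inter> V)) (\<lambda>\<sigma>. \<kappa>' \<sigma> - k * \<kappa> \<sigma>)"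
      using cohomology_sphereD(3)[OF \<kappa> \<kappa>'(1)] by blast
    have "conn n U V (\<lambda>\<sigma>. \<phi> \<sigma> - k * \<omega> \<sigma>) (\<lambda>\<sigma>. \<kappa>' \<sigma> - k * \<kappa> \<sigma>)"
      by (rule conn_lincomb[OF \<kappa>'(2) \<omega>(2), where k = 1 and l = "- k"]) simp_all
    moreover have "is_cocycle (Suc n) (top_of_set (U \<union> V)) (\<lambda>\<sigma>. \<phi> \<sigma> - k * \<omega> \<sigma>)"
      by (rule is_cocycle_lincomb[OF \<phi> \<omega>(1), where k = 1 and l = "- k"]) simp
    ultimately have "is_cobd (Suc n) (top_of_set (U \<union> V)) (\<lambda>\<sigma>. \<phi> \<sigma> - k * \<omega> \<sigma>)"
      using conn_rcobd_imp_is_cobd[OF UV _ _ k] by blast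
    then show ?thesis using is_cobd_imp_is_rcobd by blast
  qed
  moreover have "k = 0" if "is_rcobd (Suc n) (top_of_set (U \<union> V)) (\<lambda>\<sigma>. k * \<omega> \<sigma>)" for k
  proof -
    have cob: "is_cobd (Suc n) (top_of_set (U \<union> V)) (\<lambda>\<sigma>. k * \<omega> \<sigma>)" using that by (simp add: is_rcobd_pos)
    have "conn n U V (\<lambda>\<sigma>. k * \<omega> \<sigma>) (\<lambda>\<sigma>. k * \<kappa> \<sigma>)"
      by (rule conn_lincomb[OF \<omega>(2,2), where k = k and l = 0]) simp_all
    from conn_is_cobd[OF this cob] obtain \<alpha> \<beta> where
      *: "is_cocycle n (top_of_set U) \<alpha>" "is_cocycle n (top_of_set V) \<beta>"
        "is_rcobd n (top_of_set (U \<inter> V)) (\<lambda>\<sigma>. k * \<kappa> \<sigma> - (\<alpha> \<sigma> - \<beta> \<sigma>))" by blast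
    then have "is_rcobd n (top_of_set U) \<alpha>" "is_rcobd n (top_of_set V) \<beta>"
      using U V unfolding acyclic_space_def by blast+
    then have r: "is_rcobd n (top_of_set (U \<inter> V)) \<alpha>" "is_rcobd n (top_of_set (U \<inter> V)) \<beta>"
      using is_rcobd_mono by blast+
    have "is_rcobd n (top_of_set (U \<inter> V)) (\<lambda>\<sigma>. \<alpha> \<sigma> - \<beta> \<sigma>)"
      by (rule is_rcobd_lincomb[OF r, where k = 1 and l = "-1"]) simp
    from is_rcobd_lincomb[OF *(3) this, where k = 1 and l = 1]
    have "is_rcobd n (top_of_set (U \<inter> V)) (\<lambda>\<sigma>. k * \<kappa> \<sigma>)" by simp
    then show ?thesis by (rule cohomology_sphereD(4)[OF \<kappa>])
  qed
  ultimately have "cohomology_sphere (Suc n) (top_of_set (U \<union> V)) \<omega>"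
    using \<omega>(1) unfolding cohomology_sphere_def by blast
  then show ?thesis using \<omega>(2) that by blast
qed

lemma singular_simplex_disjoint:
  "U \<inter> V = {} \<Longrightarrow> singular_simplex q (top_of_set U) \<sigma> \<Longrightarrow> \<not> singular_simplex q (top_of_set V) \<sigma>"
  using singular_simplex_top_of_set_Int[of q U V \<sigma>] singular_simplex_empty[of "top_of_set {}" q \<sigma>] by auto

text \<open>A \<open>0\<close>-cocycle is a constant \<open>i\<close> on \<open>U\<close> and a
  constant \<open>j\<close> on \<open>V\<close>; subtracting \<open>i - j\<close> times the
  indicator of \<open>U\<close> leaves the constant \<open>j\<close>, which is zero in reduced
  cohomology.\<close>

lemma cohomology_sphere_disjoint_Un:
  assumes UV: "open_pair U V" "U \<inter> V = {}" and "U \<noteq> {}" "V \<noteq> {}"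
    and U: "acyclic_space (top_of_set U)" and V: "acyclic_space (top_of_set V)"
  shows "cohomology_sphere 0 (top_of_set (U \<union> V)) (\<lambda>\<sigma>. if singular_simplex 0 (top_of_set U) \<sigma> then 1 else 0)"
    (is "cohomology_sphere 0 _ ?\<kappa>")
proof -
  have cocycle: "is_cocycle 0 (top_of_set (U \<union> V)) ?\<kappa>"
  proof (rule is_cocycle_disjoint_Un[OF UV])
    show "is_cocycle 0 (top_of_set U) ?\<kappa>"
      by (rule is_cocycle_cong[OF is_cocycle_const[of _ 1]]) simp
    show "is_cocycle 0 (top_of_set V) ?\<kappa>"
      by (rule is_cocycle_cong[OF is_cocycle_const[of _ 0]]) (use singular_simplex_disjoint[OF UV(2)] in auto)
  qed
  have const: "\<exists>i j. (\<forall>\<sigma>. singular_simplex 0 (top_of_set U) \<sigma> \<longrightarrow> \<phi> \<sigma> = i) \<and>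
      (\<forall>\<sigma>. singular_simplex 0 (top_of_set V) \<sigma> \<longrightarrow> \<phi> \<sigma> = j)"
    if "is_cocycle 0 (top_of_set (U \<union> V)) \<phi>" for \<phi>
  proof -
    have "is_rcobd 0 (top_of_set U) \<phi>" "is_rcobd 0 (top_of_set V) \<phi>"
      using that U V is_cocycle_mono[of 0 "U \<union> V" \<phi>] unfolding acyclic_space_def by blast+
    then show ?thesis unfolding is_rcobd_0 by blast
  qed
  have "is_rcobd q (top_of_set (U \<union> V)) \<phi>" if \<phi>: "is_cocycle q (top_of_set (U \<union> V)) \<phi>" "q \<noteq> 0" for q \<phi>
  proof -
    have "is_rcobd q (top_of_set U) \<phi>" "is_rcobd q (top_of_set V) \<phi>"
      using \<phi>(1) U V is_cocycle_mono[of q "U \<union> V" \<phi>] unfolding acyclic_space_def by blast+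
    then show ?thesis
      using is_cobd_disjoint_Un[OF UV, of q \<phi>] \<phi>(2) by (simp add: is_rcobd_pos)
  qed
  moreover have "\<exists>k. is_rcobd 0 (top_of_set (U \<union> V)) (\<lambda>\<sigma>. \<phi> \<sigma> - k * ?\<kappa> \<sigma>)"
    if \<phi>: "is_cocycle 0 (top_of_set (U \<union> V)) \<phi>" for \<phi>
  proof -
    obtain i j where ij: "\<And>\<sigma>. singular_simplex 0 (top_of_set U) \<sigma> \<Longrightarrow> \<phi> \<sigma> = i"
      "\<And>\<sigma>. singular_simplex 0 (top_of_set V) \<sigma> \<Longrightarrow> \<phi> \<sigma> = j"
      using const[OF \<phi>] by blast
    have "\<phi> \<sigma> - (i - j) * ?\<kappa> \<sigma> = j" if "singular_simplex 0 (top_of_set (U \<union> V)) \<sigma>" for \<sigma>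
      using singular_simplex_disjoint_Un[OF UV that] ij singular_simplex_disjoint[OF UV(2)] by auto
    then show ?thesis unfolding is_rcobd_0 by blast
  qed
  moreover have "k = 0" if k: "is_rcobd 0 (top_of_set (U \<union> V)) (\<lambda>\<sigma>. k * ?\<kappa> \<sigma>)" for k
  proof -
    obtain c where c: "\<And>\<sigma>. singular_simplex 0 (top_of_set (U \<union> V)) \<sigma> \<Longrightarrow> k * ?\<kappa> \<sigma> = c"
      using k unfolding is_rcobd_0 by blast
    obtain p r where "p \<in> U" "r \<in> V" using assms(3,4) by blast
    then have p: "singular_simplex 0 (top_of_set U) (\<lambda>x\<in>standard_simplex 0. p)"
      and r: "singular_simplex 0 (top_of_set V) (\<lambda>x\<in>standard_simplex 0. r)"
      by (simp_all add: singular_simplex_const)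
    have "\<not> singular_simplex 0 (top_of_set U) (\<lambda>x\<in>standard_simplex 0. r)"
      using r singular_simplex_disjoint[OF UV(2)] by blast
    then have "k = c" "0 = c"
      using c[OF singular_simplex_top_of_set_mono[OF p, of "U \<union> V"]]
        c[OF singular_simplex_top_of_set_mono[OF r, of "U \<union> V"]] p r
      by auto
    then show ?thesis by simp
  qed
  ultimately show ?thesis using cocycle unfolding cohomology_sphere_def by blast
qed

section \<open>The antipodal map and the generators of the spheres\<close>

definition antipodal_sign :: "nat \<Rightarrow> 'a::real_normed_vector cochain \<Rightarrow> int \<Rightarrow> bool"
  where "antipodal_sign n \<kappa> s \<longleftrightarrow> is_rcobd n (top_of_set (sphere 0 1)) (\<lambda>\<sigma>. \<kappa> (simplex_map n uminus \<sigma>) - s * \<kappa> \<sigma>)"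

text \<open>The antipodal map exchanges the two points, so it turns the indicator of one point into
  \<open>1\<close> minus itself. In the augmented complex the constant disappears and the sign
  \<open>-1\<close> remains.\<close>

lemma cohomology_sphere_real_sphere:
  obtains \<kappa> where "cohomology_sphere 0 (top_of_set (sphere (0::real) 1)) \<kappa>" "antipodal_sign 0 \<kappa> (-1)"
proof -
  have S: "sphere (0::real) 1 = {1} \<union> {-1}" by (auto simp: dist_real_def)
  have op: "open_pair {1::real} {-1}"
    unfolding open_pair_def openin_open
    by (intro conjI exI[of _ "{0<..}"] exI[of _ "{..<0}"]) auto
  define \<kappa> where "\<kappa> \<sigma> = (if singular_simplex 0 (top_of_set {1::real}) \<sigma> then 1 else 0 :: int)" for \<sigma>
  have \<kappa>: "cohomology_sphere 0 (top_of_set (sphere (0::real) 1)) \<kappa>"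
    unfolding S \<kappa>_def using op by (intro cohomology_sphere_disjoint_Un acyclic_space_singleton) auto
  have "\<kappa> (simplex_map 0 uminus \<sigma>) + \<kappa> \<sigma> = 1" if "singular_simplex 0 (top_of_set ({1} \<union> {-1})) \<sigma>" for \<sigma>
  proof -
    have *: "singular_simplex 0 (top_of_set {- a}) (simplex_map 0 uminus \<sigma>)"
      if "singular_simplex 0 (top_of_set {a}) \<sigma>" for a :: real
      using that by (rule singular_simplex_simplex_map) (auto intro!: continuous_intros)
    show ?thesis
      using singular_simplex_disjoint_Un[OF op _ that] *[of 1] *[of "-1"]
        singular_simplex_disjoint[of "{1::real}" "{-1}" 0]
      by (auto simp: \<kappa>_def)
  qed
  then have "antipodal_sign 0 \<kappa> (-1)"
    unfolding antipodal_sign_def S is_rcobd_0 by auto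
  then show ?thesis using \<kappa> that by blast
qed

text \<open>The unit sphere without the pole \<open>(0, - s)\<close>, for \<open>s = 1\<close> or \<open>s = - 1\<close>.\<close>

definition cap :: "real \<Rightarrow> ('a::real_normed_vector \<times> real) set"
  where "cap s = {z \<in> sphere 0 1. fst z \<noteq> 0 \<or> s * snd z > 0}"

lemma norm_eq_norm_snd: "fst z = 0 \<Longrightarrow> norm z = norm (snd z)" for z :: "'a::real_normed_vector \<times> 'b::real_normed_vector"
  by (cases z) (simp add: norm_Pair)

lemma cap_Un: "cap 1 \<union> cap (-1) = sphere 0 1"
proof -
  have "z \<in> cap 1 \<union> cap (-1)" if "norm z = 1" for z :: "'a \<times> real"
    using that norm_eq_norm_snd[of z] by (auto simp: cap_def)
  then show ?thesis by (auto simp: cap_def)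
qed

lemma cap_Int: "cap 1 \<inter> cap (-1) = {z \<in> sphere 0 1. fst z \<noteq> 0}"
  by (auto simp: cap_def)

lemma open_pair_cap: "open_pair (cap 1 :: ('a::real_normed_vector \<times> real) set) (cap (-1))"
proof -
  have "openin (top_of_set (sphere 0 1)) (cap s :: ('a \<times> real) set)" for s
  proof -
    have "open {z :: 'a \<times> real. fst z \<noteq> 0 \<or> s * snd z > 0}"
      by (intro open_Collect_disj open_Collect_neq open_Collect_less continuous_intros)
    moreover have "cap s = sphere 0 1 \<inter> {z :: 'a \<times> real. fst z \<noteq> 0 \<or> s * snd z > 0}"
      by (auto simp: cap_def)
    ultimately show ?thesis unfolding openin_open by blast
  qed
  then show ?thesis by (simp add: open_pair_def cap_Un)
qed

lemma sgn_in_cap: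
  assumes "fst z \<noteq> 0 \<or> s * snd z > 0"
  shows "sgn z \<in> cap s"
proof -
  have "z \<noteq> 0" using assms by auto
  then show ?thesis
    using assms by (auto simp: cap_def norm_sgn sgn_div_norm zero_less_mult_iff mult_less_0_iff)
qed

text \<open>The condition describes a set that is star-shaped about the pole \<open>(0, s)\<close>.
  For \<open>t > 0\<close> a nonzero first component only gets scaled; if it is zero,
  \<open>s\<close> times the second component is a convex combination of \<open>s * s = 1\<close>
  and a positive number.\<close>

lemma cap_segment:
  assumes "\<bar>s\<bar> = 1" "z \<in> cap s" "0 \<le> t" "t \<le> 1" and w: "w = (1 - t) *\<^sub>R (0, s) + t *\<^sub>R z"
  shows "fst w \<noteq> 0 \<or> s * snd w > 0"
proof (cases "t = 0 \<or> fst z = 0")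
  case True
  have "s * s = 1" using assms(1) by (metis abs_mult_self_eq mult_1)
  have "s * snd w = (1 - t) * (s * s) + t * (s * snd z)" by (simp add: w algebra_simps)
  then have *: "s * snd w = (1 - t) + t * (s * snd z)" using \<open>s * s = 1\<close> by simp
  show ?thesis
  proof (cases "t = 0")
    case False
    then have "s * snd z > 0" using True assms(2) by (auto simp: cap_def)
    then have "t * (s * snd z) > 0" using False assms(3) by simp
    then show ?thesis using * assms(4) by simp
  qed (use * in simp)
qed (simp add: w)

lemma acyclic_space_cap:
  assumes "\<bar>s\<bar> = 1"
  shows "acyclic_space (top_of_set (cap s :: ('a::real_normed_vector \<times> real) set))"
proof (rule acyclic_space_deformation_retract)
  let ?p = "(0, s) :: 'a \<times> real"
  have p: "?p \<in> cap s" using assms by (auto simp: cap_def norm_Pair abs_if split: if_splits)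
  show "acyclic_space (top_of_set {?p})" by (rule acyclic_space_singleton)
  show "continuous_map (top_of_set (cap s)) (top_of_set {?p}) (\<lambda>_. ?p)"
    "continuous_map (top_of_set {?p}) (top_of_set (cap s)) id" using p by auto
  show "homotopic_with (\<lambda>_. True) (top_of_set (cap s)) (top_of_set (cap s)) (id \<circ> (\<lambda>_. ?p)) id"
  proof (rule homotopic_normalized_segment)
    fix z :: "'a \<times> real" and t :: real assume z: "z \<in> cap s" "0 \<le> t" "t \<le> 1"
    let ?w = "(1 - t) *\<^sub>R (id \<circ> (\<lambda>_. ?p)) z + t *\<^sub>R z"
    have "fst ?w \<noteq> 0 \<or> s * snd ?w > 0" by (rule cap_segment[OF assms z]) simp
    moreover from this have "?w \<noteq> 0" by (metis fst_zero snd_zero mult_zero_right less_irrefl)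
    ultimately show "?w \<noteq> 0 \<and> sgn ?w \<in> cap s" using sgn_in_cap[of ?w s] by blast
  qed (use p in \<open>auto simp: cap_def\<close>)
qed auto

lemma homotopic_equator:
  "homotopic_with (\<lambda>_. True) (top_of_set {z :: 'a::real_normed_vector \<times> real. z \<in> sphere 0 1 \<and> fst z \<noteq> 0})
    (top_of_set {z. z \<in> sphere 0 1 \<and> fst z \<noteq> 0}) ((\<lambda>x. (x, 0)) \<circ> (\<lambda>z. sgn (fst z))) id"
proof (rule homotopic_normalized_segment)
  let ?E = "{z :: 'a \<times> real. z \<in> sphere 0 1 \<and> fst z \<noteq> 0}"
  show "continuous_on ?E ((\<lambda>x. (x, 0)) \<circ> (\<lambda>z. sgn (fst z)))"
    unfolding o_def by (intro continuous_intros) auto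
  fix z :: "'a \<times> real" assume z: "z \<in> ?E"
  then show "((\<lambda>x. (x, 0)) \<circ> (\<lambda>z. sgn (fst z))) z \<in> ?E" by (simp add: norm_Pair norm_sgn sgn_zero_iff)
  fix t :: real assume t: "0 \<le> t" "t \<le> 1"
  let ?w = "(1 - t) *\<^sub>R ((\<lambda>x. (x, 0)) \<circ> (\<lambda>z. sgn (fst z))) z + t *\<^sub>R z"
  have "fst ?w = ((1 - t) / norm (fst z) + t) *\<^sub>R fst z"
    by (simp add: sgn_div_norm algebra_simps divide_inverse)
  moreover have "(1 - t) / norm (fst z) + t > 0"
    using t z by (cases "t = 0") (auto intro!: add_nonneg_pos)
  ultimately have w: "fst ?w \<noteq> 0" using z by auto
  then have "?w \<noteq> 0" by (metis fst_zero)
  then show "?w \<noteq> 0 \<and> sgn ?w \<in> ?E" using w by (auto simp: norm_sgn sgn_div_norm)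
qed auto

text \<open>The sphere is the suspension of its equator, with the two caps as cones. The antipodal
  map exchanges the caps, which negates the connecting class, and induces the antipodal map of the
  equator, which contributes \<open>s\<close>; together they give \<open>- s\<close>.\<close>

lemma cohomology_sphere_sphere_Suc:
  fixes \<kappa> :: "'a::real_normed_vector cochain"
  assumes \<kappa>: "cohomology_sphere n (top_of_set (sphere 0 1)) \<kappa>" and s: "antipodal_sign n \<kappa> s"
  obtains \<omega> :: "('a \<times> real) cochain" where "cohomology_sphere (Suc n) (top_of_set (sphere 0 1)) \<omega>"
    "conn n (cap 1) (cap (-1)) \<omega> (\<lambda>\<sigma>. \<kappa> (simplex_map n (\<lambda>z. sgn (fst z)) \<sigma>))"
    "antipodal_sign (Suc n) \<omega> (- s)"
proof -
  let ?E = "cap 1 \<inter> cap (-1) :: ('a \<times> real) set"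
  let ?v = "\<lambda>z :: 'a \<times> real. sgn (fst z)"
  let ?\<kappa>' = "\<lambda>\<sigma>. \<kappa> (simplex_map n ?v \<sigma>)"
  have v: "continuous_map (top_of_set ?E) (top_of_set (sphere 0 1)) ?v"
    unfolding cap_Int by (auto simp: norm_sgn intro!: continuous_intros)
  have \<kappa>': "cohomology_sphere n (top_of_set ?E) ?\<kappa>'"
  proof (rule cohomology_sphere_deformation_retract[OF \<kappa> v])
    show "continuous_map (top_of_set (sphere 0 1)) (top_of_set ?E) (\<lambda>x. (x, 0))"
      unfolding cap_Int by (auto simp: norm_Pair intro!: continuous_intros)
    show "homotopic_with (\<lambda>_. True) (top_of_set ?E) (top_of_set ?E) ((\<lambda>x. (x, 0)) \<circ> ?v) id"
      unfolding cap_Int by (rule homotopic_equator)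
  qed (simp add: sgn_div_norm)
  have caps: "acyclic_space (top_of_set (cap 1 :: ('a \<times> real) set))"
    "acyclic_space (top_of_set (cap (-1) :: ('a \<times> real) set))"
    by (rule acyclic_space_cap, simp)+
  obtain \<omega> where \<omega>: "cohomology_sphere (Suc n) (top_of_set (cap 1 \<union> cap (-1))) \<omega>"
    "conn n (cap 1) (cap (-1)) \<omega> ?\<kappa>'"
    using cohomology_sphere_suspension[OF open_pair_cap caps \<kappa>'] by blast
  let ?A = "uminus :: 'a \<times> real \<Rightarrow> 'a \<times> real"
  let ?\<omega>A = "\<lambda>\<sigma>. \<omega> (simplex_map (Suc n) ?A \<sigma>)"
  have A: "continuous_map (top_of_set (cap 1)) (top_of_set (cap (-1))) ?A"
    "continuous_map (top_of_set (cap (-1))) (top_of_set (cap 1)) ?A"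
    by (auto simp: cap_def intro!: continuous_intros)
  have conn_A: "conn n (cap 1) (cap (-1)) ?\<omega>A (\<lambda>\<sigma>. - ?\<kappa>' (simplex_map n ?A \<sigma>))"
    using conn_pullback[OF conn_commute[OF \<omega>(2)] A] .
  have "is_rcobd n (top_of_set ?E) (\<lambda>\<sigma>. \<kappa> (simplex_map n uminus (simplex_map n ?v \<sigma>)) - s * ?\<kappa>' \<sigma>)"
    using is_rcobd_pullback[OF s[unfolded antipodal_sign_def] v] .
  moreover have "simplex_map n ?v (simplex_map n ?A \<sigma>) = simplex_map n uminus (simplex_map n ?v \<sigma>)" for \<sigma>
    by (simp add: simplex_map_simplex_map o_def sgn_minus)
  ultimately have r: "is_rcobd n (top_of_set ?E) (\<lambda>\<sigma>. 0 - (1 * (- ?\<kappa>' (simplex_map n ?A \<sigma>)) + s * ?\<kappa>' \<sigma>))"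
    by simp
  \<comment> \<open>The combination with coefficients \<open>1\<close> and \<open>s\<close> has
    connecting class zero, hence is a coboundary; this is the claimed sign.\<close>
  have "conn n (cap 1) (cap (-1)) (\<lambda>\<sigma>. ?\<omega>A \<sigma> - (- s) * \<omega> \<sigma>) (\<lambda>_. 0)"
    by (rule conn_lincomb[OF conn_A \<omega>(2) _ r]) simp
  moreover have "is_cocycle (Suc n) (top_of_set (cap 1 \<union> cap (-1))) (\<lambda>\<sigma>. ?\<omega>A \<sigma> - (- s) * \<omega> \<sigma>)"
  proof (rule is_cocycle_lincomb[OF is_cocycle_pullback, where k = 1 and l = s])
    show "is_cocycle (Suc n) (top_of_set (cap 1 \<union> cap (-1))) \<omega>" using cohomology_sphereD(1)[OF \<omega>(1)] .
    then show "is_cocycle (Suc n) (top_of_set (cap 1 \<union> cap (-1))) \<omega>" .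
    show "continuous_map (top_of_set (cap 1 \<union> cap (-1))) (top_of_set (cap 1 \<union> cap (-1))) ?A"
      unfolding cap_Un by (auto intro!: continuous_intros)
  qed simp
  ultimately have "is_cobd (Suc n) (top_of_set (cap 1 \<union> cap (-1))) (\<lambda>\<sigma>. ?\<omega>A \<sigma> - (- s) * \<omega> \<sigma>)"
    using conn_rcobd_imp_is_cobd[OF open_pair_cap _ _ is_rcobd_zero] by blast
  then have "antipodal_sign (Suc n) \<omega> (- s)"
    unfolding antipodal_sign_def cap_Un by (rule is_cobd_imp_is_rcobd)
  then show ?thesis using \<omega> that unfolding cap_Un by blast
qed

text \<open>The spheres lie in nested products of lines. Each suspension flips the antipodal sign,
  from \<open>-1\<close> on two points to \<open>1\<close> on the circle and back to
  \<open>-1\<close> on \<open>S^2\<close>. The connecting relation between the last two generators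
  is kept, since it is what determines the degree of the gluing map.\<close>

lemma cohomology_sphere_2_and_3:
  obtains \<kappa> :: "((real \<times> real) \<times> real) cochain" and \<omega> :: "(((real \<times> real) \<times> real) \<times> real) cochain" where
    "cohomology_sphere (Suc (Suc 0)) (top_of_set (sphere 0 1)) \<kappa>" "antipodal_sign (Suc (Suc 0)) \<kappa> (-1)"
    "cohomology_sphere (Suc (Suc (Suc 0))) (top_of_set (sphere 0 1)) \<omega>"
    "conn (Suc (Suc 0)) (cap 1) (cap (-1)) \<omega> (\<lambda>\<sigma>. \<kappa> (simplex_map (Suc (Suc 0)) (\<lambda>z. sgn (fst z)) \<sigma>))"
proof -
  obtain \<kappa>0 where 0: "cohomology_sphere 0 (top_of_set (sphere (0::real) 1)) \<kappa>0" "antipodal_sign 0 \<kappa>0 (-1)"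
    by (rule cohomology_sphere_real_sphere)
  obtain \<kappa>1 :: "(real \<times> real) cochain" where
    1: "cohomology_sphere (Suc 0) (top_of_set (sphere 0 1)) \<kappa>1" "antipodal_sign (Suc 0) \<kappa>1 (- (-1))"
    using cohomology_sphere_sphere_Suc[OF 0] by blast
  obtain \<kappa>2 :: "((real \<times> real) \<times> real) cochain" where
    2: "cohomology_sphere (Suc (Suc 0)) (top_of_set (sphere 0 1)) \<kappa>2" "antipodal_sign (Suc (Suc 0)) \<kappa>2 (- (- (-1)))"
    using cohomology_sphere_sphere_Suc[OF 1] by blast
  obtain \<omega> :: "(((real \<times> real) \<times> real) \<times> real) cochain" where
    3: "cohomology_sphere (Suc (Suc (Suc 0))) (top_of_set (sphere 0 1)) \<omega>"
    "conn (Suc (Suc 0)) (cap 1) (cap (-1)) \<omega> (\<lambda>\<sigma>. \<kappa>2 (simplex_map (Suc (Suc 0)) (\<lambda>z. sgn (fst z)) \<sigma>))"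
    using cohomology_sphere_sphere_Suc[OF 2] by blast
  show ?thesis
    using that[of \<kappa>2 \<omega>] 2 3 by simp
qed

section \<open>Mayer-Vietoris computations\<close>

lemma cohomology_sphere_is_cobd:
  "cohomology_sphere n X \<kappa> \<Longrightarrow> is_cocycle q X \<phi> \<Longrightarrow> q \<noteq> n \<Longrightarrow> 0 < q \<Longrightarrow> is_cobd q X \<phi>"
  using cohomology_sphereD(2) is_rcobd_pos by blast

lemma conn_is_cobd_left: "conn q U V \<phi> \<kappa> \<Longrightarrow> is_cobd (Suc q) (top_of_set U) \<phi>"
  unfolding conn_def is_cobd_def by blast

definition cohomology_generator :: "nat \<Rightarrow> 'a topology \<Rightarrow> 'a cochain \<Rightarrow> bool"
  where "cohomology_generator q X \<beta> \<longleftrightarrow> is_cocycle q X \<beta> \<and>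
    (\<forall>\<phi>. is_cocycle q X \<phi> \<longrightarrow> (\<exists>k. is_cobd q X (\<lambda>\<sigma>. \<phi> \<sigma> - k * \<beta> \<sigma>))) \<and>
    (\<forall>k. is_cobd q X (\<lambda>\<sigma>. k * \<beta> \<sigma>) \<longrightarrow> k = 0)"

lemma cohomology_generatorI:
  assumes "is_cocycle q X \<beta>" "\<And>\<phi>. is_cocycle q X \<phi> \<Longrightarrow> \<exists>k. is_cobd q X (\<lambda>\<sigma>. \<phi> \<sigma> - k * \<beta> \<sigma>)"
    and "\<And>k. is_cobd q X (\<lambda>\<sigma>. k * \<beta> \<sigma>) \<Longrightarrow> k = 0"
  shows "cohomology_generator q X \<beta>"
  using assms unfolding cohomology_generator_def by blast

lemma cohomology_generatorD:
  assumes "cohomology_generator q X \<beta>"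
  shows "is_cocycle q X \<beta>" "\<And>\<phi>. is_cocycle q X \<phi> \<Longrightarrow> \<exists>k. is_cobd q X (\<lambda>\<sigma>. \<phi> \<sigma> - k * \<beta> \<sigma>)"
    and "\<And>k. is_cobd q X (\<lambda>\<sigma>. k * \<beta> \<sigma>) \<Longrightarrow> k = 0"
  using assms unfolding cohomology_generator_def by blast+

lemma cohomology_sphere_generator:
  "cohomology_sphere (Suc n) X \<kappa> \<Longrightarrow> cohomology_generator (Suc n) X \<kappa>"
  unfolding cohomology_sphere_def cohomology_generator_def by (simp add: is_rcobd_pos)

text \<open>
  The cover of (a space homotopy equivalent to) \<open>S^(m+1) \<times> S^1\<close> by the preimages of two arcs;
  \<open>P\<close> and \<open>M\<close> are the preimages of the two components of the intersection of the arcs.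
\<close>

locale sphere_circle_cover =
  fixes m :: nat and N N' P M :: "'a::topological_space set" and \<kappa> :: "'a cochain"
  assumes m: "0 < m" and NN': "open_pair N N'" and Int: "N \<inter> N' = P \<union> M"
    and PM: "open_pair P M" "P \<inter> M = {}"
    and \<kappa>: "is_cocycle (Suc m) (top_of_set (N \<union> N')) \<kappa>"
    and N: "cohomology_sphere (Suc m) (top_of_set N) \<kappa>"
    and N': "cohomology_sphere (Suc m) (top_of_set N') \<kappa>"
    and P: "cohomology_sphere (Suc m) (top_of_set P) \<kappa>"
    and M: "cohomology_sphere (Suc m) (top_of_set M) \<kappa>"
begin

lemma subsets: "N \<subseteq> N \<union> N'" "N' \<subseteq> N \<union> N'" "P \<subseteq> N" "P \<subseteq> N'" "M \<subseteq> N" "M \<subseteq> N'"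
  "P \<subseteq> N \<inter> N'" "M \<subseteq> N \<inter> N'"
  using Int by blast+

lemma not_simplex_P: "singular_simplex q (top_of_set M) \<sigma> \<Longrightarrow> \<not> singular_simplex q (top_of_set P) \<sigma>"
  using singular_simplex_disjoint[OF PM(2)] by blast

lemma is_cobd_Int:
  "is_cobd q (top_of_set P) \<phi> \<Longrightarrow> is_cobd q (top_of_set M) \<phi> \<Longrightarrow> is_cobd q (top_of_set (N \<inter> N')) \<phi>"
  unfolding Int by (rule is_cobd_disjoint_Un[OF PM])

lemma is_cobd_N: "is_cocycle q (top_of_set (N \<union> N')) \<phi> \<Longrightarrow> q \<noteq> Suc m \<Longrightarrow> 0 < q \<Longrightarrow> is_cobd q (top_of_set N) \<phi>"
  and is_cobd_N': "is_cocycle q (top_of_set (N \<union> N')) \<phi> \<Longrightarrow> q \<noteq> Suc m \<Longrightarrow> 0 < q \<Longrightarrow> is_cobd q (top_of_set N') \<phi>"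
  using cohomology_sphere_is_cobd[OF N, of q \<phi>] cohomology_sphere_is_cobd[OF N', of q \<phi>]
    is_cocycle_mono[of q "N \<union> N'" \<phi>] by simp_all

lemma is_cocycle_imp_is_rcobd_Int:
  assumes "is_cocycle q (top_of_set (N \<inter> N')) \<phi>" "q \<noteq> Suc m" "0 < q"
  shows "is_rcobd q (top_of_set (N \<inter> N')) \<phi>"
  using assms is_cocycle_mono[OF assms(1)] subsets
  by (intro is_cobd_imp_is_rcobd is_cobd_Int cohomology_sphere_is_cobd[OF P] cohomology_sphere_is_cobd[OF M]) auto

lemma degree_0: "is_cocycle 0 (top_of_set (N \<union> N')) \<phi> \<Longrightarrow> is_rcobd 0 (top_of_set (N \<union> N')) \<phi>"
  using cohomology_sphere_nonempty[OF P] subsets is_cocycle_mono[of 0 "N \<union> N'" \<phi>]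
  by (intro is_rcobd_0_Un cohomology_sphereD(2)[OF N] cohomology_sphereD(2)[OF N']) auto

text \<open>The three excluded values of \<open>r\<close> are those where a neighbouring group
  survives: for \<open>r = 0\<close> and \<open>r = Suc m\<close> on the intersection, for
  \<open>r = m\<close> on \<open>N\<close> and \<open>N'\<close>.\<close>

lemma degree_other:
  assumes \<phi>: "is_cocycle (Suc r) (top_of_set (N \<union> N')) \<phi>" and r: "r \<noteq> 0" "r \<noteq> m" "r \<noteq> Suc m"
  shows "is_cobd (Suc r) (top_of_set (N \<union> N')) \<phi>"
proof -
  have "is_cobd (Suc r) (top_of_set N) \<phi>" "is_cobd (Suc r) (top_of_set N') \<phi>"
    using is_cobd_N[OF \<phi>] is_cobd_N'[OF \<phi>] r by auto
  then obtain \<mu> where \<mu>: "is_cocycle r (top_of_set (N \<inter> N')) \<mu>" "conn r N N' \<phi> \<mu>" by (rule conn_exists)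
  have "is_rcobd r (top_of_set (N \<inter> N')) \<mu>" using is_cocycle_imp_is_rcobd_Int[OF \<mu>(1)] r by auto
  then show ?thesis by (rule conn_rcobd_imp_is_cobd[OF NN' \<phi> \<mu>(2)])
qed

text \<open>The class of the circle factor. The intersection falls into \<open>P\<close> and
  \<open>M\<close>, while \<open>N\<close> and \<open>N'\<close> have no reduced cohomology in
  degree \<open>0\<close>; so the indicator of \<open>P\<close>, taken modulo constants, has a
  connecting image of infinite order, and it generates.\<close>

lemma degree_1: "\<exists>\<beta>. cohomology_generator (Suc 0) (top_of_set (N \<union> N')) \<beta>"
proof -
  let ?ind = "\<lambda>\<sigma>. if singular_simplex 0 (top_of_set P) \<sigma> then 1 else 0 :: int"
  have "is_cocycle 0 (top_of_set (N \<inter> N')) ?ind"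
    unfolding Int
  proof (rule is_cocycle_disjoint_Un[OF PM])
    show "is_cocycle 0 (top_of_set P) ?ind"
      by (rule is_cocycle_cong[OF is_cocycle_const[of _ 1]]) simp
    show "is_cocycle 0 (top_of_set M) ?ind"
      by (rule is_cocycle_cong[OF is_cocycle_const[of _ 0]]) (simp add: not_simplex_P)
  qed
  then obtain \<beta> where \<beta>: "is_cocycle (Suc 0) (top_of_set (N \<union> N')) \<beta>" "conn 0 N N' \<beta> ?ind"
    by (rule cocycle_with_conn_exists[OF NN'])
  have "cohomology_generator (Suc 0) (top_of_set (N \<union> N')) \<beta>"
  proof (rule cohomology_generatorI[OF \<beta>(1)])
    fix \<phi> assume \<phi>: "is_cocycle (Suc 0) (top_of_set (N \<union> N')) \<phi>"
    have "is_cobd (Suc 0) (top_of_set N) \<phi>" "is_cobd (Suc 0) (top_of_set N') \<phi>"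
      using is_cobd_N[OF \<phi>] is_cobd_N'[OF \<phi>] m by auto
    then obtain \<mu> where \<mu>: "is_cocycle 0 (top_of_set (N \<inter> N')) \<mu>" "conn 0 N N' \<phi> \<mu>" by (rule conn_exists)
    have "is_rcobd 0 (top_of_set P) \<mu>" "is_rcobd 0 (top_of_set M) \<mu>"
      using is_cocycle_mono[OF \<mu>(1)] subsets(7,8)
      by (auto intro!: cohomology_sphereD(2)[OF P] cohomology_sphereD(2)[OF M])
    then obtain i j where ij: "\<And>\<sigma>. singular_simplex 0 (top_of_set P) \<sigma> \<Longrightarrow> \<mu> \<sigma> = i"
      "\<And>\<sigma>. singular_simplex 0 (top_of_set M) \<sigma> \<Longrightarrow> \<mu> \<sigma> = j"
      unfolding is_rcobd_0 by blast
    let ?\<theta> = "\<lambda>\<sigma>. \<phi> \<sigma> - (i - j) * \<beta> \<sigma>"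
    have "conn 0 N N' ?\<theta> (\<lambda>\<sigma>. \<mu> \<sigma> - (i - j) * ?ind \<sigma>)"
      by (rule conn_lincomb[OF \<mu>(2) \<beta>(2), where k = 1 and l = "- (i - j)"]) (simp_all add: algebra_simps)
    moreover have "\<mu> \<sigma> - (i - j) * ?ind \<sigma> = j" if "singular_simplex 0 (top_of_set (N \<inter> N')) \<sigma>" for \<sigma>
      using singular_simplex_disjoint_Un[OF PM that[unfolded Int]] ij not_simplex_P by auto
    then have "is_rcobd 0 (top_of_set (N \<inter> N')) (\<lambda>\<sigma>. \<mu> \<sigma> - (i - j) * ?ind \<sigma>)"
      unfolding is_rcobd_0 by blast
    moreover have "is_cocycle (Suc 0) (top_of_set (N \<union> N')) ?\<theta>"
      by (rule is_cocycle_lincomb[OF \<phi> \<beta>(1), where k = 1 and l = "- (i - j)"]) (simp add: algebra_simps)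
    ultimately have "is_cobd (Suc 0) (top_of_set (N \<union> N')) ?\<theta>"
      using conn_rcobd_imp_is_cobd[OF NN'] by blast
    then show "\<exists>k. is_cobd (Suc 0) (top_of_set (N \<union> N')) (\<lambda>\<sigma>. \<phi> \<sigma> - k * \<beta> \<sigma>)" by blast
  next
    fix k assume k: "is_cobd (Suc 0) (top_of_set (N \<union> N')) (\<lambda>\<sigma>. k * \<beta> \<sigma>)"
    have "conn 0 N N' (\<lambda>\<sigma>. k * \<beta> \<sigma>) (\<lambda>\<sigma>. k * ?ind \<sigma>)"
      by (rule conn_lincomb[OF \<beta>(2,2), where k = k and l = 0]) simp_all
    from conn_is_cobd[OF this k] obtain a b where ab: "is_cocycle 0 (top_of_set N) a"
      "is_cocycle 0 (top_of_set N') b" "is_rcobd 0 (top_of_set (N \<inter> N')) (\<lambda>\<sigma>. k * ?ind \<sigma> - (a \<sigma> - b \<sigma>))"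
      by blast
    \<comment> \<open>\<open>a\<close> is constant on \<open>N\<close> and \<open>b\<close> on
      \<open>N'\<close>, so \<open>k\<close> times the indicator of \<open>P\<close> is constant on
      the intersection; comparing a point of \<open>P\<close> with one of \<open>M\<close> gives
      \<open>k = 0\<close>.\<close>
    have r: "is_rcobd 0 (top_of_set (N \<inter> N')) a" "is_rcobd 0 (top_of_set (N \<inter> N')) b"
      by (rule is_rcobd_mono[OF cohomology_sphereD(2)[OF N ab(1)]], simp, blast)
        (rule is_rcobd_mono[OF cohomology_sphereD(2)[OF N' ab(2)]], simp, blast)
    have "is_rcobd 0 (top_of_set (N \<inter> N')) (\<lambda>\<sigma>. a \<sigma> - b \<sigma>)"
      by (rule is_rcobd_lincomb[OF r, where k = 1 and l = "-1"]) simp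
    from is_rcobd_lincomb[OF ab(3) this, where k = 1 and l = 1]
    have "is_rcobd 0 (top_of_set (N \<inter> N')) (\<lambda>\<sigma>. k * ?ind \<sigma>)" by simp
    then obtain c where c: "\<And>\<sigma>. singular_simplex 0 (top_of_set (N \<inter> N')) \<sigma> \<Longrightarrow> k * ?ind \<sigma> = c"
      unfolding is_rcobd_0 by blast
    obtain p r where "p \<in> P" "r \<in> M"
      using cohomology_sphere_nonempty[OF P] cohomology_sphere_nonempty[OF M] by blast
    then have p: "singular_simplex 0 (top_of_set P) (\<lambda>x\<in>standard_simplex 0. p)"
      and r: "singular_simplex 0 (top_of_set M) (\<lambda>x\<in>standard_simplex 0. r)"
      by (simp_all add: singular_simplex_const)
    have "k = c" "0 = c"
      using c[OF singular_simplex_top_of_set_mono[OF p subsets(7)]] p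
        c[OF singular_simplex_top_of_set_mono[OF r subsets(8)]] not_simplex_P[OF r] by simp_all
    then show "k = 0" by simp
  qed
  then show ?thesis by blast
qed

text \<open>A class is some \<open>i * \<kappa>\<close> on \<open>N\<close> and some
  \<open>j * \<kappa>\<close> on \<open>N'\<close>; on \<open>P\<close>, where both descriptions
  hold, \<open>i = j\<close>. What remains after subtraction comes from degree \<open>m\<close> of
  the intersection, which carries nothing because \<open>m\<close> is neither \<open>0\<close> nor
  \<open>Suc m\<close>.\<close>

lemma degree_Suc_m: "cohomology_generator (Suc m) (top_of_set (N \<union> N')) \<kappa>"
proof (rule cohomology_generatorI[OF \<kappa>])
  fix \<phi> assume \<phi>: "is_cocycle (Suc m) (top_of_set (N \<union> N')) \<phi>"
  obtain i where i: "is_cobd (Suc m) (top_of_set N) (\<lambda>\<sigma>. \<phi> \<sigma> - i * \<kappa> \<sigma>)"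
    using cohomology_generatorD(2)[OF cohomology_sphere_generator[OF N] is_cocycle_mono[OF \<phi> subsets(1)]] by blast
  obtain j where j: "is_cobd (Suc m) (top_of_set N') (\<lambda>\<sigma>. \<phi> \<sigma> - j * \<kappa> \<sigma>)"
    using cohomology_generatorD(2)[OF cohomology_sphere_generator[OF N'] is_cocycle_mono[OF \<phi> subsets(2)]] by blast
  have "is_cobd (Suc m) (top_of_set P) (\<lambda>\<sigma>. (i - j) * \<kappa> \<sigma>)"
    by (rule is_cobd_lincomb[OF is_cobd_mono[OF i subsets(3)] is_cobd_mono[OF j subsets(4)], where k = "-1" and l = 1])
      (simp add: algebra_simps)
  then have "i = j" using cohomology_generatorD(3)[OF cohomology_sphere_generator[OF P]] by fastforce
  let ?\<theta> = "\<lambda>\<sigma>. \<phi> \<sigma> - i * \<kappa> \<sigma>"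
  obtain \<mu> where \<mu>: "is_cocycle m (top_of_set (N \<inter> N')) \<mu>" "conn m N N' ?\<theta> \<mu>"
    using conn_exists[OF i j[folded \<open>i = j\<close>]] by blast
  have "is_cocycle (Suc m) (top_of_set (N \<union> N')) ?\<theta>"
    by (rule is_cocycle_lincomb[OF \<phi> \<kappa>, where k = 1 and l = "- i"]) simp
  moreover have "is_rcobd m (top_of_set (N \<inter> N')) \<mu>" using is_cocycle_imp_is_rcobd_Int[OF \<mu>(1)] m by auto
  ultimately have "is_cobd (Suc m) (top_of_set (N \<union> N')) ?\<theta>"
    using conn_rcobd_imp_is_cobd[OF NN' _ \<mu>(2)] by blast
  then show "\<exists>k. is_cobd (Suc m) (top_of_set (N \<union> N')) (\<lambda>\<sigma>. \<phi> \<sigma> - k * \<kappa> \<sigma>)" by blast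
next
  fix k assume "is_cobd (Suc m) (top_of_set (N \<union> N')) (\<lambda>\<sigma>. k * \<kappa> \<sigma>)"
  then show "k = 0"
    using cohomology_generatorD(3)[OF cohomology_sphere_generator[OF N]] is_cobd_mono[OF _ subsets(1)] by blast
qed

text \<open>The top class of sphere times circle is the connecting image of \<kappa> placed on
  \<open>P\<close> alone. The second clause evaluates any class from its coefficients
  \<open>i\<close> on \<open>P\<close> and \<open>j\<close> on \<open>M\<close>: only their
  difference counts, because \<open>j * \<kappa>\<close> is a cocycle on all of \<open>N\<close> and
  can be removed from both components.\<close>

lemma degree_Suc_Suc_m:
  obtains \<eta> where "cohomology_generator (Suc (Suc m)) (top_of_set (N \<union> N')) \<eta>"
    and "\<And>\<zeta> \<mu> i j. is_cocycle (Suc (Suc m)) (top_of_set (N \<union> N')) \<zeta> \<Longrightarrow> conn (Suc m) N N' \<zeta> \<mu> \<Longrightarrow>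
      is_cobd (Suc m) (top_of_set P) (\<lambda>\<sigma>. \<mu> \<sigma> - i * \<kappa> \<sigma>) \<Longrightarrow>
      is_cobd (Suc m) (top_of_set M) (\<lambda>\<sigma>. \<mu> \<sigma> - j * \<kappa> \<sigma>) \<Longrightarrow>
      is_cobd (Suc (Suc m)) (top_of_set (N \<union> N')) (\<lambda>\<sigma>. \<zeta> \<sigma> - (i - j) * \<eta> \<sigma>)"
proof -
  let ?\<kappa>P = "\<lambda>\<sigma>. if singular_simplex (Suc m) (top_of_set P) \<sigma> then \<kappa> \<sigma> else 0"
  have "is_cocycle (Suc m) (top_of_set (N \<inter> N')) ?\<kappa>P"
    unfolding Int
  proof (rule is_cocycle_disjoint_Un[OF PM])
    show "is_cocycle (Suc m) (top_of_set P) ?\<kappa>P"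
      by (rule is_cocycle_cong[OF cohomology_sphereD(1)[OF P]]) simp
    show "is_cocycle (Suc m) (top_of_set M) ?\<kappa>P"
      by (rule is_cocycle_cong[OF is_cocycle_zero]) (simp add: not_simplex_P)
  qed
  then obtain \<eta> where \<eta>: "is_cocycle (Suc (Suc m)) (top_of_set (N \<union> N')) \<eta>" "conn (Suc m) N N' \<eta> ?\<kappa>P"
    by (rule cocycle_with_conn_exists[OF NN'])
  have key: "is_cobd (Suc (Suc m)) (top_of_set (N \<union> N')) (\<lambda>\<sigma>. \<zeta> \<sigma> - (i - j) * \<eta> \<sigma>)"
    if \<zeta>: "is_cocycle (Suc (Suc m)) (top_of_set (N \<union> N')) \<zeta>" and c: "conn (Suc m) N N' \<zeta> \<mu>"
      and i: "is_cobd (Suc m) (top_of_set P) (\<lambda>\<sigma>. \<mu> \<sigma> - i * \<kappa> \<sigma>)"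
      and j: "is_cobd (Suc m) (top_of_set M) (\<lambda>\<sigma>. \<mu> \<sigma> - j * \<kappa> \<sigma>)" for \<zeta> \<mu> i j
  proof (rule conn_imp_is_cobd[OF NN'])
    show "is_cocycle (Suc (Suc m)) (top_of_set (N \<union> N')) (\<lambda>\<sigma>. \<zeta> \<sigma> - (i - j) * \<eta> \<sigma>)"
      by (rule is_cocycle_lincomb[OF \<zeta> \<eta>(1), where k = 1 and l = "- (i - j)"]) (simp add: algebra_simps)
    show "conn (Suc m) N N' (\<lambda>\<sigma>. \<zeta> \<sigma> - (i - j) * \<eta> \<sigma>) (\<lambda>\<sigma>. \<mu> \<sigma> - (i - j) * ?\<kappa>P \<sigma>)"
      by (rule conn_lincomb[OF c \<eta>(2), where k = 1 and l = "- (i - j)"]) (simp_all add: algebra_simps)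
    show "is_cocycle (Suc m) (top_of_set N) (\<lambda>\<sigma>. j * \<kappa> \<sigma>)"
      by (rule is_cocycle_lincomb[OF cohomology_sphereD(1)[OF N] is_cocycle_zero, where k = j and l = 0]) simp
    show "is_cocycle (Suc m) (top_of_set N') (\<lambda>\<sigma>. 0)" by simp
    have "is_cobd (Suc m) (top_of_set (N \<inter> N')) (\<lambda>\<sigma>. (\<mu> \<sigma> - (i - j) * ?\<kappa>P \<sigma>) - (j * \<kappa> \<sigma> - 0))"
    proof (rule is_cobd_Int)
      show "is_cobd (Suc m) (top_of_set P) (\<lambda>\<sigma>. (\<mu> \<sigma> - (i - j) * ?\<kappa>P \<sigma>) - (j * \<kappa> \<sigma> - 0))"
        by (rule is_cobd_cong[OF i]) (simp add: algebra_simps)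
      show "is_cobd (Suc m) (top_of_set M) (\<lambda>\<sigma>. (\<mu> \<sigma> - (i - j) * ?\<kappa>P \<sigma>) - (j * \<kappa> \<sigma> - 0))"
        by (rule is_cobd_cong[OF j]) (simp add: not_simplex_P)
    qed
    then show "is_rcobd (Suc m) (top_of_set (N \<inter> N')) (\<lambda>\<sigma>. (\<mu> \<sigma> - (i - j) * ?\<kappa>P \<sigma>) - (j * \<kappa> \<sigma> - 0))"
      by (rule is_cobd_imp_is_rcobd)
  qed
  have "cohomology_generator (Suc (Suc m)) (top_of_set (N \<union> N')) \<eta>"
  proof (rule cohomology_generatorI[OF \<eta>(1)])
    fix \<phi> assume \<phi>: "is_cocycle (Suc (Suc m)) (top_of_set (N \<union> N')) \<phi>"
    have "is_cobd (Suc (Suc m)) (top_of_set N) \<phi>" "is_cobd (Suc (Suc m)) (top_of_set N') \<phi>"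
      using is_cobd_N[OF \<phi>] is_cobd_N'[OF \<phi>] by auto
    then obtain \<mu> where \<mu>: "is_cocycle (Suc m) (top_of_set (N \<inter> N')) \<mu>" "conn (Suc m) N N' \<phi> \<mu>"
      by (rule conn_exists)
    obtain i where i: "is_cobd (Suc m) (top_of_set P) (\<lambda>\<sigma>. \<mu> \<sigma> - i * \<kappa> \<sigma>)"
      using cohomology_generatorD(2)[OF cohomology_sphere_generator[OF P] is_cocycle_mono[OF \<mu>(1) subsets(7)]] by blast
    obtain j where j: "is_cobd (Suc m) (top_of_set M) (\<lambda>\<sigma>. \<mu> \<sigma> - j * \<kappa> \<sigma>)"
      using cohomology_generatorD(2)[OF cohomology_sphere_generator[OF M] is_cocycle_mono[OF \<mu>(1) subsets(8)]] by blast
    show "\<exists>k. is_cobd (Suc (Suc m)) (top_of_set (N \<union> N')) (\<lambda>\<sigma>. \<phi> \<sigma> - k * \<eta> \<sigma>)"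
      using key[OF \<phi> \<mu>(2) i j] by blast
  next
    fix k assume k: "is_cobd (Suc (Suc m)) (top_of_set (N \<union> N')) (\<lambda>\<sigma>. k * \<eta> \<sigma>)"
    have "conn (Suc m) N N' (\<lambda>\<sigma>. k * \<eta> \<sigma>) (\<lambda>\<sigma>. k * ?\<kappa>P \<sigma>)"
      by (rule conn_lincomb[OF \<eta>(2,2), where k = k and l = 0]) simp_all
    from conn_is_cobd[OF this k] obtain \<alpha> \<beta> where \<alpha>\<beta>: "is_cocycle (Suc m) (top_of_set N) \<alpha>"
      "is_cocycle (Suc m) (top_of_set N') \<beta>"
      "is_rcobd (Suc m) (top_of_set (N \<inter> N')) (\<lambda>\<sigma>. k * ?\<kappa>P \<sigma> - (\<alpha> \<sigma> - \<beta> \<sigma>))"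
      by blast
    obtain a where a: "is_cobd (Suc m) (top_of_set N) (\<lambda>\<sigma>. \<alpha> \<sigma> - a * \<kappa> \<sigma>)"
      using cohomology_generatorD(2)[OF cohomology_sphere_generator[OF N] \<alpha>\<beta>(1)] by blast
    obtain b where b: "is_cobd (Suc m) (top_of_set N') (\<lambda>\<sigma>. \<beta> \<sigma> - b * \<kappa> \<sigma>)"
      using cohomology_generatorD(2)[OF cohomology_sphere_generator[OF N'] \<alpha>\<beta>(2)] by blast
    have "is_cobd (Suc m) (top_of_set (N \<inter> N')) (\<lambda>\<sigma>. (\<alpha> \<sigma> - a * \<kappa> \<sigma>) - (\<beta> \<sigma> - b * \<kappa> \<sigma>))"
      by (rule is_cobd_lincomb[OF is_cobd_mono[OF a] is_cobd_mono[OF b], where k = 1 and l = "-1"]) auto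
    \<comment> \<open>Cocycles from \<open>N\<close> and \<open>N'\<close> contribute the same
      coefficient \<open>a - b\<close> on both components. On \<open>M\<close>, where the first term
      is zero, this forces \<open>a = b\<close>; on \<open>P\<close> then
      \<open>k = 0\<close>.\<close>
    then have *: "is_cobd (Suc m) (top_of_set (N \<inter> N')) (\<lambda>\<sigma>. k * ?\<kappa>P \<sigma> - (a - b) * \<kappa> \<sigma>)"
      by (rule is_cobd_lincomb[OF \<alpha>\<beta>(3)[unfolded is_rcobd_pos[OF zero_less_Suc]], where k = 1 and l = 1])
        (simp add: algebra_simps)
    have "is_cobd (Suc m) (top_of_set M) (\<lambda>\<sigma>. (a - b) * \<kappa> \<sigma>)"
      by (rule is_cobd_lincomb[OF is_cobd_mono[OF * subsets(8)] is_cobd_zero, where k = "-1" and l = 0])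
        (simp add: not_simplex_P)
    then have "a - b = 0" using cohomology_generatorD(3)[OF cohomology_sphere_generator[OF M]] by blast
    have "is_cobd (Suc m) (top_of_set P) (\<lambda>\<sigma>. k * \<kappa> \<sigma>)"
      by (rule is_cobd_cong[OF is_cobd_mono[OF * subsets(7)]]) (simp add: \<open>a - b = 0\<close>)
    then show "k = 0" using cohomology_generatorD(3)[OF cohomology_sphere_generator[OF P]] by blast
  qed
  then show ?thesis using key that by blast
qed

end

text \<open>\<open>R\<close> identifies the cohomology group with the quotient of the group of parameters by \<open>K\<close>.\<close>

definition cohomology_param ::
    "nat \<Rightarrow> 'a topology \<Rightarrow> ('a cochain \<Rightarrow> 'v::ab_group_add \<Rightarrow> bool) \<Rightarrow> 'v set \<Rightarrow> bool"
  where "cohomology_param q X R K \<longleftrightarrow>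
    (\<forall>\<phi>. is_cocycle q X \<phi> \<longrightarrow> (\<exists>a. R \<phi> a)) \<and>
    (\<forall>a. \<exists>\<phi>. is_cocycle q X \<phi> \<and> R \<phi> a) \<and>
    (\<forall>\<phi> \<psi> a b. R \<phi> a \<longrightarrow> R \<psi> b \<longrightarrow> R (\<lambda>\<sigma>. \<phi> \<sigma> - \<psi> \<sigma>) (a - b)) \<and>
    (\<forall>\<phi> a. is_cocycle q X \<phi> \<longrightarrow> R \<phi> a \<longrightarrow> is_cobd q X \<phi> \<longleftrightarrow> a \<in> K)"

text \<open>
  Up to homotopy, two spheres \<open>S^(m+2)\<close> glued along \<open>S^(m+1) \<times> S^1\<close>, which maps to each of them
  with degree \<open>2\<close>.
\<close>

locale double_cover_gluing =
  fixes m :: nat and U V :: "'a::topological_space set" and \<omega> \<kappa> \<beta> \<eta> :: "'a cochain"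
  assumes m: "0 < m" and UV: "open_pair U V"
    and \<omega>: "is_cocycle (Suc (Suc m)) (top_of_set (U \<union> V)) \<omega>"
    and U: "cohomology_sphere (Suc (Suc m)) (top_of_set U) \<omega>"
    and V: "cohomology_sphere (Suc (Suc m)) (top_of_set V) \<omega>"
    and nonempty: "U \<inter> V \<noteq> {}"
    and Int_0: "\<And>\<phi>. is_cocycle 0 (top_of_set (U \<inter> V)) \<phi> \<Longrightarrow> is_rcobd 0 (top_of_set (U \<inter> V)) \<phi>"
    and \<beta>: "cohomology_generator (Suc 0) (top_of_set (U \<inter> V)) \<beta>"
    and \<kappa>: "cohomology_generator (Suc m) (top_of_set (U \<inter> V)) \<kappa>"
    and \<eta>: "cohomology_generator (Suc (Suc m)) (top_of_set (U \<inter> V)) \<eta>"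
    and Int_other: "\<And>r \<phi>. is_cocycle (Suc r) (top_of_set (U \<inter> V)) \<phi> \<Longrightarrow> r \<noteq> 0 \<Longrightarrow> r \<noteq> m \<Longrightarrow> r \<noteq> Suc m \<Longrightarrow>
      is_cobd (Suc r) (top_of_set (U \<inter> V)) \<phi>"
    and \<omega>_\<eta>: "is_cobd (Suc (Suc m)) (top_of_set (U \<inter> V)) (\<lambda>\<sigma>. \<omega> \<sigma> - 2 * \<eta> \<sigma>)"
begin

lemma is_cobd_U: "is_cocycle q (top_of_set (U \<union> V)) \<phi> \<Longrightarrow> q \<noteq> Suc (Suc m) \<Longrightarrow> 0 < q \<Longrightarrow> is_cobd q (top_of_set U) \<phi>"
  and is_cobd_V: "is_cocycle q (top_of_set (U \<union> V)) \<phi> \<Longrightarrow> q \<noteq> Suc (Suc m) \<Longrightarrow> 0 < q \<Longrightarrow> is_cobd q (top_of_set V) \<phi>"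
  using cohomology_sphere_is_cobd[OF U, of q \<phi>] cohomology_sphere_is_cobd[OF V, of q \<phi>]
    is_cocycle_mono[of q "U \<union> V" \<phi>] by simp_all

lemma conn_exists_Un:
  assumes "is_cocycle (Suc q) (top_of_set (U \<union> V)) \<phi>" "q \<noteq> Suc m"
  obtains \<mu> where "is_cocycle q (top_of_set (U \<inter> V)) \<mu>" "conn q U V \<phi> \<mu>"
  using is_cobd_U[OF assms(1)] is_cobd_V[OF assms(1)] assms(2) conn_exists[of q U \<phi> V] by auto

lemma Un_degree_0: "is_cocycle 0 (top_of_set (U \<union> V)) \<phi> \<Longrightarrow> is_rcobd 0 (top_of_set (U \<union> V)) \<phi>"
  using nonempty is_cocycle_mono[of 0 "U \<union> V" \<phi>]
  by (intro is_rcobd_0_Un cohomology_sphereD(2)[OF U] cohomology_sphereD(2)[OF V]) auto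

lemma Un_degree_1:
  assumes \<phi>: "is_cocycle (Suc 0) (top_of_set (U \<union> V)) \<phi>"
  shows "is_cobd (Suc 0) (top_of_set (U \<union> V)) \<phi>"
proof -
  obtain \<mu> where "is_cocycle 0 (top_of_set (U \<inter> V)) \<mu>" "conn 0 U V \<phi> \<mu>"
    using conn_exists_Un[OF \<phi>] by auto
  then show ?thesis using conn_rcobd_imp_is_cobd[OF UV \<phi>] Int_0 by blast
qed

lemma Un_degree_other:
  assumes \<phi>: "is_cocycle (Suc (Suc r)) (top_of_set (U \<union> V)) \<phi>" and r: "r \<noteq> 0" "r \<noteq> m" "r \<noteq> Suc m"
  shows "is_cobd (Suc (Suc r)) (top_of_set (U \<union> V)) \<phi>"
proof -
  obtain \<mu> where "is_cocycle (Suc r) (top_of_set (U \<inter> V)) \<mu>" "conn (Suc r) U V \<phi> \<mu>"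
    using conn_exists_Un[OF \<phi>] r by auto
  then show ?thesis using conn_rcobd_imp_is_cobd[OF UV \<phi>] Int_other r is_cobd_imp_is_rcobd by blast
qed

lemma conn_is_cobd_unique:
  assumes c: "conn q U V \<phi> \<mu>" and \<phi>: "is_cobd (Suc q) (top_of_set (U \<union> V)) \<phi>" and q: "q \<noteq> Suc (Suc m)" "0 < q"
  shows "is_cobd q (top_of_set (U \<inter> V)) \<mu>"
proof -
  obtain a b where ab: "is_cocycle q (top_of_set U) a" "is_cocycle q (top_of_set V) b"
    "is_rcobd q (top_of_set (U \<inter> V)) (\<lambda>\<sigma>. \<mu> \<sigma> - (a \<sigma> - b \<sigma>))"
    using conn_is_cobd[OF c \<phi>] by blast
  have "is_cobd q (top_of_set (U \<inter> V)) a" "is_cobd q (top_of_set (U \<inter> V)) b"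
    using is_cobd_mono[OF cohomology_sphere_is_cobd[OF U ab(1) q]]
      is_cobd_mono[OF cohomology_sphere_is_cobd[OF V ab(2) q]] by auto
  then have "is_cobd q (top_of_set (U \<inter> V)) (\<lambda>\<sigma>. a \<sigma> - b \<sigma>)"
    by (rule is_cobd_lincomb[where k = 1 and l = "-1"]) simp
  from is_cobd_lincomb[OF ab(3)[unfolded is_rcobd_pos[OF q(2)]] this, where k = 1 and l = 1]
  show ?thesis by simp
qed

lemma is_cocycle_cmul: "is_cocycle q X \<phi> \<Longrightarrow> is_cocycle q X (\<lambda>\<sigma>. k * \<phi> \<sigma>)"
  by (rule is_cocycle_lincomb[OF _ is_cocycle_zero, where k = k and l = 0]) auto

text \<open>The common part of two computations: where \<open>U\<close> and \<open>V\<close> carry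
  no classes in degree \<open>Suc q\<close>, a class on the union is determined by its connecting
  class, a multiple \<open>k\<close> of \<gamma>. The computations differ only in the set of
  \<open>k\<close> that give coboundaries.\<close>

lemma cohomology_param_conn:
  assumes \<gamma>: "cohomology_generator q (top_of_set (U \<inter> V)) \<gamma>" and q: "q \<noteq> Suc m"
    and ker: "\<And>\<phi> k. is_cocycle (Suc q) (top_of_set (U \<union> V)) \<phi> \<Longrightarrow> conn q U V \<phi> (\<lambda>\<sigma>. k * \<gamma> \<sigma>) \<Longrightarrow>
      is_cobd (Suc q) (top_of_set (U \<union> V)) \<phi> \<longleftrightarrow> k \<in> K"
  shows "cohomology_param (Suc q) (top_of_set (U \<union> V)) (\<lambda>\<phi> k. conn q U V \<phi> (\<lambda>\<sigma>. k * \<gamma> \<sigma>)) K"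
  unfolding cohomology_param_def
proof (intro conjI allI impI)
  fix \<phi> assume \<phi>: "is_cocycle (Suc q) (top_of_set (U \<union> V)) \<phi>"
  obtain \<mu> where \<mu>: "is_cocycle q (top_of_set (U \<inter> V)) \<mu>" "conn q U V \<phi> \<mu>"
    using conn_exists_Un[OF \<phi> q] by blast
  obtain k where "is_cobd q (top_of_set (U \<inter> V)) (\<lambda>\<sigma>. \<mu> \<sigma> - k * \<gamma> \<sigma>)"
    using cohomology_generatorD(2)[OF \<gamma> \<mu>(1)] by blast
  then have "is_cobd q (top_of_set (U \<inter> V)) (\<lambda>\<sigma>. k * \<gamma> \<sigma> - \<mu> \<sigma>)"
    by (rule is_cobd_lincomb[OF _ is_cobd_zero, where k = "-1" and l = 0]) simp
  then have "conn q U V \<phi> (\<lambda>\<sigma>. k * \<gamma> \<sigma>)"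
    by (rule conn_cong[OF \<mu>(2) refl is_cobd_imp_is_rcobd])
  then show "\<exists>k. conn q U V \<phi> (\<lambda>\<sigma>. k * \<gamma> \<sigma>)" by blast
next
  fix k
  show "\<exists>\<phi>. is_cocycle (Suc q) (top_of_set (U \<union> V)) \<phi> \<and> conn q U V \<phi> (\<lambda>\<sigma>. k * \<gamma> \<sigma>)"
    using cocycle_with_conn_exists[OF UV is_cocycle_cmul[OF cohomology_generatorD(1)[OF \<gamma>]]] by blast
next
  fix \<phi> \<psi> k l assume "conn q U V \<phi> (\<lambda>\<sigma>. k * \<gamma> \<sigma>)" "conn q U V \<psi> (\<lambda>\<sigma>. l * \<gamma> \<sigma>)"
  then show "conn q U V (\<lambda>\<sigma>. \<phi> \<sigma> - \<psi> \<sigma>) (\<lambda>\<sigma>. (k - l) * \<gamma> \<sigma>)"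
    by (rule conn_lincomb[where k = 1 and l = "-1"]) (simp_all add: algebra_simps)
qed (rule ker)

lemma Un_degree_2:
  "cohomology_param (Suc (Suc 0)) (top_of_set (U \<union> V)) (\<lambda>\<phi> k. conn (Suc 0) U V \<phi> (\<lambda>\<sigma>. k * \<beta> \<sigma>)) {0}"
proof (rule cohomology_param_conn[OF \<beta>])
  fix \<phi> k assume \<phi>: "is_cocycle (Suc (Suc 0)) (top_of_set (U \<union> V)) \<phi>"
    and c: "conn (Suc 0) U V \<phi> (\<lambda>\<sigma>. k * \<beta> \<sigma>)"
  have "k = 0" if "is_cobd (Suc (Suc 0)) (top_of_set (U \<union> V)) \<phi>"
    using conn_is_cobd_unique[OF c that] cohomology_generatorD(3)[OF \<beta>] by auto
  moreover have "is_cobd (Suc (Suc 0)) (top_of_set (U \<union> V)) \<phi>" if "k = 0"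
    using conn_rcobd_imp_is_cobd[OF UV \<phi> c] that by simp
  ultimately show "is_cobd (Suc (Suc 0)) (top_of_set (U \<union> V)) \<phi> \<longleftrightarrow> k \<in> {0}" by auto
qed (use m in simp)

text \<open>In the parameter \<open>(s, k)\<close>, \<open>s\<close> is the coefficient of \<omega>
  on \<open>U\<close> and on \<open>V\<close>, and \<open>k\<close> the coefficient of \<kappa> in
  the connecting class of \<open>\<phi> - s * \<omega>\<close>. As \<omega> is a cocycle on the
  whole union, subtracting it splits the extension and both coefficients are additive.\<close>

lemma Un_degree_Suc_Suc_m:
  "cohomology_param (Suc (Suc m)) (top_of_set (U \<union> V))
    (\<lambda>\<phi> a. conn (Suc m) U V (\<lambda>\<sigma>. \<phi> \<sigma> - fst a * \<omega> \<sigma>) (\<lambda>\<sigma>. snd a * \<kappa> \<sigma>)) {0}"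
  unfolding cohomology_param_def
proof (intro conjI allI impI)
  fix \<phi> assume \<phi>: "is_cocycle (Suc (Suc m)) (top_of_set (U \<union> V)) \<phi>"
  obtain s where s: "is_cobd (Suc (Suc m)) (top_of_set U) (\<lambda>\<sigma>. \<phi> \<sigma> - s * \<omega> \<sigma>)"
    using cohomology_generatorD(2)[OF cohomology_sphere_generator[OF U] is_cocycle_mono[OF \<phi>]] by blast
  obtain t where t: "is_cobd (Suc (Suc m)) (top_of_set V) (\<lambda>\<sigma>. \<phi> \<sigma> - t * \<omega> \<sigma>)"
    using cohomology_generatorD(2)[OF cohomology_sphere_generator[OF V] is_cocycle_mono[OF \<phi>]] by blast
  have "is_cobd (Suc (Suc m)) (top_of_set (U \<inter> V)) (\<lambda>\<sigma>. (s - t) * \<omega> \<sigma>)"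
    by (rule is_cobd_lincomb[OF is_cobd_mono[OF s] is_cobd_mono[OF t], where k = "-1" and l = 1])
      (auto simp: algebra_simps)
  \<comment> \<open>On the intersection \<omega> becomes \<open>2 * \<eta>\<close>, which still has
    infinite order, so the coefficients on \<open>U\<close> and on \<open>V\<close> have to be
    equal.\<close>
  then have "is_cobd (Suc (Suc m)) (top_of_set (U \<inter> V)) (\<lambda>\<sigma>. (2 * (s - t)) * \<eta> \<sigma>)"
    by (rule is_cobd_lincomb[OF _ \<omega>_\<eta>, where k = 1 and l = "- (s - t)"]) (simp add: algebra_simps)
  then have "2 * (s - t) = 0" by (rule cohomology_generatorD(3)[OF \<eta>])
  then have "s = t" by simp
  obtain \<mu> where \<mu>: "is_cocycle (Suc m) (top_of_set (U \<inter> V)) \<mu>" "conn (Suc m) U V (\<lambda>\<sigma>. \<phi> \<sigma> - s * \<omega> \<sigma>) \<mu>"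
    using conn_exists[OF s t[folded \<open>s = t\<close>]] by blast
  obtain k where "is_cobd (Suc m) (top_of_set (U \<inter> V)) (\<lambda>\<sigma>. \<mu> \<sigma> - k * \<kappa> \<sigma>)"
    using cohomology_generatorD(2)[OF \<kappa> \<mu>(1)] by blast
  then have "is_cobd (Suc m) (top_of_set (U \<inter> V)) (\<lambda>\<sigma>. k * \<kappa> \<sigma> - \<mu> \<sigma>)"
    by (rule is_cobd_lincomb[OF _ is_cobd_zero, where k = "-1" and l = 0]) simp
  then have "conn (Suc m) U V (\<lambda>\<sigma>. \<phi> \<sigma> - s * \<omega> \<sigma>) (\<lambda>\<sigma>. k * \<kappa> \<sigma>)"
    by (rule conn_cong[OF \<mu>(2) refl is_cobd_imp_is_rcobd])
  then show "\<exists>a. conn (Suc m) U V (\<lambda>\<sigma>. \<phi> \<sigma> - fst a * \<omega> \<sigma>) (\<lambda>\<sigma>. snd a * \<kappa> \<sigma>)"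
    by (intro exI[of _ "(s, k)"]) simp
next
  fix a :: "int \<times> int"
  obtain \<phi> where \<phi>: "is_cocycle (Suc (Suc m)) (top_of_set (U \<union> V)) \<phi>" "conn (Suc m) U V \<phi> (\<lambda>\<sigma>. snd a * \<kappa> \<sigma>)"
    using cocycle_with_conn_exists[OF UV is_cocycle_cmul[OF cohomology_generatorD(1)[OF \<kappa>]]] by blast
  have "is_cocycle (Suc (Suc m)) (top_of_set (U \<union> V)) (\<lambda>\<sigma>. \<phi> \<sigma> + fst a * \<omega> \<sigma>)"
    by (rule is_cocycle_lincomb[OF \<phi>(1) \<omega>, where k = 1 and l = "fst a"]) simp
  then show "\<exists>\<phi>. is_cocycle (Suc (Suc m)) (top_of_set (U \<union> V)) \<phi> \<and>
      conn (Suc m) U V (\<lambda>\<sigma>. \<phi> \<sigma> - fst a * \<omega> \<sigma>) (\<lambda>\<sigma>. snd a * \<kappa> \<sigma>)"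
    using \<phi>(2) by (intro exI[of _ "\<lambda>\<sigma>. \<phi> \<sigma> + fst a * \<omega> \<sigma>"]) simp
next
  fix \<phi> \<psi> and a b :: "int \<times> int"
  assume "conn (Suc m) U V (\<lambda>\<sigma>. \<phi> \<sigma> - fst a * \<omega> \<sigma>) (\<lambda>\<sigma>. snd a * \<kappa> \<sigma>)"
    "conn (Suc m) U V (\<lambda>\<sigma>. \<psi> \<sigma> - fst b * \<omega> \<sigma>) (\<lambda>\<sigma>. snd b * \<kappa> \<sigma>)"
  then show "conn (Suc m) U V (\<lambda>\<sigma>. \<phi> \<sigma> - \<psi> \<sigma> - fst (a - b) * \<omega> \<sigma>) (\<lambda>\<sigma>. snd (a - b) * \<kappa> \<sigma>)"
    by (rule conn_lincomb[where k = 1 and l = "-1"]) (simp_all add: algebra_simps)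
next
  fix \<phi> and a :: "int \<times> int"
  let ?\<theta> = "\<lambda>\<sigma>. \<phi> \<sigma> - fst a * \<omega> \<sigma>"
  assume \<phi>: "is_cocycle (Suc (Suc m)) (top_of_set (U \<union> V)) \<phi>" and c: "conn (Suc m) U V ?\<theta> (\<lambda>\<sigma>. snd a * \<kappa> \<sigma>)"
  have "a = 0" if cob: "is_cobd (Suc (Suc m)) (top_of_set (U \<union> V)) \<phi>"
  proof -
    have "is_cobd (Suc (Suc m)) (top_of_set U) (\<lambda>\<sigma>. fst a * \<omega> \<sigma>)"
      by (rule is_cobd_lincomb[OF is_cobd_mono[OF cob] conn_is_cobd_left[OF c], where k = 1 and l = "-1"]) auto
    then have "fst a = 0" by (rule cohomology_generatorD(3)[OF cohomology_sphere_generator[OF U]])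
    then have "is_cobd (Suc m) (top_of_set (U \<inter> V)) (\<lambda>\<sigma>. snd a * \<kappa> \<sigma>)"
      using conn_is_cobd_unique[OF c] cob by simp
    then have "snd a = 0" by (rule cohomology_generatorD(3)[OF \<kappa>])
    with \<open>fst a = 0\<close> show ?thesis by (simp add: prod_eq_iff)
  qed
  moreover have "is_cobd (Suc (Suc m)) (top_of_set (U \<union> V)) \<phi>" if "a = 0"
    using conn_rcobd_imp_is_cobd[OF UV \<phi>, of "\<lambda>_. 0"] c that by simp
  ultimately show "is_cobd (Suc (Suc m)) (top_of_set (U \<union> V)) \<phi> \<longleftrightarrow> a \<in> {0}" by auto
qed

text \<open>The cokernel of restriction: on the intersection, \<open>a * \<omega>\<close> from
  \<open>U\<close> and \<open>b * \<omega>\<close> from \<open>V\<close> differ by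
  \<open>2 * (a - b) * \<eta>\<close> up to a coboundary, so exactly the even multiples of \<eta>
  are connecting classes of coboundaries.\<close>

lemma Un_degree_Suc_Suc_Suc_m:
  "cohomology_param (Suc (Suc (Suc m))) (top_of_set (U \<union> V))
    (\<lambda>\<phi> k. conn (Suc (Suc m)) U V \<phi> (\<lambda>\<sigma>. k * \<eta> \<sigma>)) {k. even k}"
proof (rule cohomology_param_conn[OF \<eta>])
  fix \<phi> k assume \<phi>: "is_cocycle (Suc (Suc (Suc m))) (top_of_set (U \<union> V)) \<phi>"
    and c: "conn (Suc (Suc m)) U V \<phi> (\<lambda>\<sigma>. k * \<eta> \<sigma>)"
  have "even k" if cob: "is_cobd (Suc (Suc (Suc m))) (top_of_set (U \<union> V)) \<phi>"
  proof -
    obtain \<alpha> \<gamma> where \<alpha>\<gamma>: "is_cocycle (Suc (Suc m)) (top_of_set U) \<alpha>" "is_cocycle (Suc (Suc m)) (top_of_set V) \<gamma>"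
      "is_rcobd (Suc (Suc m)) (top_of_set (U \<inter> V)) (\<lambda>\<sigma>. k * \<eta> \<sigma> - (\<alpha> \<sigma> - \<gamma> \<sigma>))"
      using conn_is_cobd[OF c cob] by blast
    obtain a where a: "is_cobd (Suc (Suc m)) (top_of_set U) (\<lambda>\<sigma>. \<alpha> \<sigma> - a * \<omega> \<sigma>)"
      using cohomology_generatorD(2)[OF cohomology_sphere_generator[OF U] \<alpha>\<gamma>(1)] by blast
    obtain b where b: "is_cobd (Suc (Suc m)) (top_of_set V) (\<lambda>\<sigma>. \<gamma> \<sigma> - b * \<omega> \<sigma>)"
      using cohomology_generatorD(2)[OF cohomology_sphere_generator[OF V] \<alpha>\<gamma>(2)] by blast
    have "is_cobd (Suc (Suc m)) (top_of_set (U \<inter> V)) (\<lambda>\<sigma>. (\<alpha> \<sigma> - a * \<omega> \<sigma>) - (\<gamma> \<sigma> - b * \<omega> \<sigma>))"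
      by (rule is_cobd_lincomb[OF is_cobd_mono[OF a] is_cobd_mono[OF b], where k = 1 and l = "-1"]) auto
    then have "is_cobd (Suc (Suc m)) (top_of_set (U \<inter> V)) (\<lambda>\<sigma>. k * \<eta> \<sigma> - (a - b) * \<omega> \<sigma>)"
      by (rule is_cobd_lincomb[OF \<alpha>\<gamma>(3)[unfolded is_rcobd_pos[OF zero_less_Suc]], where k = 1 and l = 1])
        (simp add: algebra_simps)
    then have "is_cobd (Suc (Suc m)) (top_of_set (U \<inter> V)) (\<lambda>\<sigma>. (k - 2 * (a - b)) * \<eta> \<sigma>)"
      by (rule is_cobd_lincomb[OF _ \<omega>_\<eta>, where k = 1 and l = "a - b"]) (simp add: algebra_simps)
    then have "k - 2 * (a - b) = 0" by (rule cohomology_generatorD(3)[OF \<eta>])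
    then show ?thesis by presburger
  qed
  moreover have "is_cobd (Suc (Suc (Suc m))) (top_of_set (U \<union> V)) \<phi>" if ev: "even k"
  proof -
    obtain l where l: "k = 2 * l" using ev by (rule evenE)
    \<comment> \<open>For \<open>k = 2 * l\<close> the correcting cocycles are
      \<open>l * \<omega>\<close> on \<open>U\<close> and zero on \<open>V\<close>.\<close>
    have "is_cobd (Suc (Suc m)) (top_of_set (U \<inter> V)) (\<lambda>\<sigma>. k * \<eta> \<sigma> - (l * \<omega> \<sigma> - 0))"
      by (rule is_cobd_lincomb[OF \<omega>_\<eta> is_cobd_zero, where k = "- l" and l = 0]) (simp add: l algebra_simps)
    then show ?thesis
      by (intro conn_imp_is_cobd[OF UV \<phi> c is_cocycle_cmul[OF cohomology_sphereD(1)[OF U]] is_cocycle_zero]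
          is_cobd_imp_is_rcobd)
  qed
  ultimately show "is_cobd (Suc (Suc (Suc m))) (top_of_set (U \<union> V)) \<phi> \<longleftrightarrow> k \<in> {k. even k}" by auto
qed simp

end

section \<open>A quaternionic model of the space of commuting pairs\<close>

text \<open>
  Unit quaternions are written with the imaginary part first; two of them commute iff their imaginary
  parts are linearly dependent.
\<close>

definition comm_model :: "(('a::real_inner \<times> real) \<times> ('a \<times> real)) set"
  where "comm_model = {z \<in> sphere 0 1 \<times> sphere 0 1. fst (fst z) = 0 \<or> (\<exists>c. fst (snd z) = c *\<^sub>R fst (fst z))}"

definition modelU :: "real \<Rightarrow> (('a::real_inner \<times> real) \<times> ('a \<times> real)) set"
  where "modelU s = {z \<in> comm_model. fst z \<in> cap s}"

text \<open>The first entry is not central, and the second avoids the central point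
  \<open>(0, - s)\<close>. Up to homotopy these are two arcs of the circle factor, times the sphere
  of axes.\<close>

definition modelN :: "real \<Rightarrow> (('a::real_inner \<times> real) \<times> ('a \<times> real)) set"
  where "modelN s = {z \<in> comm_model. fst (fst z) \<noteq> 0 \<and> snd z \<in> cap s}"

text \<open>For commuting elements the inner product of the imaginary parts vanishes only if one of
  them is central; its sign tells whether the two axes agree or are opposite.\<close>

definition modelP :: "real \<Rightarrow> (('a::real_inner \<times> real) \<times> ('a \<times> real)) set"
  where "modelP s = {z \<in> comm_model. 0 < s * (fst (fst z) \<bullet> fst (snd z))}"

section \<open>The open covers of the model\<close>

lemma comm_model_sgn:
  assumes "g \<noteq> 0" "h \<noteq> 0" "fst g = 0 \<or> (\<exists>c. fst h = c *\<^sub>R fst g)"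
  shows "(sgn g, sgn h) \<in> comm_model"
proof -
  have "fst (sgn h) = (c * norm g / norm h) *\<^sub>R fst (sgn g)" if "fst h = c *\<^sub>R fst g" for c
    using assms(1,2) that by (simp add: sgn_div_norm divide_inverse)
  moreover have "fst (sgn g) = 0" if "fst g = 0" using that by (simp add: sgn_div_norm)
  ultimately have "fst (sgn g) = 0 \<or> (\<exists>c. fst (sgn h) = c *\<^sub>R fst (sgn g))" using assms(3) by blast
  then show ?thesis using assms(1,2) by (simp add: comm_model_def norm_sgn)
qed

lemma modelU_Un: "modelU 1 \<union> modelU (-1) = (comm_model :: (('a::real_inner \<times> real) \<times> ('a \<times> real)) set)"
proof -
  have "fst z \<in> cap 1 \<union> cap (-1)" if "z \<in> comm_model" for z :: "('a \<times> real) \<times> ('a \<times> real)"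
    using that unfolding cap_Un by (auto simp: comm_model_def)
  then show ?thesis by (auto simp: modelU_def)
qed

lemma modelN_Un:
  "modelN 1 \<union> modelN (-1) = {z \<in> comm_model :: (('a::real_inner \<times> real) \<times> ('a \<times> real)) set. fst (fst z) \<noteq> 0}"
proof -
  have "snd z \<in> cap 1 \<union> cap (-1)" if "z \<in> comm_model" for z :: "('a \<times> real) \<times> ('a \<times> real)"
    using that unfolding cap_Un by (auto simp: comm_model_def)
  then show ?thesis by (auto simp: modelN_def)
qed

lemma modelU_Int: "modelU 1 \<inter> modelU (-1) = modelN 1 \<union> modelN (-1)"
  unfolding modelN_Un by (auto simp: modelU_def cap_def comm_model_def)

lemma modelN_Int: "modelN 1 \<inter> modelN (-1) = modelP 1 \<union> modelP (-1)"
proof -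
  have "fst (fst z) \<noteq> 0 \<and> fst (snd z) \<noteq> 0 \<longleftrightarrow> fst (fst z) \<bullet> fst (snd z) \<noteq> 0"
    if "z \<in> comm_model" for z :: "('a \<times> real) \<times> ('a \<times> real)"
    using that by (auto simp: comm_model_def)
  moreover have "z \<in> modelN 1 \<inter> modelN (-1) \<longleftrightarrow> z \<in> comm_model \<and> fst (fst z) \<noteq> 0 \<and> fst (snd z) \<noteq> 0"
    for z :: "('a \<times> real) \<times> ('a \<times> real)"
  proof -
    have "snd z \<in> sphere 0 1" if "z \<in> comm_model" using that by (auto simp: comm_model_def)
    then show ?thesis by (auto simp: modelN_def cap_def)
  qed
  moreover have "z \<in> modelP 1 \<union> modelP (-1) \<longleftrightarrow> z \<in> comm_model \<and> fst (fst z) \<bullet> fst (snd z) \<noteq> 0"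
    for z :: "('a \<times> real) \<times> ('a \<times> real)"
    by (auto simp: modelP_def)
  ultimately show ?thesis by blast
qed

lemma modelP_Int: "modelP 1 \<inter> modelP (-1) = {}"
  by (auto simp: modelP_def)

lemma open_pairI:
  assumes "open S" "open T" "U = (U \<union> V) \<inter> S" "V = (U \<union> V) \<inter> T"
  shows "open_pair U V"
  unfolding open_pair_def openin_open using assms by blast

lemma open_cap_condition: "open {z :: 'a::real_normed_vector \<times> real. fst z \<noteq> 0 \<or> s * snd z > 0}"
  by (intro open_Collect_disj open_Collect_neq open_Collect_less continuous_intros)

lemma open_pair_modelU: "open_pair (modelU 1) (modelU (-1))"
proof -
  let ?S = "\<lambda>s. fst -` {z :: 'a \<times> real. fst z \<noteq> 0 \<or> s * snd z > 0} :: (('a \<times> real) \<times> ('a \<times> real)) set"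
  have o: "open (?S s)" for s by (intro open_vimage_fst open_cap_condition)
  have eq: "modelU s = comm_model \<inter> ?S s" for s
    by (auto simp: modelU_def cap_def comm_model_def)
  show ?thesis by (rule open_pairI[OF o[of 1] o[of "-1"]]) (unfold modelU_Un, rule eq, rule eq)
qed

lemma open_pair_modelN: "open_pair (modelN 1) (modelN (-1))"
proof -
  let ?S = "\<lambda>s. snd -` {z :: 'a \<times> real. fst z \<noteq> 0 \<or> s * snd z > 0} :: (('a \<times> real) \<times> ('a \<times> real)) set"
  have o: "open (?S s)" for s by (intro open_vimage_snd open_cap_condition)
  have eq: "modelN s = {z \<in> comm_model. fst (fst z) \<noteq> 0} \<inter> ?S s" for s
    by (auto simp: modelN_def cap_def comm_model_def)
  show ?thesis by (rule open_pairI[OF o[of 1] o[of "-1"]]) (unfold modelN_Un, rule eq, rule eq)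
qed

lemma open_pair_modelP: "open_pair (modelP 1) (modelP (-1))"
proof -
  let ?S = "\<lambda>s. {z :: ('a \<times> real) \<times> ('a \<times> real). 0 < s * (fst (fst z) \<bullet> fst (snd z))}"
  have o: "open (?S s)" for s by (intro open_Collect_less continuous_intros)
  have eq: "modelP s = comm_model \<inter> ?S s" for s by (auto simp: modelP_def)
  show ?thesis by (rule open_pairI[OF o[of 1] o[of "-1"]]) (unfold eq, blast+)
qed

section \<open>Homotopy types of the members of the covers\<close>

lemma cap_pole: "\<bar>s\<bar> = 1 \<Longrightarrow> (0, s) \<in> cap s"
  by (auto simp: cap_def norm_Pair abs_if split: if_splits)

text \<open>\<open>g\<close> is moved along the normalized segment to the central element
  \<open>(0, s)\<close> while \<open>h\<close> stays fixed. Before normalization the imaginary part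
  of \<open>g\<close> is multiplied by \<open>t\<close>, hence stays collinear with that of
  \<open>h\<close>.\<close>

lemma cohomology_sphere_modelU:
  fixes \<omega> :: "('a::real_inner \<times> real) cochain"
  assumes s: "\<bar>s\<bar> = 1" and \<omega>: "cohomology_sphere n (top_of_set (sphere 0 1)) \<omega>"
  shows "cohomology_sphere n (top_of_set (modelU s)) (\<lambda>\<sigma>. \<omega> (simplex_map n snd \<sigma>))"
proof (rule cohomology_sphere_deformation_retract[OF \<omega>])
  let ?U = "modelU s :: (('a \<times> real) \<times> ('a \<times> real)) set"
  let ?i = "\<lambda>h :: 'a \<times> real. ((0, s) :: 'a \<times> real, h)"
  have i: "?i h \<in> ?U" if "h \<in> sphere 0 1" for h
    using that cap_pole[OF s, where 'a = 'a] s by (auto simp: modelU_def comm_model_def norm_Pair)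
  show "continuous_map (top_of_set ?U) (top_of_set (sphere 0 1)) snd"
    by (auto simp: modelU_def comm_model_def intro!: continuous_intros)
  show "continuous_map (top_of_set (sphere 0 1)) (top_of_set ?U) ?i"
    using i by (auto intro!: continuous_intros)
  show "homotopic_with (\<lambda>_. True) (top_of_set ?U) (top_of_set ?U) (?i \<circ> snd) id"
  proof (rule homotopic_normalized_segment_pair)
    show "?U \<subseteq> sphere 0 1 \<times> sphere 0 1" by (auto simp: modelU_def comm_model_def)
    show "continuous_on ?U (?i \<circ> snd)" unfolding o_def by (intro continuous_intros)
    fix z assume z: "z \<in> ?U"
    then have nz: "snd z \<in> sphere 0 1" "fst z \<in> cap s" by (auto simp: modelU_def comm_model_def)
    show "(?i \<circ> snd) z \<in> ?U" using i[OF nz(1)] by simp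
    fix t :: real assume t: "0 \<le> t" "t \<le> 1"
    let ?g = "(1 - t) *\<^sub>R (0, s) + t *\<^sub>R fst z"
    have w: "(1 - t) *\<^sub>R (?i \<circ> snd) z + t *\<^sub>R z = (?g, snd z)"
      by (cases z) (simp add: algebra_simps)
    have g: "fst ?g \<noteq> 0 \<or> s * snd ?g > 0" by (rule cap_segment[OF s nz(2) t refl])
    then have "?g \<noteq> 0" by (metis fst_zero snd_zero mult_zero_right less_irrefl)
    moreover have "snd z \<noteq> 0" using nz(1) by auto
    moreover have "fst ?g = 0 \<or> (\<exists>c. fst (snd z) = c *\<^sub>R fst ?g)"
    proof (cases "t = 0")
      case False
      \<comment> \<open>The old ratio \<open>c\<close> is divided by \<open>t\<close>; at
        \<open>t = 0\<close> the first entry is central and no ratio is required.\<close>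
      have *: "fst (snd z) = (c / t) *\<^sub>R fst ?g" if "fst (snd z) = c *\<^sub>R fst (fst z)" for c
        using False that by simp
      have "fst (fst z) = 0 \<or> (\<exists>c. fst (snd z) = c *\<^sub>R fst (fst z))"
        using z by (simp add: modelU_def comm_model_def)
      then show ?thesis
      proof
        assume "fst (fst z) = 0"
        then show ?thesis by simp
      qed (use * in blast)
    qed simp
    ultimately have "?g \<noteq> 0 \<and> snd z \<noteq> 0 \<and> (sgn ?g, sgn (snd z)) \<in> ?U"
      using sgn_in_cap[OF g] comm_model_sgn[of ?g "snd z"] by (auto simp: modelU_def)
    then show "\<exists>g h. (1 - t) *\<^sub>R (?i \<circ> snd) z + t *\<^sub>R z = (g, h) \<and> g \<noteq> 0 \<and> h \<noteq> 0 \<and> (sgn g, sgn h) \<in> ?U"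
      unfolding w by blast
  qed
qed simp

abbreviation model_axis :: "('a::real_inner \<times> real) \<times> ('a \<times> real) \<Rightarrow> 'a"
  where "model_axis z \<equiv> sgn (fst (fst z))"

lemma segment_to_equator:
  assumes "fst g \<noteq> 0" "0 \<le> t" "t \<le> (1::real)"
  obtains p where "0 < p" "fst ((1 - t) *\<^sub>R (sgn (fst g), 0::real) + t *\<^sub>R g) = p *\<^sub>R fst g"
    "p = (1 - t) / norm (fst g) + t"
proof
  show "0 < (1 - t) / norm (fst g) + t"
    using assms by (cases "t = 0") (auto intro!: add_nonneg_pos)
  show "fst ((1 - t) *\<^sub>R (sgn (fst g), 0::real) + t *\<^sub>R g) = ((1 - t) / norm (fst g) + t) *\<^sub>R fst g"
    by (simp add: sgn_div_norm algebra_simps divide_inverse)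
qed simp

text \<open>The retraction keeps the axis of \<open>g\<close> and moves \<open>g\<close> to the
  equator of purely imaginary elements and \<open>h\<close> to the pole \<open>(0, s)\<close>. Both
  imaginary parts stay multiples of the one axis, so the pair keeps commuting.\<close>

lemma cohomology_sphere_modelN:
  fixes \<kappa> :: "'a::real_inner cochain"
  assumes s: "\<bar>s\<bar> = 1" and \<kappa>: "cohomology_sphere n (top_of_set (sphere 0 1)) \<kappa>"
  shows "cohomology_sphere n (top_of_set (modelN s)) (\<lambda>\<sigma>. \<kappa> (simplex_map n model_axis \<sigma>))"
proof (rule cohomology_sphere_deformation_retract[OF \<kappa>])
  let ?N = "modelN s :: (('a \<times> real) \<times> ('a \<times> real)) set"
  let ?i = "\<lambda>x :: 'a. ((x, 0 :: real), (0 :: 'a, s))"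
  have i: "?i x \<in> ?N" if "x \<in> sphere 0 1" for x
    using that cap_pole[OF s, where 'a = 'a] s by (auto simp: modelN_def comm_model_def norm_Pair)
  show "continuous_map (top_of_set ?N) (top_of_set (sphere 0 1)) model_axis"
    by (auto simp: modelN_def comm_model_def norm_sgn intro!: continuous_intros)
  show "continuous_map (top_of_set (sphere 0 1)) (top_of_set ?N) ?i"
    using i by (auto intro!: continuous_intros)
  show "homotopic_with (\<lambda>_. True) (top_of_set ?N) (top_of_set ?N) (?i \<circ> model_axis) id"
  proof (rule homotopic_normalized_segment_pair)
    show "?N \<subseteq> sphere 0 1 \<times> sphere 0 1" by (auto simp: modelN_def comm_model_def)
    show "continuous_on ?N (?i \<circ> model_axis)"
      unfolding o_def by (intro continuous_intros) (auto simp: modelN_def)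
    fix z assume z: "z \<in> ?N"
    then have nz: "fst (fst z) \<noteq> 0" "snd z \<in> cap s" by (auto simp: modelN_def)
    obtain c where c: "fst (snd z) = c *\<^sub>R fst (fst z)" using z by (auto simp: modelN_def comm_model_def)
    show "(?i \<circ> model_axis) z \<in> ?N" using i[of "model_axis z"] nz(1) by (simp add: norm_sgn)
    fix t :: real assume t: "0 \<le> t" "t \<le> 1"
    let ?g = "(1 - t) *\<^sub>R (model_axis z, 0) + t *\<^sub>R fst z"
    let ?h = "(1 - t) *\<^sub>R (0, s) + t *\<^sub>R snd z"
    have w: "(1 - t) *\<^sub>R (?i \<circ> model_axis) z + t *\<^sub>R z = (?g, ?h)"
      by (cases z) simp
    have h: "fst ?h \<noteq> 0 \<or> s * snd ?h > 0" by (rule cap_segment[OF s nz(2) t refl])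
    then have h0: "?h \<noteq> 0" by (metis fst_zero snd_zero mult_zero_right less_irrefl)
    obtain p where p: "0 < p" "fst ?g = p *\<^sub>R fst (fst z)" using segment_to_equator[OF nz(1) t] by blast
    then have g: "fst ?g \<noteq> 0" using nz(1) by simp
    then have g0: "?g \<noteq> 0" by (metis fst_zero)
    have "fst ?h = (t * c / p) *\<^sub>R fst ?g" unfolding p(2) using p(1) c by simp
    then have "(sgn ?g, sgn ?h) \<in> comm_model" using comm_model_sgn[OF g0 h0] by blast
    moreover have "fst (sgn ?g) \<noteq> 0" using g g0 by (simp add: sgn_div_norm)
    ultimately have "?g \<noteq> 0 \<and> ?h \<noteq> 0 \<and> (sgn ?g, sgn ?h) \<in> ?N"
      using g0 h0 sgn_in_cap[OF h] by (simp add: modelN_def)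
    then show "\<exists>g h. (1 - t) *\<^sub>R (?i \<circ> model_axis) z + t *\<^sub>R z = (g, h) \<and> g \<noteq> 0 \<and> h \<noteq> 0 \<and> (sgn g, sgn h) \<in> ?N"
      unfolding w by blast
  qed
qed (simp add: sgn_div_norm)

lemma continuous_map_axis_modelP: "continuous_map (top_of_set (modelP s)) (top_of_set (sphere 0 1)) model_axis"
proof -
  have "fst (fst z) \<noteq> 0" if "z \<in> modelP s" for z :: "('a \<times> real) \<times> ('a \<times> real)"
    using that by (auto simp: modelP_def)
  then show ?thesis by (auto simp: norm_sgn intro!: continuous_intros)
qed

lemma inner_fst_sgn_collinear:
  fixes g h :: "'a::real_inner \<times> real"
  assumes "fst g = p *\<^sub>R x" "fst h = r *\<^sub>R x"
  shows "s * (fst (sgn g) \<bullet> fst (sgn h)) = (s * r) * (p * (x \<bullet> x) * (inverse (norm g) * inverse (norm h)))"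
  unfolding sgn_div_norm fst_scaleR assms by simp

text \<open>The retract consists of the pairs \<open>(x, s x)\<close> of imaginary units. Both
  entries move to the equator; the coefficient of the axis in \<open>h\<close> keeps the sign
  \<open>s\<close>, so the homotopy stays on the same component.\<close>

lemma cohomology_sphere_modelP:
  fixes \<kappa> :: "'a::real_inner cochain"
  assumes s: "\<bar>s\<bar> = 1" and \<kappa>: "cohomology_sphere n (top_of_set (sphere 0 1)) \<kappa>"
  shows "cohomology_sphere n (top_of_set (modelP s)) (\<lambda>\<sigma>. \<kappa> (simplex_map n model_axis \<sigma>))"
proof (rule cohomology_sphere_deformation_retract[OF \<kappa>])
  let ?P = "modelP s :: (('a \<times> real) \<times> ('a \<times> real)) set"
  let ?i = "\<lambda>x :: 'a. ((x, 0 :: real), (s *\<^sub>R x, 0 :: real))"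
  have ss: "s * s = 1" using s by (metis abs_mult_self_eq mult_1)
  have i: "?i x \<in> ?P" if "x \<in> sphere 0 1" for x
  proof -
    have "x \<bullet> x = 1" using that by (simp add: dot_square_norm)
    then have "0 < s * (x \<bullet> (s *\<^sub>R x))" using ss by simp
    then show ?thesis using that s by (auto simp: modelP_def comm_model_def norm_Pair)
  qed
  have nz: "fst (fst z) \<noteq> 0" if "z \<in> ?P" for z using that by (auto simp: modelP_def)
  show "continuous_map (top_of_set ?P) (top_of_set (sphere 0 1)) model_axis"
    by (rule continuous_map_axis_modelP)
  show "continuous_map (top_of_set (sphere 0 1)) (top_of_set ?P) ?i"
    using i by (auto intro!: continuous_intros)
  show "homotopic_with (\<lambda>_. True) (top_of_set ?P) (top_of_set ?P) (?i \<circ> model_axis) id"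
  proof (rule homotopic_normalized_segment_pair)
    show "?P \<subseteq> sphere 0 1 \<times> sphere 0 1" by (auto simp: modelP_def comm_model_def)
    show "continuous_on ?P (?i \<circ> model_axis)"
      unfolding o_def by (intro continuous_intros) (use nz in auto)
    fix z assume z: "z \<in> ?P"
    obtain c where c: "fst (snd z) = c *\<^sub>R fst (fst z)" using z nz[OF z] by (auto simp: modelP_def comm_model_def)
    have "0 < (s * c) * (fst (fst z) \<bullet> fst (fst z))" using z c by (simp add: modelP_def)
    then have sc: "0 < s * c" by (rule zero_less_mult_pos2) (use nz[OF z] in simp)
    show "(?i \<circ> model_axis) z \<in> ?P" using i[of "model_axis z"] nz[OF z] by (simp add: norm_sgn)
    fix t :: real assume t: "0 \<le> t" "t \<le> 1"
    let ?x = "fst (fst z)"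
    let ?g = "(1 - t) *\<^sub>R (model_axis z, 0) + t *\<^sub>R fst z"
    let ?h = "(1 - t) *\<^sub>R (s *\<^sub>R model_axis z, 0) + t *\<^sub>R snd z"
    have w: "(1 - t) *\<^sub>R (?i \<circ> model_axis) z + t *\<^sub>R z = (?g, ?h)"
      by (cases z) simp
    obtain p where p: "0 < p" "fst ?g = p *\<^sub>R ?x" using segment_to_equator[OF nz[OF z] t] by blast
    \<comment> \<open>The coefficient of the imaginary part of the moving second entry with respect
      to \<open>?x\<close>, before normalization. Since \<open>s * s = 1\<close>, the product
      \<open>s * r\<close> is a sum of nonnegative terms, one of them positive.\<close>
    define r where "r = s * ((1 - t) / norm ?x) + t * c"
    have r: "fst ?h = r *\<^sub>R ?x"
      by (simp add: r_def c sgn_div_norm algebra_simps divide_inverse)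
    have "s * r = (s * s) * ((1 - t) / norm ?x) + t * (s * c)" by (simp add: r_def algebra_simps)
    then have "s * r = (1 - t) / norm ?x + t * (s * c)" by (simp add: ss)
    moreover have "0 < (1 - t) / norm ?x + t * (s * c)"
      using t sc nz[OF z] by (cases "t = 0") (auto intro!: add_nonneg_pos)
    ultimately have sr: "0 < s * r" by simp
    then have "r \<noteq> 0" by auto
    then have g0: "?g \<noteq> 0" and h0: "?h \<noteq> 0"
      using p r nz[OF z] by (metis fst_zero scaleR_eq_0_iff less_irrefl)+
    have "fst ?h = (r / p) *\<^sub>R fst ?g" unfolding p(2) r using p(1) by simp
    then have mem: "(sgn ?g, sgn ?h) \<in> comm_model" using comm_model_sgn[OF g0 h0] by blast
    have eq: "s * (fst (sgn ?g) \<bullet> fst (sgn ?h)) = (s * r) * (p * (?x \<bullet> ?x) * (inverse (norm ?g) * inverse (norm ?h)))"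
      by (rule inner_fst_sgn_collinear[OF p(2) r])
    have pos: "0 < p * (?x \<bullet> ?x) * (inverse (norm ?g) * inverse (norm ?h))"
      using p(1) nz[OF z] g0 h0 by (intro mult_pos_pos) (auto simp: zero_less_norm_iff)
    have "0 < s * (fst (sgn ?g) \<bullet> fst (sgn ?h))"
      unfolding eq by (rule mult_pos_pos[OF sr pos])
    then have "?g \<noteq> 0 \<and> ?h \<noteq> 0 \<and> (sgn ?g, sgn ?h) \<in> ?P"
      unfolding modelP_def using g0 h0 mem by simp
    then show "\<exists>g h. (1 - t) *\<^sub>R (?i \<circ> model_axis) z + t *\<^sub>R z = (g, h) \<and> g \<noteq> 0 \<and> h \<noteq> 0 \<and> (sgn g, sgn h) \<in> ?P"
      unfolding w by blast
  qed
qed (simp add: sgn_div_norm)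

text \<open>If the imaginary part of \<open>h\<close> is \<open>c\<close> times that of
  \<open>g\<close>, membership in \<open>modelP s\<close> says that \<open>c\<close> has the sign of
  \<open>s\<close>. Thus the two axes are equal on one component and antipodal on the other.\<close>

lemma modelP_axis:
  assumes "\<bar>s\<bar> = 1" "z \<in> modelP s"
  shows "sgn (fst (snd z)) = s *\<^sub>R model_axis z"
proof -
  have nz: "fst (fst z) \<noteq> 0" using assms(2) by (auto simp: modelP_def)
  then obtain c where c: "fst (snd z) = c *\<^sub>R fst (fst z)" using assms(2) by (auto simp: modelP_def comm_model_def)
  have "0 < (s * c) * (fst (fst z) \<bullet> fst (fst z))" using assms(2) c by (simp add: modelP_def)
  then have "0 < s * c" by (rule zero_less_mult_pos2) (use nz in simp)
  then have "sgn c = s" using assms(1) by (auto simp: zero_less_mult_iff abs_if split: if_splits)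
  then show ?thesis by (simp add: c sgn_scaleR)
qed

type_synonym quat = "((real \<times> real) \<times> real) \<times> real"

text \<open>\<open>snd\<close> carries the cover by \<open>modelN\<close> to the cover of
  \<open>S^3\<close> by caps, so the connecting class of \<open>\<omega>'\<close> is \<kappa> pulled
  back along the axis of \<open>h\<close>. It has coefficient \<open>1\<close> on
  \<open>modelP 1\<close> and the antipodal sign \<open>-1\<close> on \<open>modelP (-1)\<close>; up
  to a coboundary \<open>\<omega>'\<close> is therefore \<open>1 - (-1)\<close> times \<eta> on the
  intersection.\<close>

lemma double_cover_gluing_model:
  obtains \<omega> \<kappa> \<beta> \<eta> where
    "double_cover_gluing (Suc 0) (modelU 1) (modelU (-1) :: (quat \<times> quat) set) \<omega> \<kappa> \<beta> \<eta>"
proof -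
  let ?U = "modelU :: real \<Rightarrow> (quat \<times> quat) set"
  let ?N = "modelN :: real \<Rightarrow> (quat \<times> quat) set"
  let ?P = "modelP :: real \<Rightarrow> (quat \<times> quat) set"
  let ?v = "\<lambda>z :: quat. sgn (fst z)"
  obtain \<kappa> :: "((real \<times> real) \<times> real) cochain" and \<omega> :: "quat cochain" where
    \<kappa>: "cohomology_sphere (Suc (Suc 0)) (top_of_set (sphere 0 1)) \<kappa>" "antipodal_sign (Suc (Suc 0)) \<kappa> (-1)"
    and \<omega>: "cohomology_sphere (Suc (Suc (Suc 0))) (top_of_set (sphere 0 1)) \<omega>"
    "conn (Suc (Suc 0)) (cap 1) (cap (-1)) \<omega> (\<lambda>\<sigma>. \<kappa> (simplex_map (Suc (Suc 0)) ?v \<sigma>))"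
    by (rule cohomology_sphere_2_and_3)
  define \<kappa>' where "\<kappa>' \<sigma> = \<kappa> (simplex_map (Suc (Suc 0)) model_axis \<sigma>)"
    for \<sigma> :: "_ \<Rightarrow> quat \<times> quat"
  define \<omega>' where "\<omega>' \<sigma> = \<omega> (simplex_map (Suc (Suc (Suc 0))) snd \<sigma>)"
    for \<sigma> :: "_ \<Rightarrow> quat \<times> quat"
  have axis: "continuous_map (top_of_set {z \<in> comm_model. fst (fst z) \<noteq> 0}) (top_of_set (sphere 0 1))
      (model_axis :: _ \<Rightarrow> (real \<times> real) \<times> real)"
    by (auto simp: norm_sgn intro!: continuous_intros)
  interpret W: sphere_circle_cover "Suc 0" "?N 1" "?N (-1)" "?P 1" "?P (-1)" \<kappa>'
  proof
    show "is_cocycle (Suc (Suc 0)) (top_of_set (?N 1 \<union> ?N (-1))) \<kappa>'"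
      unfolding modelN_Un \<kappa>'_def
      by (rule is_cocycle_pullback[OF cohomology_sphereD(1)[OF \<kappa>(1)] axis])
  qed (auto simp only: \<kappa>'_def[abs_def] modelN_Int modelP_Int open_pair_modelN open_pair_modelP abs_1 abs_minus
      intro!: cohomology_sphere_modelN[OF _ \<kappa>(1)] cohomology_sphere_modelP[OF _ \<kappa>(1)])
  obtain \<eta> where \<eta>: "cohomology_generator (Suc (Suc (Suc 0))) (top_of_set (?N 1 \<union> ?N (-1))) \<eta>"
    and \<eta>_conn: "\<And>\<zeta> \<mu> i j. is_cocycle (Suc (Suc (Suc 0))) (top_of_set (?N 1 \<union> ?N (-1))) \<zeta> \<Longrightarrow>
      conn (Suc (Suc 0)) (?N 1) (?N (-1)) \<zeta> \<mu> \<Longrightarrow>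
      is_cobd (Suc (Suc 0)) (top_of_set (?P 1)) (\<lambda>\<sigma>. \<mu> \<sigma> - i * \<kappa>' \<sigma>) \<Longrightarrow>
      is_cobd (Suc (Suc 0)) (top_of_set (?P (-1))) (\<lambda>\<sigma>. \<mu> \<sigma> - j * \<kappa>' \<sigma>) \<Longrightarrow>
      is_cobd (Suc (Suc (Suc 0))) (top_of_set (?N 1 \<union> ?N (-1))) (\<lambda>\<sigma>. \<zeta> \<sigma> - (i - j) * \<eta> \<sigma>)"
    by (rule W.degree_Suc_Suc_m) blast
  obtain \<beta> where \<beta>: "cohomology_generator (Suc 0) (top_of_set (?N 1 \<union> ?N (-1))) \<beta>"
    using W.degree_1 by blast
  have sndU: "continuous_map (top_of_set (?U 1 \<union> ?U (-1))) (top_of_set (sphere 0 1)) snd"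
    unfolding modelU_Un by (auto simp: comm_model_def intro!: continuous_intros)
  have \<omega>'_cocycle: "is_cocycle (Suc (Suc (Suc 0))) (top_of_set (?U 1 \<union> ?U (-1))) \<omega>'"
    unfolding \<omega>'_def by (rule is_cocycle_pullback[OF cohomology_sphereD(1)[OF \<omega>(1)] sndU])
  have sndN: "continuous_map (top_of_set (?N s)) (top_of_set (cap s)) snd" for s
    by (auto simp: modelN_def intro!: continuous_intros)
  have "is_cobd (Suc (Suc (Suc 0))) (top_of_set (?N 1 \<union> ?N (-1))) (\<lambda>\<sigma>. \<omega>' \<sigma> - (1 - (-1)) * \<eta> \<sigma>)"
  proof (rule \<eta>_conn)
    show "is_cocycle (Suc (Suc (Suc 0))) (top_of_set (?N 1 \<union> ?N (-1))) \<omega>'"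
      using \<omega>'_cocycle by (rule is_cocycle_mono) (auto simp flip: modelU_Int)
    let ?\<mu> = "\<lambda>\<sigma>. \<kappa> (simplex_map (Suc (Suc 0)) ?v (simplex_map (Suc (Suc 0)) snd \<sigma>))"
    show "conn (Suc (Suc 0)) (?N 1) (?N (-1)) \<omega>' ?\<mu>"
      unfolding \<omega>'_def by (rule conn_pullback[OF \<omega>(2) sndN sndN])
    have eq: "simplex_map (Suc (Suc 0)) ?v (simplex_map (Suc (Suc 0)) snd \<sigma>) =
        simplex_map (Suc (Suc 0)) (\<lambda>z. s *\<^sub>R model_axis z) \<sigma>"
      if "\<bar>s\<bar> = 1" "singular_simplex (Suc (Suc 0)) (top_of_set (?P s)) \<sigma>" for s \<sigma>
      unfolding simplex_map_simplex_map
      by (rule simplex_map_eq[OF that(2)]) (simp add: modelP_axis[OF that(1)])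
    show "is_cobd (Suc (Suc 0)) (top_of_set (?P 1)) (\<lambda>\<sigma>. ?\<mu> \<sigma> - 1 * \<kappa>' \<sigma>)"
      by (rule is_cobd_cong[OF is_cobd_zero]) (simp add: eq[of 1] \<kappa>'_def)
    have "is_rcobd (Suc (Suc 0)) (top_of_set (?P (-1)))
        (\<lambda>\<sigma>. \<kappa> (simplex_map (Suc (Suc 0)) uminus (simplex_map (Suc (Suc 0)) model_axis \<sigma>)) - (-1) * \<kappa>' \<sigma>)"
      unfolding \<kappa>'_def by (rule is_rcobd_pullback[OF \<kappa>(2)[unfolded antipodal_sign_def] continuous_map_axis_modelP])
    then have "is_cobd (Suc (Suc 0)) (top_of_set (?P (-1)))
        (\<lambda>\<sigma>. \<kappa> (simplex_map (Suc (Suc 0)) uminus (simplex_map (Suc (Suc 0)) model_axis \<sigma>)) - (-1) * \<kappa>' \<sigma>)"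
      by (simp add: is_rcobd_pos)
    then show "is_cobd (Suc (Suc 0)) (top_of_set (?P (-1))) (\<lambda>\<sigma>. ?\<mu> \<sigma> - (-1) * \<kappa>' \<sigma>)"
      by (rule is_cobd_cong) (use eq[of "-1"] in \<open>simp add: simplex_map_simplex_map o_def\<close>)
  qed
  then have \<omega>_\<eta>: "is_cobd (Suc (Suc (Suc 0))) (top_of_set (?N 1 \<union> ?N (-1))) (\<lambda>\<sigma>. \<omega>' \<sigma> - 2 * \<eta> \<sigma>)" by simp
  have "double_cover_gluing (Suc 0) (?U 1) (?U (-1)) \<omega>' \<kappa>' \<beta> \<eta>"
  proof
    show "?U 1 \<inter> ?U (-1) \<noteq> {}"
      unfolding modelU_Int using cohomology_sphere_nonempty[OF W.N] by blast
    show "is_rcobd 0 (top_of_set (?U 1 \<inter> ?U (-1))) \<phi>" if "is_cocycle 0 (top_of_set (?U 1 \<inter> ?U (-1))) \<phi>" for \<phi>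
      using W.degree_0 that unfolding modelU_Int by blast
    show "is_cobd (Suc r) (top_of_set (?U 1 \<inter> ?U (-1))) \<phi>"
      if "is_cocycle (Suc r) (top_of_set (?U 1 \<inter> ?U (-1))) \<phi>" "r \<noteq> 0" "r \<noteq> Suc 0" "r \<noteq> Suc (Suc 0)" for r \<phi>
      using W.degree_other that unfolding modelU_Int by blast
    show "cohomology_sphere (Suc (Suc (Suc 0))) (top_of_set (?U 1)) \<omega>'"
      "cohomology_sphere (Suc (Suc (Suc 0))) (top_of_set (?U (-1))) \<omega>'"
      unfolding \<omega>'_def by (rule cohomology_sphere_modelU[OF _ \<omega>(1)], simp)+
    show "cohomology_generator (Suc (Suc 0)) (top_of_set (?U 1 \<inter> ?U (-1))) \<kappa>'"
      unfolding modelU_Int by (rule W.degree_Suc_m)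
  qed (use \<omega>'_cocycle \<beta> \<eta> \<omega>_\<eta> open_pair_modelU in \<open>auto simp: modelU_Int\<close>)
  then show ?thesis by (rule that)
qed

section \<open>Cup products\<close>

abbreviation vertex_shift :: "nat \<Rightarrow> (nat \<Rightarrow> real) \<Rightarrow> nat \<Rightarrow> real"
  where "vertex_shift p x \<equiv> (\<lambda>i. if i < p then 0 else x (i - p))"

lemma vertex_shift_in_standard_simplex:
  assumes "x \<in> standard_simplex q"
  shows "vertex_shift p x \<in> standard_simplex (p + q)"
proof -
  have "(\<Sum>i\<le>p + q. vertex_shift p x i) = (\<Sum>i\<in>{p..p + q}. x (i - p))"
    by (rule sum.mono_neutral_cong_right) auto
  also have "\<dots> = (\<Sum>i\<le>q. x i)"
    using sum.shift_bounds_cl_nat_ivl[of "\<lambda>i. x (i - p)" 0 p q] by (simp add: add.commute atMost_atLeast0)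
  finally have "(\<Sum>i\<le>p + q. vertex_shift p x i) = (\<Sum>i\<le>q. x i)" .
  then show ?thesis using assms by (auto simp: standard_simplex_def)
qed

lemma singular_simplex_front_face:
  assumes "singular_simplex (p + q) X \<sigma>"
  shows "singular_simplex p X (front_face p \<sigma>)"
proof -
  have "continuous_map (subtopology (powertop_real UNIV) (standard_simplex p)) X \<sigma>"
    by (rule continuous_map_from_subtopology_mono[of _ "standard_simplex (p + q)"])
      (use assms standard_simplex_mono[of p "p + q"] in \<open>auto simp: singular_simplex_def\<close>)
  then have "continuous_map (subtopology (powertop_real UNIV) (standard_simplex p)) X (front_face p \<sigma>)"
    by (rule continuous_map_eq) (simp add: front_face_def)
  then show ?thesis by (simp add: singular_simplex_def front_face_def)
qed

lemma singular_simplex_back_face: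
  assumes "singular_simplex (p + q) X \<sigma>"
  shows "singular_simplex q X (back_face p q \<sigma>)"
proof -
  have "continuous_map (subtopology (powertop_real UNIV) (standard_simplex q))
      (subtopology (powertop_real UNIV) (standard_simplex (p + q))) (vertex_shift p)"
    unfolding continuous_map_in_subtopology
  proof
    have "continuous_map (subtopology (powertop_real UNIV) (standard_simplex q)) euclideanreal
        (\<lambda>x. vertex_shift p x i)" for i
      by (cases "i < p") (auto intro!: continuous_map_from_subtopology continuous_map_product_projection)
    then show "continuous_map (subtopology (powertop_real UNIV) (standard_simplex q)) (powertop_real UNIV) (vertex_shift p)"
      by (simp only: continuous_map_componentwise_UNIV) simp
    show "vertex_shift p \<in> topspace (subtopology (powertop_real UNIV) (standard_simplex q)) \<rightarrow> standard_simplex (p + q)"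
      using vertex_shift_in_standard_simplex by auto
  qed
  from continuous_map_compose[OF this, of X \<sigma>] assms
  have "continuous_map (subtopology (powertop_real UNIV) (standard_simplex q)) X (\<sigma> \<circ> vertex_shift p)"
    by (simp add: singular_simplex_def)
  then have "continuous_map (subtopology (powertop_real UNIV) (standard_simplex q)) X (back_face p q \<sigma>)"
    by (rule continuous_map_eq) (simp add: back_face_def)
  then show ?thesis by (simp add: singular_simplex_def back_face_def)
qed

section \<open>Faces of front and back faces\<close>

lemma simplical_face_above: "x \<in> standard_simplex p \<Longrightarrow> p < k \<Longrightarrow> simplical_face k x = x"
  by (rule ext) (auto simp: simplical_face_def standard_simplex_def)

lemma front_face_singular_face:
  assumes "k \<le> p"
  shows "front_face p (singular_face (Suc (p + q)) k \<sigma>) = singular_face (Suc p) k (front_face (Suc p) \<sigma>)"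
proof
  fix x
  show "front_face p (singular_face (Suc (p + q)) k \<sigma>) x = singular_face (Suc p) k (front_face (Suc p) \<sigma>) x"
  proof (cases "x \<in> standard_simplex p")
    case True
    then have "x \<in> standard_simplex (p + q)" using standard_simplex_mono[of p "p + q"] by auto
    moreover have "simplical_face k x \<in> standard_simplex (Suc p)"
      using True assms simplical_face_in_standard_simplex[of "Suc p" k x] by simp
    ultimately show ?thesis using True by (simp add: front_face_def singular_face_def)
  qed (simp add: front_face_def singular_face_def)
qed

lemma front_face_singular_face_above:
  assumes "p < k"
  shows "front_face p (singular_face (Suc (p + q)) k \<sigma>) = front_face p \<sigma>"
proof
  fix x
  show "front_face p (singular_face (Suc (p + q)) k \<sigma>) x = front_face p \<sigma> x"
  proof (cases "x \<in> standard_simplex p")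
    case True
    then have "x \<in> standard_simplex (p + q)" using standard_simplex_mono[of p "p + q"] by auto
    then show ?thesis using True assms by (simp add: front_face_def singular_face_def simplical_face_above)
  qed (simp add: front_face_def)
qed

lemma back_face_singular_face:
  assumes "k \<le> p"
  shows "back_face p q (singular_face (Suc (p + q)) k \<sigma>) = back_face (Suc p) q \<sigma>"
proof
  fix x
  have "simplical_face k (vertex_shift p x) = vertex_shift (Suc p) x"
    using assms by (auto simp: simplical_face_def fun_eq_iff)
  then show "back_face p q (singular_face (Suc (p + q)) k \<sigma>) x = back_face (Suc p) q \<sigma> x"
    using vertex_shift_in_standard_simplex[of x q p] by (simp add: back_face_def singular_face_def)
qed

lemma back_face_singular_face_above:
  assumes "j \<le> q"
  shows "back_face p q (singular_face (Suc (p + q)) (Suc (p + j)) \<sigma>) = singular_face (Suc q) (Suc j) (back_face p (Suc q) \<sigma>)"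
proof
  fix x
  have "simplical_face (Suc (p + j)) (vertex_shift p x) = vertex_shift p (simplical_face (Suc j) x)"
    by (auto simp: simplical_face_def fun_eq_iff)
  moreover have "simplical_face (Suc j) x \<in> standard_simplex (Suc q)" if "x \<in> standard_simplex q"
    using that assms simplical_face_in_standard_simplex[of "Suc q" "Suc j" x] by simp
  ultimately show "back_face p q (singular_face (Suc (p + q)) (Suc (p + j)) \<sigma>) x =
      singular_face (Suc q) (Suc j) (back_face p (Suc q) \<sigma>) x"
    using vertex_shift_in_standard_simplex[of x q p] by (simp add: back_face_def singular_face_def)
qed

lemma singular_face_front_face: "singular_face (Suc p) (Suc p) (front_face (Suc p) \<sigma>) = front_face p \<sigma>"
proof
  fix x
  show "singular_face (Suc p) (Suc p) (front_face (Suc p) \<sigma>) x = front_face p \<sigma> x"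
    using standard_simplex_mono[of p "Suc p"]
    by (auto simp: front_face_def singular_face_def simplical_face_above)
qed

lemma singular_face_back_face: "singular_face (Suc q) 0 (back_face p (Suc q) \<sigma>) = back_face (Suc p) q \<sigma>"
proof
  fix x
  have "vertex_shift p (simplical_face 0 x) = vertex_shift (Suc p) x"
    by (auto simp: simplical_face_def fun_eq_iff)
  moreover have "simplical_face 0 x \<in> standard_simplex (Suc q)" if "x \<in> standard_simplex q"
    using that simplical_face_in_standard_simplex[of "Suc q" 0 x] by simp
  ultimately show "singular_face (Suc q) 0 (back_face p (Suc q) \<sigma>) x = back_face (Suc p) q \<sigma> x"
    by (simp add: back_face_def singular_face_def)
qed

section \<open>The Leibniz rule and products of coboundaries\<close>

definition cup :: "nat \<Rightarrow> nat \<Rightarrow> 'a cochain \<Rightarrow> 'a cochain \<Rightarrow> 'a cochain"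
  where "cup p q \<phi> \<psi> \<sigma> = \<phi> (front_face p \<sigma>) * \<psi> (back_face p q \<sigma>)"

lemma sum_atMost_split: "(\<Sum>k\<le>Suc (p + q). f k) = (\<Sum>k\<le>p. f k) + (\<Sum>j\<le>q. f (Suc (p + j)))"
  for f :: "nat \<Rightarrow> int"
  by (induction q) simp_all

text \<open>Faces of index at most \<open>p\<close> run through the front part while the back factor
  stays fixed, and conversely for the later ones. Each partial sum lacks one face of a full
  coboundary, the last of the front part and the first of the back part; the two completing terms
  are the same product with opposite signs.\<close>

lemma cobd_cup:
  "cobd (Suc (p + q)) (cup p q \<phi> \<psi>) \<sigma> =
    cobd (Suc p) \<phi> (front_face (Suc p) \<sigma>) * \<psi> (back_face (Suc p) q \<sigma>) +
    (-1) ^ p * \<phi> (front_face p \<sigma>) * cobd (Suc q) \<psi> (back_face p (Suc q) \<sigma>)"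
proof -
  let ?F = "\<lambda>k. \<phi> (singular_face (Suc p) k (front_face (Suc p) \<sigma>))"
  let ?B = "\<lambda>j. \<psi> (singular_face (Suc q) j (back_face p (Suc q) \<sigma>))"
  have "cobd (Suc (p + q)) (cup p q \<phi> \<psi>) \<sigma> =
      (\<Sum>k\<le>p. (-1) ^ k * (?F k * \<psi> (back_face (Suc p) q \<sigma>))) +
      (\<Sum>j\<le>q. (-1) ^ Suc (p + j) * (\<phi> (front_face p \<sigma>) * ?B (Suc j)))"
    unfolding cobd_Suc sum_atMost_split cup_def
    by (intro arg_cong2[where f = "(+)"] sum.cong refl)
      (simp_all add: front_face_singular_face back_face_singular_face front_face_singular_face_above
        back_face_singular_face_above)
  also have "\<dots> = (\<Sum>k\<le>p. (-1) ^ k * ?F k) * \<psi> (back_face (Suc p) q \<sigma>) -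
      (-1) ^ p * \<phi> (front_face p \<sigma>) * (\<Sum>j\<le>q. (-1) ^ j * ?B (Suc j))"
    by (simp add: sum_distrib_left sum_distrib_right power_add sum_negf algebra_simps)
  also have "(\<Sum>k\<le>p. (-1) ^ k * ?F k) = cobd (Suc p) \<phi> (front_face (Suc p) \<sigma>) + (-1) ^ p * \<phi> (front_face p \<sigma>)"
    by (simp add: cobd_Suc singular_face_front_face)
  also have "(\<Sum>j\<le>q. (-1) ^ j * ?B (Suc j)) = \<psi> (back_face (Suc p) q \<sigma>) - cobd (Suc q) \<psi> (back_face p (Suc q) \<sigma>)"
    unfolding cobd_Suc sum.atMost_Suc_shift by (simp add: singular_face_back_face sum_negf)
  finally show ?thesis by (simp add: algebra_simps)
qed

lemma is_cocycle_cup: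
  assumes "is_cocycle p X \<phi>" "is_cocycle q X \<psi>"
  shows "is_cocycle (p + q) X (cup p q \<phi> \<psi>)"
  unfolding is_cocycle_def
proof (intro allI impI)
  fix \<sigma> assume "singular_simplex (Suc (p + q)) X \<sigma>"
  then have "singular_simplex (Suc p) X (front_face (Suc p) \<sigma>)" "singular_simplex (Suc q) X (back_face p (Suc q) \<sigma>)"
    using singular_simplex_front_face[of "Suc p" q X \<sigma>] singular_simplex_back_face[of p "Suc q" X \<sigma>] by simp_all
  then show "cobd (Suc (p + q)) (cup p q \<phi> \<psi>) \<sigma> = 0"
    using assms unfolding is_cocycle_def by (simp add: cobd_cup)
qed

lemma is_cobd_cup_left:
  assumes "is_cobd (Suc p) X \<phi>" "is_cocycle q X \<psi>"
  shows "is_cobd (Suc p + q) X (cup (Suc p) q \<phi> \<psi>)"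
proof -
  obtain a where a: "\<And>\<sigma>. singular_simplex (Suc p) X \<sigma> \<Longrightarrow> \<phi> \<sigma> = cobd (Suc p) a \<sigma>"
    using assms(1) by (auto simp: is_cobd_def)
  show ?thesis
  proof (rule is_cobdI)
    fix \<sigma> assume "singular_simplex (Suc p + q) X \<sigma>"
    then have "singular_simplex (Suc p) X (front_face (Suc p) \<sigma>)" "singular_simplex (Suc q) X (back_face p (Suc q) \<sigma>)"
      using singular_simplex_front_face[of "Suc p" q X \<sigma>] singular_simplex_back_face[of p "Suc q" X \<sigma>] by simp_all
    then show "cup (Suc p) q \<phi> \<psi> \<sigma> = cobd (Suc p + q) (cup p q a \<psi>) \<sigma>"
      using assms(2) a unfolding is_cocycle_def by (simp add: cobd_cup) (simp add: cup_def)
  qed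
qed

lemma is_cobd_cup_right:
  assumes "is_cocycle p X \<phi>" "is_cobd (Suc q) X \<psi>"
  shows "is_cobd (p + Suc q) X (cup p (Suc q) \<phi> \<psi>)"
proof -
  obtain b where b: "\<And>\<sigma>. singular_simplex (Suc q) X \<sigma> \<Longrightarrow> \<psi> \<sigma> = cobd (Suc q) b \<sigma>"
    using assms(2) by (auto simp: is_cobd_def)
  show ?thesis
  proof (rule is_cobdI)
    fix \<sigma> assume "singular_simplex (p + Suc q) X \<sigma>"
    then have "singular_simplex (Suc p) X (front_face (Suc p) \<sigma>)" "singular_simplex (Suc q) X (back_face p (Suc q) \<sigma>)"
      using singular_simplex_front_face[of "Suc p" q X \<sigma>] singular_simplex_back_face[of p "Suc q" X \<sigma>] by simp_all
    \<comment> \<open>The Leibniz rule puts the sign \<open>(-1) ^ p\<close> in front of the second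
      term; the same sign in the primitive removes it.\<close>
    then show "cup p (Suc q) \<phi> \<psi> \<sigma> = cobd (p + Suc q) (\<lambda>\<tau>. (-1) ^ p * cup p q \<phi> b \<tau>) \<sigma>"
      using assms(1) b unfolding is_cocycle_def by (simp add: cobd_cmul cobd_cup) (simp add: cup_def)
  qed
qed

text \<open>
  After subtracting coboundaries the two factors vanish on \<open>U\<close> and on \<open>V\<close>, respectively, so their
  product vanishes on all simplices that lie in \<open>U\<close> or in \<open>V\<close>.
\<close>

lemma is_cobd_cup_open_pair:
  assumes UV: "open_pair U V"
    and \<phi>: "is_cocycle (Suc p) (top_of_set (U \<union> V)) \<phi>" "is_cobd (Suc p) (top_of_set U) \<phi>"
    and \<psi>: "is_cocycle (Suc q) (top_of_set (U \<union> V)) \<psi>" "is_cobd (Suc q) (top_of_set V) \<psi>"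
  shows "is_cobd (Suc p + Suc q) (top_of_set (U \<union> V)) (cup (Suc p) (Suc q) \<phi> \<psi>)"
proof -
  let ?X = "top_of_set (U \<union> V)"
  obtain a where a: "\<And>\<sigma>. singular_simplex (Suc p) (top_of_set U) \<sigma> \<Longrightarrow> \<phi> \<sigma> = cobd (Suc p) a \<sigma>"
    using \<phi>(2) by (auto simp: is_cobd_def)
  obtain b where b: "\<And>\<sigma>. singular_simplex (Suc q) (top_of_set V) \<sigma> \<Longrightarrow> \<psi> \<sigma> = cobd (Suc q) b \<sigma>"
    using \<psi>(2) by (auto simp: is_cobd_def)
  define \<phi>' where "\<phi>' \<sigma> = \<phi> \<sigma> - cobd (Suc p) a \<sigma>" for \<sigma>
  define \<psi>' where "\<psi>' \<sigma> = \<psi> \<sigma> - cobd (Suc q) b \<sigma>" for \<sigma>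
  have c: "is_cocycle (Suc p) ?X \<phi>'" "is_cocycle (Suc q) ?X \<psi>'"
    unfolding \<phi>'_def \<psi>'_def
    by (rule is_cocycle_lincomb[OF \<phi>(1) is_cocycle_cobd[of "Suc p" _ a], where k = 1 and l = "-1"], simp)
      (rule is_cocycle_lincomb[OF \<psi>(1) is_cocycle_cobd[of "Suc q" _ b], where k = 1 and l = "-1"], simp)
  \<comment> \<open>The front face of a simplex in \<open>U\<close> lies in \<open>U\<close>, where
    the first factor is zero; for \<open>V\<close> the back face and the second factor take this
    role.\<close>
  have U: "cup (Suc p) (Suc q) \<phi>' \<psi>' \<sigma> = 0" if "singular_simplex (Suc p + Suc q) (top_of_set U) \<sigma>" for \<sigma>
    using a[OF singular_simplex_front_face[OF that]] by (simp add: cup_def \<phi>'_def)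
  have V: "cup (Suc p) (Suc q) \<phi>' \<psi>' \<sigma> = 0" if "singular_simplex (Suc p + Suc q) (top_of_set V) \<sigma>" for \<sigma>
    using b[OF singular_simplex_back_face[OF that]] by (simp add: cup_def \<psi>'_def)
  have 1: "is_cobd (Suc p + Suc q) ?X (cup (Suc p) (Suc q) \<phi>' \<psi>')"
    using open_pair_cocycle_is_coboundary[OF UV is_cocycle_cup[OF c] U V] unfolding is_cobd_def by blast
  \<comment> \<open>The original product is that of \<open>\<phi>'\<close> and
    \<open>\<psi>'\<close>, plus the products of \<open>cobd (Suc p) a\<close> with \<psi> and of
    \<open>\<phi>'\<close> with \<open>cobd (Suc q) b\<close>; the latter two are coboundaries by
    the Leibniz rule.\<close>
  have 2: "is_cobd (Suc p + Suc q) ?X (cup (Suc p) (Suc q) (cobd (Suc p) a) \<psi>)"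
    by (rule is_cobd_cup_left[OF is_cobdI \<psi>(1)]) simp
  have 3: "is_cobd (Suc p + Suc q) ?X (cup (Suc p) (Suc q) \<phi>' (cobd (Suc q) b))"
    by (rule is_cobd_cup_right[OF c(1) is_cobdI]) simp
  have 12: "is_cobd (Suc p + Suc q) ?X
      (\<lambda>\<sigma>. cup (Suc p) (Suc q) \<phi>' \<psi>' \<sigma> + cup (Suc p) (Suc q) (cobd (Suc p) a) \<psi> \<sigma>)"
    by (rule is_cobd_lincomb[OF 1 2, where k = 1 and l = 1]) simp
  show ?thesis
    by (rule is_cobd_lincomb[OF 12 3, where k = 1 and l = 1])
      (simp add: cup_def \<phi>'_def \<psi>'_def algebra_simps)
qed

lemma cup_simplex_map:
  "cup p q \<phi> \<psi> (simplex_map (p + q) f \<sigma>) =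
    cup p q (\<lambda>\<tau>. \<phi> (simplex_map p f \<tau>)) (\<lambda>\<tau>. \<psi> (simplex_map q f \<tau>)) \<sigma>"
proof -
  have "front_face p (simplex_map (p + q) f \<sigma>) = simplex_map p f (front_face p \<sigma>)"
    using standard_simplex_mono[of p "p + q"] by (auto simp: front_face_def simplex_map_def fun_eq_iff)
  moreover have "back_face p q (simplex_map (p + q) f \<sigma>) = simplex_map q f (back_face p q \<sigma>)"
    using vertex_shift_in_standard_simplex by (auto simp: back_face_def simplex_map_def fun_eq_iff)
  ultimately show ?thesis by (simp add: cup_def)
qed

section \<open>Cohomology groups\<close>

lemma carrier_cochain_group: "carrier (cochain_group q X) = extensional (singular_simplex_set q X)"
  by (simp add: cochain_group_def PiE_def)

lemma mult_cochain_group: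
  "\<phi> \<otimes>\<^bsub>cochain_group q X\<^esub> \<psi> = (\<lambda>\<sigma>\<in>singular_simplex_set q X. \<phi> \<sigma> + \<psi> \<sigma>)"
  by (simp add: cochain_group_def product_group_def)

lemma one_cochain_group: "\<one>\<^bsub>cochain_group q X\<^esub> = (\<lambda>\<sigma>\<in>singular_simplex_set q X. 0)"
  by (simp add: cochain_group_def product_group_def)

lemma group_cochain_group: "group (cochain_group q X)"
  unfolding cochain_group_def by simp

lemma coboundary_eq_cobd: "coboundary q X \<phi> = (\<lambda>\<sigma>\<in>singular_simplex_set (Suc q) X. cobd (Suc q) \<phi> \<sigma>)"
  by (simp add: coboundary_def cobd_def)

lemma coboundary_hom: "coboundary q X \<in> hom (cochain_group q X) (cochain_group (Suc q) X)"
proof (rule homI)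
  fix \<phi> show "coboundary q X \<phi> \<in> carrier (cochain_group (Suc q) X)"
    by (simp add: carrier_cochain_group coboundary_eq_cobd)
next
  fix \<phi> \<psi>
  have "cobd (Suc q) (\<lambda>\<sigma>\<in>singular_simplex_set q X. \<phi> \<sigma> + \<psi> \<sigma>) \<sigma> = cobd (Suc q) \<phi> \<sigma> + cobd (Suc q) \<psi> \<sigma>"
    if "singular_simplex (Suc q) X \<sigma>" for \<sigma>
    unfolding cobd_add[symmetric] using that by (rule cobd_cong) simp
  then show "coboundary q X (\<phi> \<otimes>\<^bsub>cochain_group q X\<^esub> \<psi>) =
      coboundary q X \<phi> \<otimes>\<^bsub>cochain_group (Suc q) X\<^esub> coboundary q X \<psi>"
    by (auto simp: mult_cochain_group coboundary_eq_cobd fun_eq_iff)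
qed

lemma singular_cocycle_set_eq:
  "singular_cocycle_set q X = {\<phi> \<in> extensional (singular_simplex_set q X). is_cocycle q X \<phi>}"
  by (auto simp: singular_cocycle_set_def kernel_def carrier_cochain_group one_cochain_group
      coboundary_eq_cobd is_cocycle_def fun_eq_iff)

lemma subgroup_cocycle_set: "subgroup (singular_cocycle_set q X) (cochain_group q X)"
proof -
  interpret group_hom "cochain_group q X" "cochain_group (Suc q) X" "coboundary q X"
    using group_cochain_group coboundary_hom
    unfolding group_hom_def group_hom_axioms_def by blast
  show ?thesis unfolding singular_cocycle_set_def by (rule subgroup_kernel)
qed

lemma carrier_cocycle_group:
  "carrier (cocycle_group q X) = {\<phi> \<in> extensional (singular_simplex_set q X). is_cocycle q X \<phi>}"
  unfolding cocycle_group_def singular_cocycle_set_eq[symmetric]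
  by (rule subgroup.carrier_subgroup_generated_subgroup[OF subgroup_cocycle_set])

lemma mult_cocycle_group: "\<phi> \<otimes>\<^bsub>cocycle_group q X\<^esub> \<psi> = (\<lambda>\<sigma>\<in>singular_simplex_set q X. \<phi> \<sigma> + \<psi> \<sigma>)"
  by (simp add: cocycle_group_def mult_cochain_group)

lemma one_cocycle_group: "\<one>\<^bsub>cocycle_group q X\<^esub> = (\<lambda>\<sigma>\<in>singular_simplex_set q X. 0)"
  by (simp add: cocycle_group_def one_cochain_group)

lemma group_cocycle_group: "group (cocycle_group q X)"
  unfolding cocycle_group_def
  by (intro group.group_subgroup_generated group_cochain_group)

lemma comm_group_cocycle_group: "comm_group (cocycle_group q X)"
  by (rule group.group_comm_groupI[OF group_cocycle_group]) (simp add: mult_cocycle_group add.commute)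

text \<open>In degree \<open>0\<close> both sides contain only the zero cochain. In positive degree
  a primitive can be cut down to an extensional one, as its coboundary on simplices of
  \<open>X\<close> depends only on values on simplices of \<open>X\<close>.\<close>

lemma singular_coboundary_set_eq:
  "singular_coboundary_set q X = {\<phi> \<in> extensional (singular_simplex_set q X). is_cobd q X \<phi>}"
proof (cases q)
  case 0
  then show ?thesis
    by (auto simp: singular_coboundary_set_def one_cochain_group is_cobd_def fun_eq_iff extensional_def)
next
  case (Suc r)
  have "\<phi> \<in> coboundary r X ` carrier (cochain_group r X)"
    if ext: "\<phi> \<in> extensional (singular_simplex_set q X)" and cobd: "is_cobd q X \<phi>" for \<phi>
  proof -
    obtain \<psi> where \<psi>: "\<And>\<sigma>. singular_simplex q X \<sigma> \<Longrightarrow> \<phi> \<sigma> = cobd q \<psi> \<sigma>" using cobd by (auto simp: is_cobd_def)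
    have "cobd q (\<lambda>\<tau>\<in>singular_simplex_set r X. \<psi> \<tau>) \<sigma> = cobd q \<psi> \<sigma>" if "singular_simplex q X \<sigma>" for \<sigma>
      using that by (rule cobd_cong) (simp add: Suc)
    then have "\<phi> = coboundary r X (\<lambda>\<tau>\<in>singular_simplex_set r X. \<psi> \<tau>)"
      using ext \<psi> Suc by (auto simp: coboundary_eq_cobd fun_eq_iff extensional_def)
    then show ?thesis by (simp add: carrier_cochain_group)
  qed
  moreover have "is_cobd q X (coboundary r X \<psi>)" for \<psi>
    by (rule is_cobdI[where \<psi> = \<psi>]) (simp add: coboundary_eq_cobd Suc)
  ultimately show ?thesis
    using Suc by (auto simp: singular_coboundary_set_def coboundary_eq_cobd)
qed

lemma subgroup_coboundary_set: "subgroup (singular_coboundary_set q X) (cocycle_group q X)"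
proof (rule group.subgroupI[OF group_cocycle_group])
  have "is_cocycle q X \<phi>" if "is_cobd q X \<phi>" for \<phi>
    using that is_rcobd_imp_is_cocycle is_cobd_imp_is_rcobd by blast
  then show sub: "singular_coboundary_set q X \<subseteq> carrier (cocycle_group q X)"
    by (auto simp: singular_coboundary_set_eq carrier_cocycle_group)
  have "(\<lambda>\<sigma>\<in>singular_simplex_set q X. 0) \<in> singular_coboundary_set q X"
    unfolding singular_coboundary_set_eq by (auto intro: is_cobd_cong[OF is_cobd_zero])
  then show "singular_coboundary_set q X \<noteq> {}" by blast
  fix \<phi> assume \<phi>: "\<phi> \<in> singular_coboundary_set q X"
  let ?m = "\<lambda>\<sigma>\<in>singular_simplex_set q X. - \<phi> \<sigma>"
  have "is_cobd q X ?m"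
    by (rule is_cobd_lincomb[of q X \<phi> \<phi> _ "-1" 0]) (use \<phi> in \<open>auto simp: singular_coboundary_set_eq\<close>)
  then have m: "?m \<in> singular_coboundary_set q X" by (simp add: singular_coboundary_set_eq)
  have "inv\<^bsub>cocycle_group q X\<^esub> \<phi> = ?m"
    by (rule group.inv_equality[OF group_cocycle_group])
      (use \<phi> m sub in \<open>auto simp: mult_cocycle_group one_cocycle_group fun_eq_iff\<close>)
  then show "inv\<^bsub>cocycle_group q X\<^esub> \<phi> \<in> singular_coboundary_set q X" using m by simp
  fix \<psi> assume \<psi>: "\<psi> \<in> singular_coboundary_set q X"
  have "is_cobd q X (\<phi> \<otimes>\<^bsub>cocycle_group q X\<^esub> \<psi>)"
    by (rule is_cobd_lincomb[of q X \<phi> \<psi> _ 1 1])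
      (use \<phi> \<psi> in \<open>auto simp: singular_coboundary_set_eq mult_cocycle_group\<close>)
  then show "\<phi> \<otimes>\<^bsub>cocycle_group q X\<^esub> \<psi> \<in> singular_coboundary_set q X"
    by (simp add: singular_coboundary_set_eq mult_cocycle_group)
qed

lemma group_cohomology_group: "group (cohomology_group q X)"
  unfolding cohomology_group_def
  using comm_group.subgroup_imp_normal[OF comm_group_cocycle_group subgroup_coboundary_set]
  by (rule normal.factorgroup_is_group)

text \<open>A cocycle may have many parameters, but two of them differ by a parameter of the zero
  cochain, which \<pi> sends to the identity. So a chosen parameter followed by \<pi> is a
  homomorphism on cocycles with the coboundaries as kernel, and the first isomorphism theorem
  applies.\<close>

lemma cohomology_group_iso:
  fixes \<pi> :: "'v::ab_group_add \<Rightarrow> 'g"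
  assumes R: "cohomology_param q X R K" and G: "group G" and \<pi>: "range \<pi> = carrier G"
    and add: "\<And>a b. \<pi> (a + b) = \<pi> a \<otimes>\<^bsub>G\<^esub> \<pi> b" and K: "\<And>a. \<pi> a = \<one>\<^bsub>G\<^esub> \<longleftrightarrow> a \<in> K"
  shows "cohomology_group q X \<cong> G"
proof -
  let ?Z = "cocycle_group q X"
  have total: "\<exists>a. R \<phi> a" if "is_cocycle q X \<phi>" for \<phi> using R that unfolding cohomology_param_def by blast
  have onto: "\<exists>\<phi>. is_cocycle q X \<phi> \<and> R \<phi> a" for a using R unfolding cohomology_param_def by blast
  have diff: "R (\<lambda>\<sigma>. \<phi> \<sigma> - \<psi> \<sigma>) (a - b)" if "R \<phi> a" "R \<psi> b" for \<phi> \<psi> a b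
    using R that unfolding cohomology_param_def by blast
  have ker: "is_cobd q X \<phi> \<longleftrightarrow> \<pi> a = \<one>\<^bsub>G\<^esub>" if "is_cocycle q X \<phi>" "R \<phi> a" for \<phi> a
    using R that unfolding cohomology_param_def K by blast
  have eqI: "\<pi> a = \<pi> b" if "\<pi> (a - b) = \<one>\<^bsub>G\<^esub>" for a b
  proof -
    have "\<pi> ((a - b) + b) = \<one>\<^bsub>G\<^esub> \<otimes>\<^bsub>G\<^esub> \<pi> b" using add that by metis
    moreover have "\<pi> b \<in> carrier G" using \<pi> by blast
    ultimately show ?thesis using G by (simp add: group.is_monoid monoid.l_one)
  qed
  define h where "h \<phi> = \<pi> (SOME a. R \<phi> a)" for \<phi>
  have h: "h \<phi> = \<pi> a" if "is_cocycle q X \<phi>" "R \<phi> a" for \<phi> a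
  proof -
    have "R \<phi> (SOME a. R \<phi> a)" using that(2) by (rule someI)
    from diff[OF this that(2)] have "\<pi> ((SOME a. R \<phi> a) - a) = \<one>\<^bsub>G\<^esub>"
      using ker[of "\<lambda>\<sigma>. \<phi> \<sigma> - \<phi> \<sigma>"] by simp
    then show ?thesis unfolding h_def by (rule eqI)
  qed
  have hom: "h \<in> hom ?Z G"
  proof (rule homI)
    fix \<phi> assume "\<phi> \<in> carrier ?Z"
    then show "h \<phi> \<in> carrier G" using \<pi> unfolding h_def by blast
  next
    fix \<phi> \<psi> assume \<phi>: "\<phi> \<in> carrier ?Z" and \<psi>: "\<psi> \<in> carrier ?Z"
    let ?s = "\<phi> \<otimes>\<^bsub>?Z\<^esub> \<psi>"
    have c: "is_cocycle q X \<phi>" "is_cocycle q X \<psi>" using \<phi> \<psi> by (auto simp: carrier_cocycle_group)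
    have cs: "is_cocycle q X ?s"
      by (rule is_cocycle_lincomb[OF c, where k = 1 and l = 1]) (simp add: mult_cocycle_group)
    obtain a b d where abd: "R \<phi> a" "R \<psi> b" "R ?s d" using total c cs by metis
    \<comment> \<open>The relation is compatible with differences, so additivity is read off from
      \<open>?s - \<phi> - \<psi>\<close>, which is zero on all simplices and has the parameter
      \<open>d - a - b\<close>.\<close>
    have "is_cobd q X (\<lambda>\<sigma>. ?s \<sigma> - \<phi> \<sigma> - \<psi> \<sigma>)"
      by (rule is_cobd_cong[OF is_cobd_zero]) (simp add: mult_cocycle_group)
    moreover have "is_cocycle q X (\<lambda>\<sigma>. ?s \<sigma> - \<phi> \<sigma> - \<psi> \<sigma>)"
      by (rule is_cocycle_cong[OF is_cocycle_zero]) (simp add: mult_cocycle_group)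
    ultimately have "\<pi> (d - a - b) = \<one>\<^bsub>G\<^esub>" using ker diff[OF diff[OF abd(3,1)] abd(2)] by blast
    then have "\<pi> d = \<pi> (a + b)" by (intro eqI) (simp add: algebra_simps)
    then show "h ?s = h \<phi> \<otimes>\<^bsub>G\<^esub> h \<psi>" using h[OF c(1) abd(1)] h[OF c(2) abd(2)] h[OF cs abd(3)] add by simp
  qed
  interpret group_hom ?Z G h
    using hom G group_cocycle_group unfolding group_hom_def group_hom_axioms_def by blast
  have onto_h: "h ` carrier ?Z = carrier G"
  proof (intro equalityI subsetI)
    fix y assume "y \<in> carrier G"
    then obtain a where "y = \<pi> a" using \<pi> by blast
    obtain \<phi> where \<phi>: "is_cocycle q X \<phi>" "R \<phi> a" using onto by blast
    \<comment> \<open>Elements of the group are extensional. Restricting changes nothing on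
      simplices, so the new parameter \<open>b\<close> has the same image under \<pi> as
      \<open>a\<close>.\<close>
    let ?\<phi> = "restrict \<phi> (singular_simplex_set q X)"
    have c: "is_cocycle q X ?\<phi>" by (rule is_cocycle_cong[OF \<phi>(1)]) simp
    obtain b where b: "R ?\<phi> b" using total[OF c] by blast
    have "is_cobd q X (\<lambda>\<sigma>. ?\<phi> \<sigma> - \<phi> \<sigma>)" "is_cocycle q X (\<lambda>\<sigma>. ?\<phi> \<sigma> - \<phi> \<sigma>)"
      by (rule is_cobd_cong[OF is_cobd_zero], simp) (rule is_cocycle_cong[OF is_cocycle_zero], simp)
    then have "\<pi> (b - a) = \<one>\<^bsub>G\<^esub>" using ker diff[OF b \<phi>(2)] by blast
    then have "\<pi> b = \<pi> a" by (rule eqI)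
    then have "h ?\<phi> = y" using h[OF c b] \<open>y = \<pi> a\<close> by simp
    then show "y \<in> h ` carrier ?Z" using c by (auto simp: carrier_cocycle_group intro!: image_eqI[of _ _ ?\<phi>])
  qed auto
  have "kernel ?Z G h = singular_coboundary_set q X"
  proof -
    have "h \<phi> = \<one>\<^bsub>G\<^esub> \<longleftrightarrow> is_cobd q X \<phi>" if "is_cocycle q X \<phi>" for \<phi>
      using total[OF that] h[OF that] ker[OF that] by auto
    moreover have "is_cocycle q X \<phi>" if "is_cobd q X \<phi>" for \<phi>
      using that is_rcobd_imp_is_cocycle is_cobd_imp_is_rcobd by blast
    ultimately show ?thesis
      by (auto simp: kernel_def carrier_cocycle_group singular_coboundary_set_eq)
  qed
  then show ?thesis
    using FactGroup_iso[OF onto_h] by (simp add: cohomology_group_def)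
qed

lemma trivial_group_cohomology_group:
  assumes "\<And>\<phi>. is_cocycle q X \<phi> \<Longrightarrow> is_cobd q X \<phi>"
  shows "trivial_group (cohomology_group q X)"
proof -
  have "cohomology_param q X (\<lambda>_ _. True) (UNIV :: int set)"
    unfolding cohomology_param_def using assms is_cocycle_zero by blast
  then have "cohomology_group q X \<cong> integer_mod_group 1"
    by (rule cohomology_group_iso[where \<pi> = "\<lambda>_. 0"]) (auto simp: carrier_integer_mod_group)
  then show ?thesis
    using isomorphic_group_triviality[OF _ group_cohomology_group, of q X "integer_mod_group 1"]
    by (simp add: trivial_integer_mod_group)
qed

section \<open>Cosets, products of classes and reduced classes\<close>

lemma cohomology_group_cosetE:
  assumes "a \<in> carrier (cohomology_group q X)"
  obtains \<phi> where "is_cocycle q X \<phi>" "\<phi> \<in> a" "\<And>\<psi>. \<psi> \<in> a \<Longrightarrow> is_cocycle q X \<psi>"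
proof -
  let ?Z = "cocycle_group q X" and ?B = "singular_coboundary_set q X"
  interpret group ?Z by (rule group_cocycle_group)
  interpret B: subgroup ?B ?Z by (rule subgroup_coboundary_set)
  obtain \<phi> where \<phi>: "\<phi> \<in> carrier ?Z" "a = ?B #>\<^bsub>?Z\<^esub> \<phi>"
    using assms by (auto simp: cohomology_group_def FactGroup_def RCOSETS_def)
  have "\<phi> \<in> a" unfolding \<phi>(2) by (rule rcos_self[OF \<phi>(1) subgroup_coboundary_set])
  moreover have "a \<subseteq> carrier ?Z" unfolding \<phi>(2) by (rule r_coset_subset_G[OF B.subset \<phi>(1)])
  ultimately show ?thesis using that[of \<phi>] \<phi>(1) by (auto simp: carrier_cocycle_group)
qed

lemma cohomology_class_self:
  assumes "\<phi> \<in> extensional (singular_simplex_set q X)" "is_cocycle q X \<phi>"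
  shows "\<phi> \<in> cohomology_class q X \<phi>"
  unfolding cohomology_class_def
  by (rule group.rcos_self[OF group_cocycle_group _ subgroup_coboundary_set])
    (use assms in \<open>simp add: carrier_cocycle_group\<close>)

lemma cohomology_class_coboundary:
  assumes "\<phi> \<in> singular_coboundary_set q X"
  shows "cohomology_class q X \<phi> = singular_coboundary_set q X"
  unfolding cohomology_class_def
  by (rule subgroup.rcos_const[OF subgroup_coboundary_set group_cocycle_group assms])

lemma one_cohomology_group: "\<one>\<^bsub>cohomology_group q X\<^esub> = singular_coboundary_set q X"
  by (simp add: cohomology_group_def FactGroup_def)

text \<open>The product is a union over representatives. Both classes are nonempty and every term of
  the union is the set of coboundaries, so the union is that set.\<close>

lemma cup_product_eq_one:
  assumes a: "a \<in> carrier (cohomology_group p X)" and b: "b \<in> carrier (cohomology_group q X)"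
    and cobd: "\<And>\<phi> \<psi>. \<phi> \<in> a \<Longrightarrow> \<psi> \<in> b \<Longrightarrow> is_cobd (p + q) X (cup p q \<phi> \<psi>)"
  shows "cup_product p q X a b = \<one>\<^bsub>cohomology_group (p + q) X\<^esub>"
proof -
  have "cohomology_class (p + q) X (cup_cochain p q X \<phi> \<psi>) = singular_coboundary_set (p + q) X"
    if "\<phi> \<in> a" "\<psi> \<in> b" for \<phi> \<psi>
  proof (rule cohomology_class_coboundary)
    have "is_cobd (p + q) X (cup_cochain p q X \<phi> \<psi>)"
      by (rule is_cobd_cong[OF cobd[OF that]]) (simp add: cup_cochain_def cup_def)
    then show "cup_cochain p q X \<phi> \<psi> \<in> singular_coboundary_set (p + q) X"
      by (simp add: singular_coboundary_set_eq cup_cochain_def)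
  qed
  moreover obtain \<phi> \<psi> where "\<phi> \<in> a" "\<psi> \<in> b"
    using cohomology_group_cosetE[OF a] cohomology_group_cosetE[OF b] by metis
  ultimately show ?thesis
    unfolding cup_product_def one_cohomology_group by (auto simp: SUP_eq_const)
qed

text \<open>In degree \<open>0\<close> the only coboundary of a point is zero, so a class that
  restricts to zero at the base point consists of cochains with value \<open>0\<close>
  there.\<close>

lemma reduced_cohomology_0_vanishes:
  assumes a: "a \<in> reduced_cohomology 0 X x" and x: "x \<in> topspace X" and \<phi>: "\<phi> \<in> a"
  shows "\<phi> (\<lambda>_\<in>standard_simplex 0. x) = 0"
proof -
  let ?X = "subtopology X {x}" and ?p = "\<lambda>_\<in>standard_simplex 0. x"
  have cocycle: "is_cocycle 0 X \<phi>"
    using a \<phi> cohomology_group_cosetE[of a 0 X] by (auto simp: reduced_cohomology_def kernel_def)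
  have "continuous_map ?X X id" by (simp add: continuous_map_from_subtopology)
  then have "is_cocycle 0 ?X (\<lambda>\<sigma>. \<phi> (simplex_map 0 id \<sigma>))" by (rule is_cocycle_pullback[OF cocycle])
  then have "is_cocycle 0 ?X (cochain_pullback 0 ?X id \<phi>)"
    by (rule is_cocycle_cong) (simp add: cochain_pullback_def)
  then have "cochain_pullback 0 ?X id \<phi> \<in> cohomology_class 0 ?X (cochain_pullback 0 ?X id \<phi>)"
    by (intro cohomology_class_self) (simp_all add: cochain_pullback_def)
  also have "\<dots> \<subseteq> cohomology_pullback 0 ?X id a" using \<phi> by (auto simp: cohomology_pullback_def)
  also have "\<dots> = singular_coboundary_set 0 ?X"
    using a by (simp add: reduced_cohomology_def kernel_def one_cohomology_group)
  finally have "is_cobd 0 ?X (cochain_pullback 0 ?X id \<phi>)"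
    by (simp only: singular_coboundary_set_eq mem_Collect_eq)
  moreover have "singular_simplex 0 ?X ?p" using x by (simp add: singular_simplex_def)
  ultimately have "\<phi> (simplex_map 0 id ?p) = 0" by (auto simp: is_cobd_def cochain_pullback_def)
  then show ?thesis by simp
qed

section \<open>Transport along homeomorphisms\<close>

lemma is_cobd_homeomorphic:
  assumes "continuous_map X Y f" "\<And>x. x \<in> topspace X \<Longrightarrow> g (f x) = x"
    and "is_cobd q Y (\<lambda>\<sigma>. \<phi> (simplex_map q g \<sigma>))"
  shows "is_cobd q X \<phi>"
proof (rule is_cobd_cong[OF is_cobd_pullback[OF assms(3,1)]])
  fix \<sigma> assume "singular_simplex q X \<sigma>"
  then have "simplex_map q (g \<circ> f) \<sigma> = \<sigma>" by (rule simplex_map_id_gen) (simp add: assms(2))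
  then show "\<phi> \<sigma> = \<phi> (simplex_map q g (simplex_map q f \<sigma>))" by (simp add: simplex_map_simplex_map)
qed

lemma is_rcobd_homeomorphic:
  assumes "continuous_map X Y f" "\<And>x. x \<in> topspace X \<Longrightarrow> g (f x) = x"
    and "is_rcobd q Y (\<lambda>\<sigma>. \<phi> (simplex_map q g \<sigma>))"
  shows "is_rcobd q X \<phi>"
  using assms(3) is_cobd_homeomorphic[OF assms(1,2), of q "\<lambda>\<sigma>. \<phi> \<sigma> - k" for k] unfolding is_rcobd_def by blast

lemma cohomology_param_homeomorphic:
  assumes f: "continuous_map X Y f" and g: "continuous_map Y X g"
    and gf: "\<And>x. x \<in> topspace X \<Longrightarrow> g (f x) = x" and fg: "\<And>y. y \<in> topspace Y \<Longrightarrow> f (g y) = y"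
    and R: "cohomology_param q Y R K"
  shows "cohomology_param q X (\<lambda>\<phi> a. \<exists>\<psi>. R \<psi> a \<and> is_cocycle q Y \<psi> \<and>
    (\<forall>\<sigma>. singular_simplex q X \<sigma> \<longrightarrow> \<phi> \<sigma> = \<psi> (simplex_map q f \<sigma>))) K"
    (is "cohomology_param q X ?R K")
  unfolding cohomology_param_def
proof (intro conjI allI impI)
  have gf_simplex: "simplex_map q g (simplex_map q f \<sigma>) = \<sigma>" if "singular_simplex q X \<sigma>" for \<sigma>
    unfolding simplex_map_simplex_map using that by (rule simplex_map_id_gen) (simp add: gf)
  have fg_simplex: "simplex_map q f (simplex_map q g \<sigma>) = \<sigma>" if "singular_simplex q Y \<sigma>" for \<sigma>
    unfolding simplex_map_simplex_map using that by (rule simplex_map_id_gen) (simp add: fg)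
  show "\<exists>a. ?R \<phi> a" if \<phi>: "is_cocycle q X \<phi>" for \<phi>
  proof -
    have c: "is_cocycle q Y (\<lambda>\<sigma>. \<phi> (simplex_map q g \<sigma>))" using \<phi> g by (rule is_cocycle_pullback)
    then obtain a where "R (\<lambda>\<sigma>. \<phi> (simplex_map q g \<sigma>)) a" using R unfolding cohomology_param_def by blast
    then show ?thesis
      using c gf_simplex by (intro exI[of _ a] exI[of _ "\<lambda>\<sigma>. \<phi> (simplex_map q g \<sigma>)"]) simp
  qed
  show "\<exists>\<phi>. is_cocycle q X \<phi> \<and> ?R \<phi> a" for a
  proof -
    obtain \<psi> where \<psi>: "is_cocycle q Y \<psi>" "R \<psi> a" using R unfolding cohomology_param_def by blast
    have "is_cocycle q X (\<lambda>\<sigma>. \<psi> (simplex_map q f \<sigma>))" using \<psi>(1) f by (rule is_cocycle_pullback)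
    then show ?thesis using \<psi> by blast
  qed
  show "?R (\<lambda>\<sigma>. \<phi> \<sigma> - \<psi> \<sigma>) (a - b)" if \<phi>: "?R \<phi> a" and \<psi>: "?R \<psi> b" for \<phi> \<psi> a b
  proof -
    obtain \<phi>' where 1: "R \<phi>' a" "is_cocycle q Y \<phi>'" "\<And>\<sigma>. singular_simplex q X \<sigma> \<Longrightarrow> \<phi> \<sigma> = \<phi>' (simplex_map q f \<sigma>)"
      using \<phi> by blast
    obtain \<psi>' where 2: "R \<psi>' b" "is_cocycle q Y \<psi>'" "\<And>\<sigma>. singular_simplex q X \<sigma> \<Longrightarrow> \<psi> \<sigma> = \<psi>' (simplex_map q f \<sigma>)"
      using \<psi> by blast
    have "R (\<lambda>\<sigma>. \<phi>' \<sigma> - \<psi>' \<sigma>) (a - b)" using R 1(1) 2(1) unfolding cohomology_param_def by blast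
    moreover have "is_cocycle q Y (\<lambda>\<sigma>. \<phi>' \<sigma> - \<psi>' \<sigma>)"
      by (rule is_cocycle_lincomb[OF 1(2) 2(2), where k = 1 and l = "-1"]) simp
    ultimately show ?thesis using 1(3) 2(3) by (intro exI[of _ "\<lambda>\<sigma>. \<phi>' \<sigma> - \<psi>' \<sigma>"]) simp
  qed
  show "is_cobd q X \<phi> \<longleftrightarrow> a \<in> K" if \<phi>: "is_cocycle q X \<phi>" and a: "?R \<phi> a" for \<phi> a
  proof -
    obtain \<psi> where \<psi>: "R \<psi> a" "is_cocycle q Y \<psi>" "\<And>\<sigma>. singular_simplex q X \<sigma> \<Longrightarrow> \<phi> \<sigma> = \<psi> (simplex_map q f \<sigma>)"
      using a by blast
    have "is_cobd q X \<phi> \<longleftrightarrow> is_cobd q Y \<psi>"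
    proof
      assume "is_cobd q Y \<psi>"
      from is_cobd_pullback[OF this f] show "is_cobd q X \<phi>" by (rule is_cobd_cong) (rule \<psi>(3))
    next
      assume "is_cobd q X \<phi>"
      from is_cobd_pullback[OF this g] show "is_cobd q Y \<psi>"
        by (rule is_cobd_cong) (simp add: \<psi>(3) fg_simplex singular_simplex_simplex_map[OF _ g])
    qed
    then show ?thesis using R \<psi>(1,2) unfolding cohomology_param_def by blast
  qed
qed

section \<open>Commuting pairs of matrices\<close>

text \<open>
  The matrix with rows \<open>(a + p\<i>, -r + s\<i>)\<close> and \<open>(r + s\<i>, a - p\<i>)\<close> is the unit quaternion with real
  part \<open>a\<close> and imaginary part \<open>(p, r, s)\<close>.
\<close>

definition quat_of_matrix :: "complex^2^2 \<Rightarrow> quat"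
  where "quat_of_matrix A = (((Im (A$1$1), Re (A$2$1)), Im (A$2$1)), Re (A$1$1))"

definition matrix_of_quat :: "quat \<Rightarrow> complex^2^2"
  where "matrix_of_quat w = (\<chi> i j.
    if i = 1 then if j = 1 then Complex (snd w) (fst (fst (fst w))) else Complex (- snd (fst (fst w))) (snd (fst w))
    else if j = 1 then Complex (snd (fst (fst w))) (snd (fst w)) else Complex (snd w) (- fst (fst (fst w))))"

lemma matrix_of_quat_nth:
  "matrix_of_quat (((p, r), s), a) $ 1 $ 1 = Complex a p" "matrix_of_quat (((p, r), s), a) $ 1 $ 2 = Complex (- r) s"
  "matrix_of_quat (((p, r), s), a) $ 2 $ 1 = Complex r s" "matrix_of_quat (((p, r), s), a) $ 2 $ 2 = Complex a (- p)"
  by (simp_all add: matrix_of_quat_def)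

lemma quat_of_matrix_of_quat [simp]: "quat_of_matrix (matrix_of_quat w) = w"
  by (cases w) (auto simp: quat_of_matrix_def matrix_of_quat_nth)

lemma norm_quat: "norm (((p, r), s), a :: real) = sqrt (p\<^sup>2 + r\<^sup>2 + s\<^sup>2 + a\<^sup>2)" for p r s :: real
  by (simp add: norm_Pair)

lemma matrix_of_quat_in_SU2:
  assumes "norm w = 1"
  shows "matrix_of_quat w \<in> SU2"
proof -
  obtain p r s a where w: "w = (((p, r), s), a)" by (metis surj_pair)
  have "p\<^sup>2 + r\<^sup>2 + s\<^sup>2 + a\<^sup>2 = 1" using assms by (simp add: w norm_quat)
  then show ?thesis
    by (simp add: SU2_def w vec_eq_iff forall_2 matrix_matrix_mult_def sum_2 conjugate_transpose_def mat_def det_2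
        matrix_of_quat_nth complex_eq_iff power2_eq_square algebra_simps)
qed

text \<open>Unitarity says that the conjugate transpose is the inverse, and determinant one that the
  adjugate is; the calculations compare their entries by inserting a factor \<open>1\<close> in one
  of these two forms.\<close>

lemma SU2_entries:
  assumes "A \<in> SU2"
  shows "A$2$2 = cnj (A$1$1)" "A$1$2 = - cnj (A$2$1)" "A$1$1 * cnj (A$1$1) + A$1$2 * cnj (A$1$2) = 1"
proof -
  let ?a = "A$1$1" and ?b = "A$1$2" and ?c = "A$2$1" and ?d = "A$2$2"
  have u: "?a * cnj ?a + ?b * cnj ?b = 1" "?c * cnj ?a + ?d * cnj ?b = 0" "?a * ?d - ?b * ?c = 1"
    using assms
    by (simp_all add: SU2_def vec_eq_iff forall_2 matrix_matrix_mult_def sum_2 conjugate_transpose_def mat_def det_2)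
  show "?a * cnj ?a + ?b * cnj ?b = 1" by (rule u)
  have "?d = ?d * (?a * cnj ?a + ?b * cnj ?b)" unfolding u by simp
  also have "\<dots> = cnj ?a * (?a * ?d - ?b * ?c) + ?b * (?c * cnj ?a + ?d * cnj ?b)" by (simp add: algebra_simps)
  also have "\<dots> = cnj ?a" unfolding u by simp
  finally show "?d = cnj ?a" .
  have "cnj ?b = cnj ?b * (?a * ?d - ?b * ?c)" unfolding u by simp
  also have "\<dots> = ?a * (?c * cnj ?a + ?d * cnj ?b) - ?c * (?a * cnj ?a + ?b * cnj ?b)" by (simp add: algebra_simps)
  also have "\<dots> = - ?c" unfolding u by simp
  finally have "cnj ?b = - ?c" .
  then have "cnj (cnj ?b) = cnj (- ?c)" by simp
  then show "?b = - cnj ?c" by simp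
qed

lemma SU2_quat:
  assumes "A \<in> SU2"
  shows "matrix_of_quat (quat_of_matrix A) = A" "norm (quat_of_matrix A) = 1"
proof -
  note e = SU2_entries[OF assms]
  show "matrix_of_quat (quat_of_matrix A) = A"
    by (simp add: vec_eq_iff forall_2 quat_of_matrix_def matrix_of_quat_nth complex_eq_iff e(1,2))
  have "Re (A$1$1 * cnj (A$1$1) + A$1$2 * cnj (A$1$2)) = 1" by (simp only: e(3) one_complex.sel)
  then show "norm (quat_of_matrix A) = 1"
    by (simp add: quat_of_matrix_def norm_quat e(2) power2_eq_square algebra_simps)
qed

lemma SU2_matrix_inv:
  assumes "A \<in> SU2"
  shows "A ** matrix_inv A = mat 1" "matrix_inv A ** A = mat 1"
proof -
  have "A ** conjugate_transpose A = mat 1" using assms by (simp add: SU2_def)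
  then have "\<exists>B. A ** B = mat 1 \<and> B ** A = mat 1" using matrix_left_right_inverse by blast
  from someI_ex[OF this] show "A ** matrix_inv A = mat 1" "matrix_inv A ** A = mat 1"
    by (simp_all add: matrix_inv_def)
qed

lemma commutator_eq_1_iff:
  assumes "g \<in> SU2" "h \<in> SU2"
  shows "g ** h ** matrix_inv g ** matrix_inv h = mat 1 \<longleftrightarrow> g ** h = h ** g"
proof
  note inv = SU2_matrix_inv[OF assms(1)] SU2_matrix_inv[OF assms(2)]
  assume "g ** h ** matrix_inv g ** matrix_inv h = mat 1"
  then have "g ** h ** matrix_inv g ** matrix_inv h ** (h ** g) = h ** g" by simp
  moreover have "g ** h ** matrix_inv g ** matrix_inv h ** (h ** g) =
      g ** h ** (matrix_inv g ** (matrix_inv h ** h) ** g)"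
    by (simp only: matrix_mul_assoc)
  ultimately show "g ** h = h ** g" by (simp add: inv)
next
  note inv = SU2_matrix_inv[OF assms(1)] SU2_matrix_inv[OF assms(2)]
  assume "g ** h = h ** g"
  then have "g ** h ** matrix_inv g ** matrix_inv h = h ** (g ** matrix_inv g) ** matrix_inv h"
    by (simp add: matrix_mul_assoc)
  then show "g ** h ** matrix_inv g ** matrix_inv h = mat 1" unfolding inv by (simp add: inv)
qed

text \<open>Real parts are central, so commuting depends on the imaginary parts alone: their cross
  product has to vanish, that is, they are linearly dependent.\<close>

lemma matrix_of_quat_commute_iff:
  "matrix_of_quat w ** matrix_of_quat w' = matrix_of_quat w' ** matrix_of_quat w \<longleftrightarrow>
    fst w = 0 \<or> (\<exists>c. fst w' = c *\<^sub>R fst w)"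
proof -
  obtain p r s a where w: "w = (((p, r), s), a)" by (metis surj_pair)
  obtain p' r' s' a' where w': "w' = (((p', r'), s'), a')" by (metis surj_pair)
  have "matrix_of_quat w ** matrix_of_quat w' = matrix_of_quat w' ** matrix_of_quat w \<longleftrightarrow>
      p * r' = r * p' \<and> p * s' = s * p' \<and> r * s' = s * r'"
    by (auto simp: w w' vec_eq_iff forall_2 matrix_matrix_mult_def sum_2 matrix_of_quat_nth complex_eq_iff algebra_simps)
  also have "\<dots> \<longleftrightarrow> (p = 0 \<and> r = 0 \<and> s = 0) \<or> (\<exists>c. p' = c * p \<and> r' = c * r \<and> s' = c * s)"
  proof
    assume *: "p * r' = r * p' \<and> p * s' = s * p' \<and> r * s' = s * r'"
    \<comment> \<open>The factor \<open>c\<close> is read off at a nonzero coordinate of the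
      imaginary part of \<open>w\<close>.\<close>
    consider "p \<noteq> 0" | "r \<noteq> 0" | "s \<noteq> 0" | "p = 0 \<and> r = 0 \<and> s = 0" by blast
    then show "(p = 0 \<and> r = 0 \<and> s = 0) \<or> (\<exists>c. p' = c * p \<and> r' = c * r \<and> s' = c * s)"
    proof cases
      case 1
      then have "p' = p' / p * p \<and> r' = p' / p * r \<and> s' = p' / p * s" using * by (simp add: field_simps)
      then show ?thesis by blast
    next
      case 2
      then have "p' = r' / r * p \<and> r' = r' / r * r \<and> s' = r' / r * s" using * by (simp add: field_simps)
      then show ?thesis by blast
    next
      case 3
      then have "p' = s' / s * p \<and> r' = s' / s * r \<and> s' = s' / s * s" using * by (simp add: field_simps)
      then show ?thesis by blast
    qed simp
  qed auto
  also have "\<dots> \<longleftrightarrow> fst w = 0 \<or> (\<exists>c. fst w' = c *\<^sub>R fst w)"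
    by (simp add: w w' zero_prod_def)
  finally show ?thesis .
qed

section \<open>The homeomorphism with the quaternionic model\<close>

lemma continuous_on_quat_of_matrix: "continuous_on S (\<lambda>x. quat_of_matrix (f x))" if "continuous_on S f"
  unfolding quat_of_matrix_def using that by (intro continuous_intros)

lemma continuous_on_matrix_of_quat: "continuous_on S (\<lambda>x. matrix_of_quat (f x))" if "continuous_on S f"
  unfolding matrix_of_quat_def
proof (intro continuous_on_vec_lambda)
  fix i j :: 2
  show "continuous_on S (\<lambda>x. if i = 1 then if j = 1 then Complex (snd (f x)) (fst (fst (fst (f x))))
      else Complex (- snd (fst (fst (f x)))) (snd (fst (f x)))
      else if j = 1 then Complex (snd (fst (fst (f x)))) (snd (fst (f x)))
      else Complex (snd (f x)) (- fst (fst (fst (f x)))))"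
    using that by (cases "i = 1"; cases "j = 1") (auto intro!: continuous_intros)
qed

abbreviation to_model where "to_model z \<equiv> (quat_of_matrix (fst z), quat_of_matrix (snd z))"
abbreviation of_model where "of_model z \<equiv> (matrix_of_quat (fst z), matrix_of_quat (snd z))"

lemma to_model: "z \<in> commuting_pairs \<Longrightarrow> to_model z \<in> comm_model \<and> of_model (to_model z) = z"
  using matrix_of_quat_commute_iff[of "quat_of_matrix (fst z)" "quat_of_matrix (snd z)"]
  by (auto simp: commuting_pairs_def commutator_eq_1_iff comm_model_def SU2_quat)

lemma of_model:
  assumes "z \<in> comm_model"
  shows "of_model z \<in> commuting_pairs"
proof -
  have "matrix_of_quat (fst z) \<in> SU2" "matrix_of_quat (snd z) \<in> SU2"
    using assms by (auto simp: comm_model_def intro: matrix_of_quat_in_SU2)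
  moreover from this have "matrix_of_quat (fst z) ** matrix_of_quat (snd z) ** matrix_inv (matrix_of_quat (fst z)) **
      matrix_inv (matrix_of_quat (snd z)) = mat 1"
    unfolding commutator_eq_1_iff[OF calculation] matrix_of_quat_commute_iff
    using assms by (simp add: comm_model_def)
  ultimately show ?thesis by (simp add: commuting_pairs_def)
qed

lemma continuous_map_to_model: "continuous_map commuting_pairs_space (top_of_set comm_model) (\<lambda>z. to_model z)"
  using to_model unfolding commuting_pairs_space_def
  by (auto intro!: continuous_intros continuous_on_quat_of_matrix)

lemma continuous_map_of_model: "continuous_map (top_of_set comm_model) commuting_pairs_space (\<lambda>z. of_model z)"
  using of_model unfolding commuting_pairs_space_def
  by (auto intro!: continuous_intros continuous_on_matrix_of_quat)

theorem lemma4p12: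
  shows "(\<forall>q\<in>{0, 2}. cohomology_group q commuting_pairs_space \<cong> integer_group) \<and>
    cohomology_group 3 commuting_pairs_space \<cong> integer_group \<times>\<times> integer_group \<and>
    cohomology_group 4 commuting_pairs_space \<cong> integer_mod_group 2 \<and>
    (\<forall>q. q \<notin> {0, 2, 3, 4} \<longrightarrow> trivial_group (cohomology_group q commuting_pairs_space)) \<and>
    (\<forall>x\<^sub>0\<in>commuting_pairs. \<forall>p q.
      \<forall>a\<in>reduced_cohomology p commuting_pairs_space x\<^sub>0.
      \<forall>b\<in>reduced_cohomology q commuting_pairs_space x\<^sub>0.
        cup_product p q commuting_pairs_space a b = \<one>\<^bsub>cohomology_group (p + q) commuting_pairs_space\<^esub>)"
proof -
  let ?X = commuting_pairs_space
  let ?Y = "top_of_set (modelU 1 \<union> modelU (-1) :: (quat \<times> quat) set)"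
  obtain \<omega> \<kappa> \<beta> \<eta> where
    "double_cover_gluing (Suc 0) (modelU 1) (modelU (-1) :: (quat \<times> quat) set) \<omega> \<kappa> \<beta> \<eta>"
    by (rule double_cover_gluing_model)
  then interpret T: double_cover_gluing "Suc 0" "modelU 1"
    "modelU (-1) :: (quat \<times> quat) set" \<omega> \<kappa> \<beta> \<eta> .
  have topspace: "topspace ?X = commuting_pairs" by (simp add: commuting_pairs_space_def)
  have f: "continuous_map ?X ?Y (\<lambda>z. to_model z)" and g: "continuous_map ?Y ?X (\<lambda>z. of_model z)"
    unfolding modelU_Un by (rule continuous_map_to_model, rule continuous_map_of_model)
  have gf: "of_model (to_model z) = z" if "z \<in> topspace ?X" for z
    using that to_model topspace by blast
  have fg: "to_model (of_model z) = z" for z by simp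
  note param = cohomology_param_homeomorphic[OF f g gf fg]
  note pullback = is_cocycle_pullback[OF _ g]
  have cobd: "is_cobd q ?X \<phi>" if "is_cobd q ?Y (\<lambda>\<sigma>. \<phi> (simplex_map q (\<lambda>z. of_model z) \<sigma>))" for q \<phi>
    by (rule is_cobd_homeomorphic[where g = "\<lambda>z. of_model z", OF f]) (use that gf in auto)
  have other: "is_cobd q ?X \<phi>" if q: "q \<notin> {0, 2, 3, 4}" and \<phi>: "is_cocycle q ?X \<phi>" for q \<phi>
  proof (rule cobd)
    let ?\<psi> = "\<lambda>\<sigma>. \<phi> (simplex_map q (\<lambda>z. of_model z) \<sigma>)"
    have \<psi>: "is_cocycle q ?Y ?\<psi>" by (rule pullback[OF \<phi>])
    show "is_cobd q ?Y ?\<psi>"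
    proof (cases "q = 1")
      case True
      then show ?thesis using T.Un_degree_1 \<psi> by simp
    next
      case False
      then obtain r where r: "q = Suc (Suc r)" using q by (metis One_nat_def insertI1 not0_implies_Suc)
      then have "r \<noteq> 0" "r \<noteq> Suc 0" "r \<noteq> Suc (Suc 0)" using q by auto
      then show ?thesis using T.Un_degree_other \<psi> unfolding r by blast
    qed
  qed
  have degree_0: "is_rcobd 0 ?X \<phi>" if "is_cocycle 0 ?X \<phi>" for \<phi>
    by (rule is_rcobd_homeomorphic[where g = "\<lambda>z. of_model z", OF f gf T.Un_degree_0[OF pullback[OF that]]])
  \<comment> \<open>The parameter of a \<open>0\<close>-cocycle is its constant value. That only the
    value \<open>0\<close> gives a coboundary needs an actual simplex, hence a commuting
    pair.\<close>
  have "cohomology_param 0 ?X (\<lambda>\<phi> k. \<forall>\<sigma>. singular_simplex 0 ?X \<sigma> \<longrightarrow> \<phi> \<sigma> = k) {0}"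
  proof -
    obtain z where "z \<in> commuting_pairs" using of_model T.nonempty modelU_Un by blast
    then have "singular_simplex 0 ?X (\<lambda>_\<in>standard_simplex 0. z)"
      unfolding commuting_pairs_space_def by (rule singular_simplex_const)
    moreover have "\<exists>k. \<forall>\<sigma>. singular_simplex 0 ?X \<sigma> \<longrightarrow> \<phi> \<sigma> = k" if "is_cocycle 0 ?X \<phi>" for \<phi>
      using degree_0[OF that] unfolding is_rcobd_0 .
    moreover have "\<exists>\<phi>. is_cocycle 0 ?X \<phi> \<and> (\<forall>\<sigma>. singular_simplex 0 ?X \<sigma> \<longrightarrow> \<phi> \<sigma> = k)" for k
      using is_cocycle_const by (intro exI[of _ "\<lambda>_. k"]) simp
    ultimately show ?thesis unfolding cohomology_param_def is_cobd_def by auto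
  qed
  then have H0: "cohomology_group 0 ?X \<cong> integer_group"
    by (rule cohomology_group_iso[where \<pi> = "\<lambda>k. k"]) auto
  have H2: "cohomology_group 2 ?X \<cong> integer_group"
    unfolding numeral_2_eq_2
    by (rule cohomology_group_iso[OF param[OF _ T.Un_degree_2], where \<pi> = "\<lambda>k. k"]) auto
  \<comment> \<open>With \<open>m = 1\<close> the degree \<open>Suc (Suc m)\<close> is
    \<open>3\<close>, and the degree after it, with the torsion, is \<open>4\<close>.\<close>
  have H3: "cohomology_group 3 ?X \<cong> integer_group \<times>\<times> integer_group"
    unfolding numeral_3_eq_3
  proof (rule cohomology_group_iso[OF param[OF _ T.Un_degree_Suc_Suc_m], where \<pi> = "\<lambda>a. a"])
    show "group (integer_group \<times>\<times> integer_group)" by (simp add: DirProd_group)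
  qed (auto simp: DirProd_def zero_prod_def)
  have "cohomology_group (Suc (Suc (Suc (Suc 0)))) ?X \<cong> integer_mod_group 2"
  proof (rule cohomology_group_iso[OF param[OF _ T.Un_degree_Suc_Suc_Suc_m], where \<pi> = "\<lambda>k. k mod 2"])
    have "k \<in> range (\<lambda>k. k mod 2)" if "k \<in> {0..<2}" for k :: int
      using that by (intro image_eqI[of _ _ k]) auto
    then show "range (\<lambda>k. k mod 2) = carrier (integer_mod_group 2)"
      by (auto simp: carrier_integer_mod_group)
  qed (auto simp: mod_add_eq even_iff_mod_2_eq_zero)
  then have H4: "cohomology_group 4 ?X \<cong> integer_mod_group 2" by (simp add: eval_nat_numeral)
  have cup: "is_cobd (p + q) ?X (cup p q \<phi> \<psi>)"
    if \<phi>: "is_cocycle p ?X \<phi>" and \<psi>: "is_cocycle q ?X \<psi>" and pq: "0 < p" "0 < q" for p q \<phi> \<psi>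
  proof -
    \<comment> \<open>If both factors have degree at least \<open>2\<close> and the total degree is
      at most \<open>4\<close>, both degrees are \<open>2\<close>.\<close>
    consider "p = 1" | "q = 1" | "p = 2" "q = 2" | "p + q \<notin> {0, 2, 3, 4}" using pq by fastforce
    then show ?thesis
    proof cases
      case 1
      then show ?thesis using is_cobd_cup_left[OF _ \<psi>, of 0 \<phi>] other[of 1] \<phi> by simp
    next
      case 2
      then show ?thesis using is_cobd_cup_right[OF \<phi>, of 0 \<psi>] other[of 1] \<psi> by simp
    next
      case 3
      let ?\<phi> = "\<lambda>\<sigma>. \<phi> (simplex_map 2 (\<lambda>z. of_model z) \<sigma>)" and ?\<psi> = "\<lambda>\<sigma>. \<psi> (simplex_map 2 (\<lambda>z. of_model z) \<sigma>)"
      have c: "is_cocycle (Suc (Suc 0)) ?Y ?\<phi>" "is_cocycle (Suc (Suc 0)) ?Y ?\<psi>"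
        using pullback[OF \<phi>] pullback[OF \<psi>] 3 by (simp_all add: numeral_2_eq_2)
      have "is_cobd (Suc (Suc 0) + Suc (Suc 0)) ?Y (cup (Suc (Suc 0)) (Suc (Suc 0)) ?\<phi> ?\<psi>)"
        using T.is_cobd_U[OF c(1)] T.is_cobd_V[OF c(2)] by (intro is_cobd_cup_open_pair[OF T.UV] c) auto
      then have "is_cobd (2 + 2) ?Y (cup 2 2 ?\<phi> ?\<psi>)" by (simp only: numeral_2_eq_2)
      then have "is_cobd (2 + 2) ?Y (\<lambda>\<sigma>. cup 2 2 \<phi> \<psi> (simplex_map (2 + 2) (\<lambda>z. of_model z) \<sigma>))"
        unfolding cup_simplex_map .
      then show ?thesis unfolding 3 by (rule cobd)
    next
      case 4
      then show ?thesis using other is_cocycle_cup[OF \<phi> \<psi>] by blast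
    qed
  qed
  have "cup_product p q ?X a b = \<one>\<^bsub>cohomology_group (p + q) ?X\<^esub>"
    if x: "x \<in> commuting_pairs" and a: "a \<in> reduced_cohomology p ?X x" and b: "b \<in> reduced_cohomology q ?X x"
    for x p q a b
  proof (rule cup_product_eq_one)
    show carrier: "a \<in> carrier (cohomology_group p ?X)" "b \<in> carrier (cohomology_group q ?X)"
      using a b by (simp_all add: reduced_cohomology_def kernel_def)
    fix \<phi> \<psi> assume \<phi>: "\<phi> \<in> a" and \<psi>: "\<psi> \<in> b"
    have c: "is_cocycle p ?X \<phi>" "is_cocycle q ?X \<psi>"
      using cohomology_group_cosetE[OF carrier(1)] cohomology_group_cosetE[OF carrier(2)] \<phi> \<psi> by metis+
    \<comment> \<open>The cochains of a reduced class of degree \<open>0\<close> are constant, as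
      cocycles in degree \<open>0\<close> are, and have the value \<open>0\<close> at the base
      point; so they vanish on all points.\<close>
    have vanish: "\<theta> \<sigma> = 0"
      if d: "d \<in> reduced_cohomology 0 ?X x" "\<theta> \<in> d" and \<theta>: "is_cocycle 0 ?X \<theta>" and \<sigma>: "singular_simplex 0 ?X \<sigma>"
      for d \<theta> \<sigma>
    proof -
      obtain k where k: "\<And>\<sigma>. singular_simplex 0 ?X \<sigma> \<Longrightarrow> \<theta> \<sigma> = k"
        using degree_0[OF \<theta>] unfolding is_rcobd_0 by blast
      have "singular_simplex 0 ?X (\<lambda>_\<in>standard_simplex 0. x)"
        using x unfolding commuting_pairs_space_def by (rule singular_simplex_const)
      then have "k = 0" using k reduced_cohomology_0_vanishes[OF d(1) _ d(2)] x topspace by metis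
      then show ?thesis using k \<sigma> by blast
    qed
    show "is_cobd (p + q) ?X (cup p q \<phi> \<psi>)"
    proof (cases "p = 0 \<or> q = 0")
      case True
      have "cup p q \<phi> \<psi> \<sigma> = 0" if "singular_simplex (p + q) ?X \<sigma>" for \<sigma>
        using True vanish[of a \<phi>] vanish[of b \<psi>] a b \<phi> \<psi> c singular_simplex_front_face[OF that]
          singular_simplex_back_face[OF that]
        by (auto simp: cup_def)
      then show ?thesis by (rule is_cobd_cong[OF is_cobd_zero])
    qed (use cup c in auto)
  qed
  moreover have "trivial_group (cohomology_group q ?X)" if "q \<notin> {0, 2, 3, 4}" for q
    using other[OF that] by (rule trivial_group_cohomology_group)
  ultimately show ?thesis using H0 H2 H3 H4 by simp
qed

end
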